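(* Let $d\in\{1,2\}$ and let $p\in[0,1]$ with $p>p_c(\mathbb{G}_d)$, where $\mathbb{G}_d$ is the lamplighter Cayley graph over $\mathbb{Z}^d$. Let $\{X_n\}$ be the simple random walk, started at $o$, in the infinite cluster of $p$-Bernoulli bond percolation $\omega$ on $\mathbb{G}_d$. Then it has zero speed, that is, $$\lim_{n\to\infty}\frac{|X_n|_\omega}{n}=0$$ almost surely on the event that $o$ is in the infinite cluster.
   Context: The lamplighter graph $\mathbb{G}_d$ has vertex set $\{(m,\eta): m\in\mathbb{Z}^d,\ \eta\subset\mathbb{Z}^d \text{ finite}\}$. The neighbors of $(m,\eta)$ are $(m,\eta\,\triangle\,\{m\})$ (the lamp at $m$ is switched) and the $2d$ vertices $(m',\eta)$ with $m'$ a nearest neighbor of $m$ in $\mathbb{Z}^d$; thus every vertex has degree $2d+1$. The basepoint is $o=(0,\emptyset)$. In $p$-Bernoulli bond percolation, each edge is independently open with probability $p$ and closed with probability $1-p$; clusters are the connected components of the subgraph $\omega$ of open edges, and $p_c(\mathbb{G})=\inf\{p:\text{there is an infinite cluster a.s.}\}$. For $p>p_c(\mathbb{G}_d)$ there is a.s. a unique infinite cluster, since $\mathbb{G}_d$ is amenable. Simple random walk in the cluster moves at each step to a uniformly chosen neighbor in the cluster (along open edges). For $x$ in the open cluster containing $o$, $|x|_\omega$ is the graph distance in this cluster from $x$ to $o$. "Almost surely" refers to the joint law of the percolation and the walk. *)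

theory Defs
  imports "HOL-Probability.Probability" "HOL-Library.FSet"
begin

section \<open>Bernoulli bond percolation\<close>

text \<open>A graph on the vertex type is given by its symmetric irreflexive adjacency relation \<open>G\<close>;
  an edge is the unordered pair of its endpoints. A configuration \<open>\<omega>\<close> maps an edge to \<open>True\<close>
  iff the edge is open.\<close>

definition edges :: "('v \<Rightarrow> 'v \<Rightarrow> bool) \<Rightarrow> 'v set set" where
  "edges G = {{x, y} |x y. G x y}"

definition percolation :: "('v \<Rightarrow> 'v \<Rightarrow> bool) \<Rightarrow> real \<Rightarrow> ('v set \<Rightarrow> bool) measure" where
  "percolation G p = PiM (edges G) (\<lambda>_. measure_pmf (bernoulli_pmf p))"

definition open_adj :: "('v \<Rightarrow> 'v \<Rightarrow> bool) \<Rightarrow> ('v set \<Rightarrow> bool) \<Rightarrow> 'v \<Rightarrow> 'v \<Rightarrow> bool" where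
  "open_adj G \<omega> x y \<longleftrightarrow> G x y \<and> \<omega> {x, y}"

definition cluster :: "('v \<Rightarrow> 'v \<Rightarrow> bool) \<Rightarrow> ('v set \<Rightarrow> bool) \<Rightarrow> 'v \<Rightarrow> 'v set" where
  "cluster G \<omega> x = {y. (open_adj G \<omega>)\<^sup>*\<^sup>* x y}"

text \<open>Only meaningful if the two vertices lie in the same cluster.\<close>

definition cluster_dist :: "('v \<Rightarrow> 'v \<Rightarrow> bool) \<Rightarrow> ('v set \<Rightarrow> bool) \<Rightarrow> 'v \<Rightarrow> 'v \<Rightarrow> nat" where
  "cluster_dist G \<omega> x y = (LEAST n. (open_adj G \<omega> ^^ n) x y)"

definition critical_prob :: "('v \<Rightarrow> 'v \<Rightarrow> bool) \<Rightarrow> real" where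
  "critical_prob G = Inf {p \<in> {0..1}. AE \<omega> in percolation G p. \<exists>x. infinite (cluster G \<omega> x)}"


section \<open>Simple random walk in the open subgraph\<close>

definition open_nbrs :: "('v \<Rightarrow> 'v \<Rightarrow> bool) \<Rightarrow> ('v set \<Rightarrow> bool) \<Rightarrow> 'v \<Rightarrow> 'v set" where
  "open_nbrs G \<omega> x = {y. open_adj G \<omega> x y}"

text \<open>By convention the walk stays put at an isolated vertex of the open subgraph. The graph is
  meant to be locally finite, so that the set of open neighbours is finite.\<close>

definition walk_step :: "('v \<Rightarrow> 'v \<Rightarrow> bool) \<Rightarrow> ('v set \<Rightarrow> bool) \<Rightarrow> 'v \<Rightarrow> 'v pmf" where
  "walk_step G \<omega> x =
     (if open_nbrs G \<omega> x = {} then return_pmf x else pmf_of_set (open_nbrs G \<omega> x))"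

text \<open>The kernels for the Ionescu-Tulcea construction: the law of the position at time \<open>n\<close> given
  the positions \<open>h\<close> at times \<open>0, \<dots>, n - 1\<close>.\<close>

fun walk_kernel ::
  "('v \<Rightarrow> 'v \<Rightarrow> bool) \<Rightarrow> ('v set \<Rightarrow> bool) \<Rightarrow> 'v \<Rightarrow> nat \<Rightarrow> (nat \<Rightarrow> 'v) \<Rightarrow> 'v measure" where
  "walk_kernel G \<omega> x0 0 h = measure_pmf (return_pmf x0)"
| "walk_kernel G \<omega> x0 (Suc n) h = measure_pmf (walk_step G \<omega> (h n))"

abbreviation path_space :: "(nat \<Rightarrow> 'v) measure" where
  "path_space \<equiv> PiM UNIV (\<lambda>_. count_space UNIV)"

text \<open>The quenched law of the walk started at \<open>x0\<close>, as the projective limit of the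
  finite-dimensional laws determined by the kernels.\<close>

definition walk_law ::
  "('v \<Rightarrow> 'v \<Rightarrow> bool) \<Rightarrow> ('v set \<Rightarrow> bool) \<Rightarrow> 'v \<Rightarrow> (nat \<Rightarrow> 'v) measure" where
  "walk_law G \<omega> x0 =
     projective_family.lim UNIV
       (Ionescu_Tulcea.CI (walk_kernel G \<omega> x0) (\<lambda>_. count_space UNIV))
       (\<lambda>_. count_space UNIV)"

text \<open>The joint law of the configuration and the walk.\<close>

definition percolation_walk ::
  "('v \<Rightarrow> 'v \<Rightarrow> bool) \<Rightarrow> real \<Rightarrow> 'v \<Rightarrow> (('v set \<Rightarrow> bool) \<times> (nat \<Rightarrow> 'v)) measure" where
  "percolation_walk G p x0 =
     percolation G p \<bind>
       (\<lambda>\<omega>. distr (walk_law G \<omega> x0) (percolation G p \<Otimes>\<^sub>M path_space) (\<lambda>X. (\<omega>, X)))"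


section \<open>The lamplighter graph\<close>

text \<open>A vertex is the position of the lamplighter together with the finite set of lit lamps;
  \<open>d\<close> is the cardinality of the index type.\<close>

type_synonym 'd lamp_vertex = "(int ^ 'd) \<times> (int ^ 'd) fset"

definition Zd_adj :: "int ^ 'd \<Rightarrow> int ^ 'd \<Rightarrow> bool" where
  "Zd_adj m m' \<longleftrightarrow> (\<Sum>i\<in>UNIV. \<bar>m $ i - m' $ i\<bar>) = 1"

definition switch :: "'a \<Rightarrow> 'a fset \<Rightarrow> 'a fset" where
  "switch m \<eta> = (\<eta> |-| {|m|}) |\<union>| ({|m|} |-| \<eta>)"

definition lamplighter :: "('d::finite) lamp_vertex \<Rightarrow> 'd lamp_vertex \<Rightarrow> bool" where
  "lamplighter v w \<longleftrightarrow>
     (case v of (m, \<eta>) \<Rightarrow> w = (m, switch m \<eta>) \<or> (\<exists>m'. Zd_adj m m' \<and> w = (m', \<eta>)))"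

definition lamp_origin :: "('d::finite) lamp_vertex" where
  "lamp_origin = (0, {||})"


section \<open>The constructions above are well defined\<close>

lemma walk_kernel_prob [simp]: "prob_space (walk_kernel G \<omega> x0 n h)"
  by (cases n) (auto intro: prob_space_measure_pmf)

lemma sets_walk_kernel [simp]: "sets (walk_kernel G \<omega> x0 n h) = UNIV"
  by (cases n) auto

lemma Ionescu_Tulcea_walk:
  fixes G :: "'v::countable \<Rightarrow> 'v \<Rightarrow> bool"
  shows "Ionescu_Tulcea (walk_kernel G \<omega> x0) (\<lambda>_. count_space UNIV)"
proof (rule Ionescu_Tulcea.intro)
  fix i
  show "walk_kernel G \<omega> x0 i \<in> measurable (PiM {0..<i} (\<lambda>_. count_space UNIV))
      (subprob_algebra (count_space UNIV))"
  proof (cases i)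
    case 0
    have "walk_kernel G \<omega> x0 0 = (\<lambda>h. measure_pmf (return_pmf x0))" by auto
    then show ?thesis using 0 by simp
  next
    case (Suc n)
    have "(\<lambda>h. h n) \<in> measurable (PiM {0..<i} (\<lambda>_. count_space UNIV)) (count_space UNIV)"
      using Suc by (intro measurable_component_singleton) auto
    moreover have "(\<lambda>x. measure_pmf (walk_step G \<omega> x)) \<in>
        measurable (count_space UNIV) (subprob_algebra (count_space UNIV))"
      by (auto intro: measure_pmf_in_subprob_space)
    ultimately have "(\<lambda>h. measure_pmf (walk_step G \<omega> (h n))) \<in>
        measurable (PiM {0..<i} (\<lambda>_. count_space UNIV)) (subprob_algebra (count_space UNIV))"
      by (rule measurable_compose)
    moreover have "walk_kernel G \<omega> x0 (Suc n) = (\<lambda>h. measure_pmf (walk_step G \<omega> (h n)))" by auto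
    ultimately show ?thesis using Suc by simp
  qed
qed (rule walk_kernel_prob)

lemma sets_walk_law [simp]:
  fixes G :: "'v::countable \<Rightarrow> 'v \<Rightarrow> bool"
  shows "sets (walk_law G \<omega> x0) = sets path_space"
proof -
  interpret Ionescu_Tulcea "walk_kernel G \<omega> x0" "\<lambda>_. count_space UNIV"
    by (rule Ionescu_Tulcea_walk)
  show ?thesis unfolding walk_law_def by (rule PF.sets_lim)
qed

lemma cylinder_in_sets:
  fixes x :: "nat \<Rightarrow> 'v::countable"
  shows "{X. \<forall>i\<le>n. X i = x i} \<in> sets path_space"
proof -
  have "{X \<in> space path_space. \<forall>i\<in>{..n}. X i = x i} \<in> sets path_space"
    by measurable
  also have "{X \<in> space path_space. \<forall>i\<in>{..n}. X i = x i} = {X. \<forall>i\<le>n. X i = x i}"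
    by (auto simp: space_PiM)
  finally show ?thesis .
qed

lemma emeasure_walk_C:
  fixes G :: "'v::countable \<Rightarrow> 'v \<Rightarrow> bool"
  shows "emeasure (Ionescu_Tulcea.C (walk_kernel G \<omega> x0) (\<lambda>_. count_space UNIV) 0 (Suc n) (\<lambda>_. undefined))
     {restrict x {0..<Suc n}} =
   ennreal ((if x 0 = x0 then 1 else 0) * (\<Prod>i<n. pmf (walk_step G \<omega> (x i)) (x (Suc i))))"
proof -
  interpret Ionescu_Tulcea "walk_kernel G \<omega> x0" "\<lambda>_. count_space UNIV"
    by (rule Ionescu_Tulcea_walk)
  let ?M = "\<lambda>_::nat. count_space (UNIV :: 'v set)"
  have sing: "{restrict x {0..<m}} \<in> sets (PiM {0..<m} ?M)" for m
  proof -
    have "{restrict x {0..<m}} = PiE {0..<m} (\<lambda>i. {x i})"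
      by (auto simp: PiE_iff extensional_def restrict_def fun_eq_iff) 
    then show ?thesis by (simp add: sets_PiM_I_finite)
  qed
  have step: "emeasure (C 0 (Suc m) (\<lambda>_. undefined)) {restrict x {0..<Suc m}} =
      emeasure (C 0 m (\<lambda>_. undefined)) {restrict x {0..<m}} *
      emeasure (walk_kernel G \<omega> x0 m (restrict x {0..<m})) {x m}" for m
  proof -
    have "emeasure (C 0 (Suc m) (\<lambda>_. undefined)) {restrict x {0..<Suc m}} =
      (\<integral>\<^sup>+h. emeasure (eP m h) {restrict x {0..<Suc m}} \<partial>C 0 m (\<lambda>_. undefined))"
      unfolding C.simps
      using measurable_eP[of m] sing[of "Suc m"]
      by (subst emeasure_bind[where N="PiM {0..<Suc m} ?M"])
         (auto simp: space_C space_PiM measurable_cong_sets[OF sets_C refl])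
    also have "\<dots> = (\<integral>\<^sup>+h. emeasure (walk_kernel G \<omega> x0 m (restrict x {0..<m})) {x m} *
        indicator {restrict x {0..<m}} h \<partial>C 0 m (\<lambda>_. undefined))"
    proof (rule nn_integral_cong)
      fix h assume "h \<in> space (C 0 m (\<lambda>_. undefined))"
      then have h: "h \<in> space (PiM {0..<m} ?M)" by (simp add: space_C space_PiM)
      then have hext: "h \<in> extensional {0..<m}" by (simp add: space_PiM PiE_iff)
      have "emeasure (eP m h) {restrict x {0..<Suc m}} =
        emeasure (walk_kernel G \<omega> x0 m h) ((\<lambda>y. h(m := y)) -` {restrict x {0..<Suc m}})"
        using h sing by (subst emeasure_eP) auto
      also have "(\<lambda>y. h(m := y)) -` {restrict x {0..<Suc m}} =
        (if h = restrict x {0..<m} then {x m} else {})"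
      proof -
        have iff: "h(m := y) = restrict x {0..<Suc m} \<longleftrightarrow> h = restrict x {0..<m} \<and> y = x m" for y
        proof
          assume a: "h(m := y) = restrict x {0..<Suc m}"
          have "h k = restrict x {0..<m} k" for k
            using fun_cong[OF a, of k] hext by (cases "k = m") (auto simp: extensional_def)
          moreover have "y = x m" using fun_cong[OF a, of m] by simp
          ultimately show "h = restrict x {0..<m} \<and> y = x m" by auto
        qed (auto simp: fun_eq_iff)
        show ?thesis by (simp only: vimage_def singleton_iff iff) simp
      qed
      finally show "emeasure (eP m h) {restrict x {0..<Suc m}} =
        emeasure (walk_kernel G \<omega> x0 m (restrict x {0..<m})) {x m} * indicator {restrict x {0..<m}} h"
        by (cases "h = restrict x {0..<m}")
           (simp_all only: if_True if_False emeasure_empty indicator_def singleton_iff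
              refl of_bool_eq mult_1_right mult_zero_right)
    qed
    also have "\<dots> = emeasure (walk_kernel G \<omega> x0 m (restrict x {0..<m})) {x m} *
        emeasure (C 0 m (\<lambda>_. undefined)) {restrict x {0..<m}}"
      using sing[of m] by (subst nn_integral_cmult_indicator) (auto simp: sets_C space_PiM)
    finally show ?thesis by (simp add: mult.commute)
  qed
  show ?thesis
  proof (induction n)
    case 0
    have "emeasure (C 0 0 (\<lambda>_. undefined)) {restrict x {0..<0}} = 1"
      by (simp add: restrict_def PiM_empty indicator_def)
    moreover have "emeasure (walk_kernel G \<omega> x0 0 (restrict x {0..<0})) {x 0} =
        ennreal (if x 0 = x0 then 1 else 0)"
      by (simp only: walk_kernel.simps emeasure_pmf_single) (simp add: indicator_def)
    ultimately show ?case by (subst step) (simp del: C.simps walk_kernel.simps)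
  next
    case (Suc n)
    have *: "emeasure (walk_kernel G \<omega> x0 (Suc n) (restrict x {0..<Suc n})) {x (Suc n)} =
      ennreal (pmf (walk_step G \<omega> (x n)) (x (Suc n)))"
      by (simp add: emeasure_pmf_single)
    show ?case
      by (subst step, subst Suc, subst *)
         (simp add: ennreal_mult''[symmetric] prod_nonneg mult.assoc)
  qed
qed

lemma emeasure_walk_law_cylinder:
  fixes G :: "'v::countable \<Rightarrow> 'v \<Rightarrow> bool"
  shows "emeasure (walk_law G \<omega> x0) {X. \<forall>i\<le>n. X i = x i} =
     ennreal ((if x 0 = x0 then 1 else 0) * (\<Prod>i<n. pmf (walk_step G \<omega> (x i)) (x (Suc i))))"
proof -
  interpret Ionescu_Tulcea "walk_kernel G \<omega> x0" "\<lambda>_. count_space UNIV"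
    by (rule Ionescu_Tulcea_walk)
  let ?M = "\<lambda>_::nat. count_space (UNIV :: 'v set)"
  let ?J = "{0..<Suc n}"
  have eq: "{restrict x ?J} = PiE ?J (\<lambda>i. {x i})"
    by (auto simp: PiE_iff extensional_def restrict_def fun_eq_iff)
  then have sing: "{restrict x ?J} \<in> sets (PiM ?J ?M)" by (simp add: sets_PiM_I_finite)
  have "restrict X ?J = restrict x ?J \<longleftrightarrow> (\<forall>i\<le>n. X i = x i)" for X
  proof
    assume a: "restrict X ?J = restrict x ?J"
    show "\<forall>i\<le>n. X i = x i"
    proof (intro allI impI)
      fix i assume "i \<le> n" then show "X i = x i" using fun_cong[OF a, of i] by simp
    qed
  qed (auto simp: fun_eq_iff)
  then have "{X. \<forall>i\<le>n. X i = x i} = PF.emb UNIV ?J {restrict x ?J}"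
    by (auto simp: prod_emb_def space_PiM)
  then have "emeasure (walk_law G \<omega> x0) {X. \<forall>i\<le>n. X i = x i} = emeasure (CI ?J) {restrict x ?J}"
    unfolding walk_law_def using lim[OF _ sing] by simp
  also have "\<dots> = emeasure (C 0 (Suc n) (\<lambda>_. undefined)) (PF.emb ?J ?J {restrict x ?J})"
    using sing by (intro emeasure_CI) auto
  also have "PF.emb ?J ?J {restrict x ?J} = {restrict x ?J}"
    by (rule prod_emb_id) (auto simp: PiE_iff)
  finally show ?thesis by (simp only: emeasure_walk_C)
qed

lemma prob_space_walk_law:
  fixes G :: "'v::countable \<Rightarrow> 'v \<Rightarrow> bool"
  shows "prob_space (walk_law G \<omega> x0)"
proof -
  interpret Ionescu_Tulcea "walk_kernel G \<omega> x0" "\<lambda>_. count_space UNIV"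
    by (rule Ionescu_Tulcea_walk)
  show ?thesis unfolding walk_law_def
  proof 
    have "space PF.lim = PF.emb UNIV {} (space (PiM {} (\<lambda>_. count_space UNIV)))"
      by (auto simp: sets_eq_imp_space_eq[OF PF.sets_lim] space_PiM prod_emb_def)
    then show "emeasure PF.lim (space PF.lim) = 1"
      using lim[of "{}" "space (PiM {} (\<lambda>_. count_space UNIV))"]
        prob_space.emeasure_space_1[OF PF.prob_space_P[of "{}"]]
      by (simp add: PF.space_P)
  qed
qed

lemma sets_path_space_cylinders:
  "sets (path_space :: (nat \<Rightarrow> 'v::countable) measure) =
     sigma_sets UNIV (insert {} (range (\<lambda>(n, x). {X. \<forall>i\<le>n. X i = x i})))" (is "_ = sigma_sets UNIV ?C")
proof
  show "sigma_sets UNIV ?C \<subseteq> sets path_space"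
  proof -
    have "?C \<subseteq> sets path_space" using cylinder_in_sets by auto
    from sets.sigma_sets_subset[OF this] show ?thesis by (simp add: space_PiM)
  qed
  interpret S: sigma_algebra UNIV "sigma_sets UNIV ?C"
    by (rule sigma_algebra_sigma_sets) auto
  have basic: "{X. X i \<in> A} \<in> sigma_sets UNIV ?C" for i and A :: "'v set"
  proof -
    let ?L = "{xs :: 'v list. length xs = Suc i \<and> xs ! i \<in> A}"
    have "{X. X i \<in> A} = (\<Union>xs\<in>?L. {X. \<forall>j\<le>i. X j = xs ! j})"
    proof safe
      fix X :: "nat \<Rightarrow> 'v" assume "X i \<in> A"
      then show "X \<in> (\<Union>xs\<in>?L. {X. \<forall>j\<le>i. X j = xs ! j})"
        by (intro UN_I[of "map X [0..<Suc i]"]) (auto simp del: upt_Suc)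
    qed auto
    also have "\<dots> \<in> sigma_sets UNIV ?C"
      by (intro S.countable_UN'' countableI_type sigma_sets.Basic) force+
    finally show ?thesis .
  qed
  show "sets path_space \<subseteq> sigma_sets UNIV ?C"
    unfolding sets_PiM_single
    by (simp, intro S.sigma_sets_subset) (use basic in auto)
qed

lemma Int_stable_cylinders:
  "Int_stable (insert {} (range (\<lambda>(n, x). {X :: nat \<Rightarrow> 'v. \<forall>i\<le>n. X i = x i})))"
proof -
  have "{X :: nat \<Rightarrow> 'v. \<forall>i\<le>n. X i = x i} \<inter> {X. \<forall>i\<le>m. X i = y i} \<in>
      insert {} (range (\<lambda>(n, x). {X :: nat \<Rightarrow> 'v. \<forall>i\<le>n. X i = x i}))" for n m x y
  proof (cases "\<forall>i\<le>min n m. x i = y i")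
    case True
    then have "{X :: nat \<Rightarrow> 'v. \<forall>i\<le>n. X i = x i} \<inter> {X. \<forall>i\<le>m. X i = y i} =
      {X. \<forall>i\<le>max n m. X i = (if i \<le> n then x i else y i)}"
      by (auto simp: le_max_iff_disj) 
    then show ?thesis by (intro insertI2 image_eqI[of _ _ "(max n m, \<lambda>i. if i \<le> n then x i else y i)"]) auto
  next
    case False
    then have "{X :: nat \<Rightarrow> 'v. \<forall>i\<le>n. X i = x i} \<inter> {X. \<forall>i\<le>m. X i = y i} = {}"
      by auto
    then show ?thesis by simp
  qed
  then show ?thesis by (auto simp: Int_stable_def)
qed

lemma measurable_open_adj:
  "(\<lambda>\<omega>. open_adj G \<omega> x y) \<in> measurable (percolation G p) (count_space UNIV)"
proof (cases "G x y")
  case True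
  then have "{x, y} \<in> edges G" by (auto simp: edges_def)
  then have "(\<lambda>\<omega>. \<omega> {x, y}) \<in> measurable (percolation G p) (measure_pmf (bernoulli_pmf p))"
    unfolding percolation_def by (rule measurable_component_singleton)
  then show ?thesis using True by (simp add: open_adj_def)
qed (simp add: open_adj_def)

lemma measurable_walk_step:
  assumes fin: "finite {y. G x y}"
  shows "(\<lambda>\<omega>. pmf (walk_step G \<omega> x) y) \<in> borel_measurable (percolation G p)"
proof -
  have eq: "open_nbrs G \<omega> x = {y \<in> {y. G x y}. open_adj G \<omega> x y}" for \<omega>
    by (auto simp: open_nbrs_def open_adj_def)
  have fin': "finite (open_nbrs G \<omega> x)" for \<omega> unfolding eq using fin by simp
  have card: "real (card (open_nbrs G \<omega> x)) = (\<Sum>y\<in>{y. G x y}. if open_adj G \<omega> x y then 1 else 0)" for \<omega>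
    unfolding eq using fin by (simp add: sum.If_cases Int_def)
  define I where "I z \<omega> = (if open_adj G \<omega> x z then 1 else 0 :: real)" for z \<omega>
  define N where "N \<omega> = (\<Sum>z\<in>{z. G x z}. I z \<omega>)" for \<omega>
  have "pmf (walk_step G \<omega> x) y = (if N \<omega> = 0 then if y = x then 1 else 0 else I y \<omega> / N \<omega>)" for \<omega>
    unfolding N_def I_def card[symmetric] using fin'[of \<omega>]
    by (auto simp: walk_step_def pmf_of_set open_nbrs_def indicator_def)
  moreover have I[measurable]: "I z \<in> borel_measurable (percolation G p)" for z
    unfolding I_def using measurable_open_adj[of G x z p] by measurable
  have [measurable]: "N \<in> borel_measurable (percolation G p)"
    unfolding N_def by measurable
  have "(\<lambda>\<omega>. if N \<omega> = 0 then if y = x then 1 else 0 else I y \<omega> / N \<omega>)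
      \<in> borel_measurable (percolation G p)"
    by measurable
  ultimately show ?thesis by simp
qed

lemma measurable_walk_law:
  fixes G :: "'v::countable \<Rightarrow> 'v \<Rightarrow> bool"
  assumes fin: "\<And>x. finite {y. G x y}"
  shows "(\<lambda>\<omega>. walk_law G \<omega> x0) \<in> measurable (percolation G p) (subprob_algebra path_space)"
proof (rule measurable_subprob_algebra_generated[OF sets_path_space_cylinders Int_stable_cylinders])
  note [measurable] = measurable_walk_step[OF fin]
  show "(\<lambda>\<omega>. emeasure (walk_law G \<omega> x0) A) \<in> borel_measurable (percolation G p)"
    if "A \<in> insert {} (range (\<lambda>(n, x). {X. \<forall>i\<le>n. X i = x i}))" for A
    using that by (auto simp: emeasure_walk_law_cylinder)
  have "emeasure (walk_law G \<omega> x0) UNIV = 1" for \<omega>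
    using prob_space.emeasure_space_1[OF prob_space_walk_law[of G \<omega> x0]]
    by (simp add: sets_eq_imp_space_eq[OF sets_walk_law] space_PiM)
  then show "(\<lambda>\<omega>. emeasure (walk_law G \<omega> x0) UNIV) \<in> borel_measurable (percolation G p)"
    by simp
qed (auto intro: prob_space_imp_subprob_space prob_space_walk_law)

lemma prob_space_percolation: "prob_space (percolation G p)"
  unfolding percolation_def by (intro prob_space_PiM prob_space_measure_pmf)

lemma measurable_percolation_walk_kernel:
  fixes G :: "'v::countable \<Rightarrow> 'v \<Rightarrow> bool"
  assumes fin: "\<And>x. finite {y. G x y}"
  shows "(\<lambda>\<omega>. distr (walk_law G \<omega> x0) (percolation G p \<Otimes>\<^sub>M path_space) (\<lambda>X. (\<omega>, X)))
     \<in> measurable (percolation G p) (subprob_algebra (percolation G p \<Otimes>\<^sub>M path_space))"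
  by (rule measurable_distr2[where L="percolation G p" and M="path_space"])
     (auto intro: measurable_walk_law fin)

lemma prob_space_percolation_walk:
  fixes G :: "'v::countable \<Rightarrow> 'v \<Rightarrow> bool"
  assumes fin: "\<And>x. finite {y. G x y}"
  shows "prob_space (percolation_walk G p x0)"
  unfolding percolation_walk_def
proof (rule prob_space.prob_space_bind[OF prob_space_percolation _ measurable_percolation_walk_kernel[OF fin]])
  show "AE \<omega> in percolation G p. prob_space
      (distr (walk_law G \<omega> x0) (percolation G p \<Otimes>\<^sub>M path_space) (\<lambda>X. (\<omega>, X)))"
  proof (rule AE_I2)
    fix \<omega> assume "\<omega> \<in> space (percolation G p)"
    then have "(\<lambda>X. (\<omega>, X)) \<in> measurable (walk_law G \<omega> x0) (percolation G p \<Otimes>\<^sub>M path_space)"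
      unfolding measurable_cong_sets[OF sets_walk_law refl] by simp
    then show "prob_space (distr (walk_law G \<omega> x0) (percolation G p \<Otimes>\<^sub>M path_space) (\<lambda>X. (\<omega>, X)))"
      by (rule prob_space.prob_space_distr[OF prob_space_walk_law])
  qed
qed

lemma fset_switch: "fset (switch m \<eta>) = sym_diff (fset \<eta>) {m}"
  by (auto simp: switch_def)

lemma Zd_adj_sym: "Zd_adj m m' \<longleftrightarrow> Zd_adj m' m"
  by (simp add: Zd_adj_def abs_minus_commute)

lemma lamplighter_sym: "lamplighter v w \<Longrightarrow> lamplighter w v"
proof -
  have "switch m (switch m \<eta>) = \<eta>" for m :: "int ^ 'd" and \<eta>
    by (rule fset_inject[THEN iffD1]) (auto simp: fset_switch)
  then show "lamplighter v w \<Longrightarrow> lamplighter w v"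
    by (auto simp: lamplighter_def Zd_adj_sym split: prod.splits)
qed

lemma lamplighter_irrefl: "\<not> lamplighter v v"
proof -
  have "switch m \<eta> \<noteq> \<eta>" for m :: "int ^ 'd" and \<eta>
    using fset_switch[of m \<eta>] by auto
  moreover have "\<not> Zd_adj m m" for m :: "int ^ 'd"
    by (simp add: Zd_adj_def)
  ultimately show ?thesis by (cases v) (auto simp: lamplighter_def dest: sym)
qed

lemma Zd_nbrs_eq:
  "{m'. Zd_adj m m'} = (\<lambda>(i, s). m + axis i s) ` (UNIV \<times> {1, -1})"
proof safe
  fix m' assume a: "Zd_adj m m'"
  then have s: "(\<Sum>i\<in>UNIV. \<bar>m $ i - m' $ i\<bar>) = 1" by (simp add: Zd_adj_def)
  obtain i where i: "m $ i \<noteq> m' $ i"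
    using s by (metis (mono_tags, lifting) abs_zero cancel_comm_monoid_add_class.diff_cancel sum.neutral zero_neq_one)
  have "(\<Sum>i\<in>UNIV. \<bar>m $ i - m' $ i\<bar>) = \<bar>m $ i - m' $ i\<bar> + (\<Sum>j\<in>UNIV - {i}. \<bar>m $ j - m' $ j\<bar>)"
    by (simp add: sum.remove)
  moreover have "(\<Sum>j\<in>UNIV - {i}. \<bar>m $ j - m' $ j\<bar>) \<ge> 0" by (simp add: sum_nonneg)
  moreover have "\<bar>m $ i - m' $ i\<bar> \<ge> 1" using i by auto
  ultimately have 1: "\<bar>m $ i - m' $ i\<bar> = 1" and 0: "(\<Sum>j\<in>UNIV - {i}. \<bar>m $ j - m' $ j\<bar>) = 0"
    using s by linarith+
  have z: "m $ j = m' $ j" if "j \<noteq> i" for j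
    using 0 that by (simp add: sum_nonneg_eq_0_iff)
  have "m' = m + axis i (m' $ i - m $ i)"
    using z by (auto simp: vec_eq_iff axis_def)
  moreover have "m' $ i - m $ i \<in> {1, -1}" using 1 by auto
  ultimately show "m' \<in> (\<lambda>(i, s). m + axis i s) ` (UNIV \<times> {1, -1})"
    by (intro image_eqI[of _ _ "(i, m' $ i - m $ i)"]) auto
next
  have adj: "Zd_adj m (m + axis i s)" if "\<bar>s\<bar> = 1" for i s
  proof -
    have "\<bar>m $ j - (m + axis i s) $ j\<bar> = (if j = i then 1 else 0)" for j
      using that by (simp add: axis_def)
    then show ?thesis by (simp add: Zd_adj_def)
  qed
  show "Zd_adj m (m + axis i 1)" "Zd_adj m (m + axis i (- 1))" for i
    by (rule adj, simp)+
qed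

lemma card_Zd_nbrs: "card {m'. Zd_adj (m :: int ^ 'd) m'} = 2 * CARD('d)"
proof -
  have "inj_on (\<lambda>(i, s). m + axis i s) (UNIV \<times> {1, -1 :: int})"
    by (auto simp: inj_on_def axis_eq_axis)
  then show ?thesis unfolding Zd_nbrs_eq by (simp add: card_image card_cartesian_product)
qed

lemma degree_lamplighter:
  fixes v :: "('d::finite) lamp_vertex"
  shows "finite {w. lamplighter v w}" and "card {w. lamplighter v w} = 2 * CARD('d) + 1"
proof -
  obtain m \<eta> where v: "v = (m, \<eta>)" by (cases v)
  have eq: "{w. lamplighter v w} = insert (m, switch m \<eta>) ((\<lambda>m'. (m', \<eta>)) ` {m'. Zd_adj m m'})"
    by (auto simp: lamplighter_def v)
  have fin: "finite {m'. Zd_adj m m'}" unfolding Zd_nbrs_eq by simp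
  have sw: "switch m \<eta> \<noteq> \<eta>"
    using fset_switch[of m \<eta>] by auto
  show "finite {w. lamplighter v w}" unfolding eq using fin by simp
  have "card ((\<lambda>m'. (m', \<eta>)) ` {m'. Zd_adj m m'}) = 2 * CARD('d)"
    by (subst card_image) (auto simp: inj_on_def card_Zd_nbrs)
  then show "card {w. lamplighter v w} = 2 * CARD('d) + 1"
    unfolding eq using fin sw by (subst card_insert_disjoint) auto
qed

end

theory Submission
  imports Defs
begin

text \<open>
  A linear distance from the origin would require the lamplighter to visit linearly many sites of
  \<open>\<int>\<^sup>d\<close>, and in dimension at most two it does not, because its position is recurrent.

  Weight the annealed law by the open degree of the origin. By reversibility and the invariance of
  percolation under automorphisms, the increments of the lamplighter's position are then stationary
  (\<open>biased_walk_law_stationary\<close>). Counting each visited site at its last visit, the number of sites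
  visited up to time \<open>n\<close> is, up to a bounded error, at most the number of times \<open>k \<le> n\<close> at which the
  lamplighter leaves its site without coming back for \<open>l\<close> steps. By the maximal ergodic inequality this is
  almost surely \<open>o(n)\<close> as soon as the probability of no return within \<open>l\<close> steps tends to 0 with growing \<open>l\<close>
  (\<open>AE_site_range_sublinear\<close>).

  The position alone is not a Markov chain, but the return probability is an escape probability
  from the fibre over a site, and per vertex of the fibre it obeys Dirichlet's principle: it is bounded
  by the energy of any test function. Test functions that depend on the position only have no
  energy on the lamp edges, and on the other edges closing edges only lowers the energy. So the
  bound is the capacity of a point in \<open>\<int>\<^sup>d\<close>, which vanishes for \<open>d \<le> 2\<close> (\<open>zero_capacity\<close>, \<open>no_return_le\<close>,
  \<open>no_return_tendsto_0\<close>).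

  Finally, fix a typical configuration. Only exponentially many vertices, with a small rate, can be
  reached with a range of at most a small multiple of \<open>n\<close> (\<open>card_endpoints_le\<close>). Each of them that lies at
  distance at least \<open>e * n\<close> in the cluster has probability at most \<open>C * exp (- e\<^sup>2 * n / 8)\<close> at time \<open>n\<close>
  (\<open>transition_probability_bound\<close>), so the Borel--Cantelli lemma excludes them.
\<close>


section \<open>Automorphisms and the Markov property\<close>

text \<open>Automorphisms of a graph act on configurations by pulling back along the induced map on edges.\<close>

definition graph_aut :: "('v \<Rightarrow> 'v \<Rightarrow> bool) \<Rightarrow> ('v \<Rightarrow> 'v) \<Rightarrow> bool" where
  "graph_aut G \<phi> \<longleftrightarrow> bij \<phi> \<and> (\<forall>x y. G (\<phi> x) (\<phi> y) \<longleftrightarrow> G x y)"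

definition act :: "('v \<Rightarrow> 'v \<Rightarrow> bool) \<Rightarrow> ('v \<Rightarrow> 'v) \<Rightarrow> ('v set \<Rightarrow> bool) \<Rightarrow> ('v set \<Rightarrow> bool)" where
  "act G \<phi> \<omega> = (\<lambda>e\<in>edges G. \<omega> (\<phi> ` e))"

lemma graph_autD:
  assumes "graph_aut G \<phi>"
  shows "bij \<phi>" "inj \<phi>" "G (\<phi> x) (\<phi> y) \<longleftrightarrow> G x y" "\<phi> x = \<phi> y \<longleftrightarrow> x = y"
  using assms by (auto simp: graph_aut_def bij_def inj_def)

lemma open_adj_act:
  assumes "graph_aut G \<phi>"
  shows "open_adj G (act G \<phi> \<omega>) x y \<longleftrightarrow> open_adj G \<omega> (\<phi> x) (\<phi> y)"
  using graph_autD(3)[OF assms] by (auto simp: open_adj_def act_def edges_def)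

text \<open>Bernoulli percolation is invariant under automorphisms, because the coordinates are independent
  and identically distributed.\<close>

lemma distr_act:
  assumes "graph_aut G \<phi>"
  shows "distr (percolation G p) (percolation G p) (act G \<phi>) = percolation G p"
proof -
  have "inj_on (\<lambda>e. \<phi> ` e) (edges G)"
    using graph_autD(2)[OF assms] by (meson inj_image_eq_iff inj_onI)
  moreover have "\<phi> ` e \<in> edges G" if "e \<in> edges G" for e
    using that graph_autD(3)[OF assms] by (fastforce simp: edges_def)
  ultimately show ?thesis
    unfolding percolation_def act_def
    using distr_PiM_reindex[of "edges G" "\<lambda>_. measure_pmf (bernoulli_pmf p)" "\<lambda>e. \<phi> ` e" "edges G"]
    by (auto simp: prob_space_measure_pmf)
qed

lemma measurable_act [measurable]:
  assumes "graph_aut G \<phi>"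
  shows "act G \<phi> \<in> measurable (percolation G p) (percolation G p)"
proof -
  have *: "\<phi> ` e \<in> edges G" if "e \<in> edges G" for e
    using that graph_autD(3)[OF assms] by (fastforce simp: edges_def)
  show ?thesis unfolding percolation_def act_def
    by (intro measurable_restrict measurable_component_singleton *)
qed

lemma open_nbrs_act:
  assumes "graph_aut G \<phi>"
  shows "open_nbrs G \<omega> (\<phi> x) = \<phi> ` open_nbrs G (act G \<phi> \<omega>) x"
proof -
  have "y \<in> range \<phi>" for y using graph_autD(1)[OF assms] by (auto simp: bij_def)
  then show ?thesis
    by (auto simp: open_nbrs_def open_adj_act[OF assms] image_iff) (metis rangeE)
qed

lemma finite_open_nbrs:
  assumes "finite {y. G x y}"
  shows "finite (open_nbrs G \<omega> x)"
  by (rule finite_subset[OF _ assms]) (auto simp: open_nbrs_def open_adj_def)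

lemma walk_step_act:
  assumes "graph_aut G \<phi>" and fin: "finite {y. G x y}"
  shows "walk_step G \<omega> (\<phi> x) = map_pmf \<phi> (walk_step G (act G \<phi> \<omega>) x)"
proof (cases "open_nbrs G (act G \<phi> \<omega>) x = {}")
  case False
  then show ?thesis
    unfolding walk_step_def open_nbrs_act[OF assms(1)]
    using map_pmf_of_set_inj[OF inj_on_subset[OF graph_autD(2)[OF assms(1)] subset_UNIV]]
      finite_open_nbrs[of G x, OF fin]
    by simp
qed (simp add: walk_step_def open_nbrs_act[OF assms(1)])

text \<open>The cylinders generate the path space and are stable under intersections, so they determine the
  law of the walk.\<close>

lemma walk_law_eqI:
  fixes G :: "'v::countable \<Rightarrow> 'v \<Rightarrow> bool"
  assumes sets: "sets M = sets path_space"
    and eq: "\<And>n x. emeasure M {X. \<forall>i\<le>n. X i = x i} = emeasure (walk_law G \<omega> x0) {X. \<forall>i\<le>n. X i = x i}"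
  shows "M = walk_law G \<omega> x0"
proof -
  let ?E = "insert {} (range (\<lambda>(n, x). {X :: nat \<Rightarrow> 'v. \<forall>i\<le>n. X i = x i}))"
  let ?A = "range (\<lambda>v. {X :: nat \<Rightarrow> 'v. \<forall>i\<le>0. X i = (\<lambda>_. v) i})"
  interpret W: prob_space "walk_law G \<omega> x0" by (rule prob_space_walk_law)
  show ?thesis
  proof (rule measure_eqI_generator_eq_countable[of ?E UNIV _ _ ?A])
    show "?A \<subseteq> ?E" by force
    show "emeasure M a \<noteq> \<infinity>" if "a \<in> ?A" for a
    proof -
      from that obtain v :: 'v where "a = {X. \<forall>i\<le>0::nat. X i = (\<lambda>_. v) i}" by auto
      then show ?thesis by (simp only: eq) simp
    qed
  qed (use Int_stable_cylinders eq sets sets_path_space_cylinders in \<open>auto simp: sets_walk_law\<close>)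
qed

lemma walk_law_act:
  fixes G :: "'v::countable \<Rightarrow> 'v \<Rightarrow> bool"
  assumes "graph_aut G \<phi>" and fin: "\<And>x. finite {y. G x y}"
  shows "walk_law G \<omega> (\<phi> x0) = distr (walk_law G (act G \<phi> \<omega>) x0) path_space (\<lambda>X i. \<phi> (X i))"
proof (rule sym, rule walk_law_eqI)
  fix n and x :: "nat \<Rightarrow> 'v"
  have m: "(\<lambda>X i. \<phi> (X i)) \<in> measurable (walk_law G (act G \<phi> \<omega>) x0) path_space"
    unfolding measurable_cong_sets[OF sets_walk_law refl]
    by (rule measurable_PiM_single') (auto simp: space_PiM)
  define y where "y i = inv \<phi> (x i)" for i
  have y: "x i = \<phi> (y i)" for i
    unfolding y_def using graph_autD(1)[OF assms(1)] by (simp add: bij_def surj_f_inv_f)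
  have "emeasure (distr (walk_law G (act G \<phi> \<omega>) x0) path_space (\<lambda>X i. \<phi> (X i))) {X. \<forall>i\<le>n. X i = x i}
     = emeasure (walk_law G (act G \<phi> \<omega>) x0) {X. \<forall>i\<le>n. X i = y i}"
    using m cylinder_in_sets[of n x]
    by (subst emeasure_distr)
       (auto simp: sets_eq_imp_space_eq[OF sets_walk_law] space_PiM y graph_autD(4)[OF assms(1)]
             intro!: arg_cong[where f="emeasure _"])
  also have "\<dots> = emeasure (walk_law G \<omega> (\<phi> x0)) {X. \<forall>i\<le>n. X i = x i}"
    unfolding emeasure_walk_law_cylinder y walk_step_act[OF assms]
    by (simp add: graph_autD(4)[OF assms(1)] pmf_map_inj' graph_autD(2)[OF assms(1)])
  finally show "emeasure (distr (walk_law G (act G \<phi> \<omega>) x0) path_space (\<lambda>X i. \<phi> (X i))) {X. \<forall>i\<le>n. X i = x i}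
     = emeasure (walk_law G \<omega> (\<phi> x0)) {X. \<forall>i\<le>n. X i = x i}" .
qed simp

lemma measurable_case_nat_path:
  "(\<lambda>X. case_nat x X) \<in> measurable path_space (path_space :: (nat \<Rightarrow> 'v) measure)"
  by (rule measurable_PiM_single')
     (auto simp: space_PiM split: nat.splits intro: measurable_component_singleton)

text \<open>The Markov property at time 1.\<close>

lemma walk_law_first_step:
  fixes G :: "'v::countable \<Rightarrow> 'v \<Rightarrow> bool"
  shows "walk_law G \<omega> x0 =
    measure_pmf (walk_step G \<omega> x0) \<bind> (\<lambda>y. distr (walk_law G \<omega> y) path_space (\<lambda>X. case_nat x0 X))"
proof (rule sym, rule walk_law_eqI)
  let ?K = "\<lambda>y. distr (walk_law G \<omega> y) path_space (\<lambda>X. case_nat x0 X)"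
  have m: "(\<lambda>X. case_nat x0 X) \<in> measurable (walk_law G \<omega> y) path_space" for y
    unfolding measurable_cong_sets[OF sets_walk_law refl] by (rule measurable_case_nat_path)
  have K: "?K \<in> measurable (measure_pmf (walk_step G \<omega> x0)) (subprob_algebra path_space)"
    using prob_space.prob_space_distr[OF prob_space_walk_law m]
    by (auto simp: space_subprob_algebra intro!: prob_space_imp_subprob_space)
  show "sets (measure_pmf (walk_step G \<omega> x0) \<bind> ?K) = sets path_space"
    by (rule sets_bind) (auto simp: space_subprob_algebra)
  fix n and x :: "nat \<Rightarrow> 'v"
  have sp: "space (walk_law G \<omega> y) = UNIV" for y
    by (simp add: sets_eq_imp_space_eq[OF sets_walk_law] space_PiM)
  have "emeasure (measure_pmf (walk_step G \<omega> x0) \<bind> ?K) {X. \<forall>i\<le>n. X i = x i} =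
    (\<integral>\<^sup>+y. emeasure (?K y) {X. \<forall>i\<le>n. X i = x i} \<partial>measure_pmf (walk_step G \<omega> x0))"
    by (rule emeasure_bind[OF _ K cylinder_in_sets]) simp
  also have "\<dots> = (\<integral>\<^sup>+y. emeasure (walk_law G \<omega> y) {X. x 0 = x0 \<and> (\<forall>i<n. X i = x (Suc i))} \<partial>measure_pmf (walk_step G \<omega> x0))"
  proof (rule nn_integral_cong)
    fix y
    have "(\<forall>i\<le>n. case_nat x0 X i = x i) \<longleftrightarrow> x 0 = x0 \<and> (\<forall>i<n. X i = x (Suc i))" for X
    proof (intro iffI allI impI)
      assume a: "\<forall>i\<le>n. case_nat x0 X i = x i"
      then show "x 0 = x0 \<and> (\<forall>i<n. X i = x (Suc i))"
        using spec[OF a, of 0] spec[OF a, of "Suc _"] by auto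
    qed (auto split: nat.split)
    then show "emeasure (?K y) {X. \<forall>i\<le>n. X i = x i} =
        emeasure (walk_law G \<omega> y) {X. x 0 = x0 \<and> (\<forall>i<n. X i = x (Suc i))}"
      using m cylinder_in_sets[of n x] sp
      by (subst emeasure_distr) (auto intro!: arg_cong[where f="emeasure _"])
  qed
  also have "\<dots> = emeasure (walk_law G \<omega> x0) {X. \<forall>i\<le>n. X i = x i}"
  proof (cases n)
    case 0
    have "emeasure (walk_law G \<omega> y) UNIV = 1" for y
      using prob_space.emeasure_space_1[OF prob_space_walk_law, of G \<omega> y] sp by simp
    then show ?thesis using 0
      unfolding emeasure_walk_law_cylinder by (cases "x 0 = x0") auto
  next
    case (Suc k)
    have *: "{X. x 0 = x0 \<and> (\<forall>i<n. X i = x (Suc i))} = (if x 0 = x0 then {X. \<forall>i\<le>k. X i = x (Suc i)} else {})"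
      using Suc by (auto simp: less_Suc_eq_le)
    show ?thesis
    proof (cases "x 0 = x0")
      case True
      have "(\<integral>\<^sup>+y. emeasure (walk_law G \<omega> y) {X. x 0 = x0 \<and> (\<forall>i<n. X i = x (Suc i))} \<partial>measure_pmf (walk_step G \<omega> x0))
        = (\<integral>\<^sup>+y. ennreal (\<Prod>i<k. pmf (walk_step G \<omega> (x (Suc i))) (x (Suc (Suc i)))) * indicator {x (Suc 0)} y \<partial>measure_pmf (walk_step G \<omega> x0))"
        unfolding * using True
        by (intro nn_integral_cong)
           (auto simp: emeasure_walk_law_cylinder[where x="\<lambda>i. x (Suc i)"])
      also have "\<dots> = ennreal (\<Prod>i<k. pmf (walk_step G \<omega> (x (Suc i))) (x (Suc (Suc i)))) * pmf (walk_step G \<omega> x0) (x (Suc 0))"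
        by (subst nn_integral_cmult_indicator) (auto simp: emeasure_pmf_single)
      also have "\<dots> = emeasure (walk_law G \<omega> x0) {X. \<forall>i\<le>n. X i = x i}"
        unfolding emeasure_walk_law_cylinder Suc prod.lessThan_Suc_shift using True
        by (simp add: ennreal_mult''[symmetric] prod_nonneg mult.commute)
      finally show ?thesis .
    next
      case False
      then show ?thesis unfolding * emeasure_walk_law_cylinder by simp
    qed
  qed
  finally show "emeasure (measure_pmf (walk_step G \<omega> x0) \<bind> ?K) {X. \<forall>i\<le>n. X i = x i}
    = emeasure (walk_law G \<omega> x0) {X. \<forall>i\<le>n. X i = x i}" .
qed

lemma nn_integral_walk_law_first_step:
  fixes G :: "'v::countable \<Rightarrow> 'v \<Rightarrow> bool"
  assumes f[measurable]: "f \<in> borel_measurable path_space"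
  shows "(\<integral>\<^sup>+X. f X \<partial>walk_law G \<omega> x0) =
    (\<integral>\<^sup>+y. (\<integral>\<^sup>+X. f (case_nat x0 X) \<partial>walk_law G \<omega> y) \<partial>measure_pmf (walk_step G \<omega> x0))"
proof -
  let ?K = "\<lambda>y. distr (walk_law G \<omega> y) path_space (\<lambda>X. case_nat x0 X)"
  have m: "(\<lambda>X. case_nat x0 X) \<in> measurable (walk_law G \<omega> y) path_space" for y
    unfolding measurable_cong_sets[OF sets_walk_law refl] by (rule measurable_case_nat_path)
  have K: "?K \<in> measurable (measure_pmf (walk_step G \<omega> x0)) (subprob_algebra path_space)"
    using prob_space.prob_space_distr[OF prob_space_walk_law m]
    by (auto simp: space_subprob_algebra intro!: prob_space_imp_subprob_space)
  show ?thesis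
    by (subst walk_law_first_step, subst nn_integral_bind[OF f K])
       (auto intro!: nn_integral_cong simp: nn_integral_distr[OF m])
qed


section \<open>Stationarity of the degree-biased annealed walk\<close>

text \<open>Two families of automorphisms of the lamplighter graph: the translations of \<open>\<int>\<^sup>d\<close>, which move
  lamplighter and lamps together, and the switching of a single lamp. Between them they carry the
  origin to each of its neighbours.\<close>

definition translate :: "int ^ 'd \<Rightarrow> ('d::finite) lamp_vertex \<Rightarrow> 'd lamp_vertex" where
  "translate a v = (a + fst v, (\<lambda>m. a + m) |`| snd v)"

definition flip :: "int ^ 'd \<Rightarrow> ('d::finite) lamp_vertex \<Rightarrow> 'd lamp_vertex" where
  "flip a v = (fst v, switch a (snd v))"

lemma fset_ext: "(\<And>x. x \<in> fset A \<longleftrightarrow> x \<in> fset B) \<Longrightarrow> A = B"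
  by (metis fset_inject set_eqI)

lemma switch_switch [simp]: "switch a (switch a A) = A"
  by (rule fset_ext) (auto simp: fset_switch)

lemma switch_commute: "switch a (switch b A) = switch b (switch a A)"
  by (rule fset_ext) (auto simp: fset_switch)

lemma switch_eq_iff [simp]: "switch a A = switch a B \<longleftrightarrow> A = B"
  by (metis switch_switch)

lemma switch_image:
  fixes a m :: "int ^ 'd"
  shows "(\<lambda>m. a + m) |`| switch m A = switch (a + m) ((\<lambda>m. a + m) |`| A)"
  by (rule fset_ext) (auto simp: fset_switch)

lemma translate_translate [simp]: "translate a (translate b v) = translate (a + b) v"
  by (auto simp: translate_def add.assoc fset.map_comp comp_def)

lemma translate_0 [simp]: "translate 0 v = v"
  by (simp add: translate_def)

lemma flip_flip [simp]: "flip a (flip a v) = v"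
  by (simp add: flip_def)

lemma fst_translate [simp]: "fst (translate a v) = a + fst v"
  and fst_flip [simp]: "fst (flip a v) = fst v"
  by (simp_all add: translate_def flip_def)

lemma graph_aut_flip: "graph_aut lamplighter (flip a)"
proof -
  have "bij (flip a)" by (rule involuntory_imp_bij) simp
  moreover have "switch a B = switch m (switch a A) \<longleftrightarrow> B = switch m A" for m A B
    by (metis switch_commute switch_eq_iff)
  then have "lamplighter (flip a (m, A)) (flip a (m', B)) \<longleftrightarrow> lamplighter (m, A) (m', B)" for m A m' B
    by (simp add: lamplighter_def flip_def)
  ultimately show ?thesis
    by (simp add: graph_aut_def split_paired_all)
qed

lemma graph_aut_translate: "graph_aut lamplighter (translate a)"
proof -
  have "bij (translate a)" by (rule o_bij[of "translate (- a)"]) (auto simp: fun_eq_iff)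
  moreover have "inj (fimage (\<lambda>m. a + m))" by (intro fset.inj_map injI) simp
  then have "(\<lambda>m. a + m) |`| B = switch (a + m) ((\<lambda>m. a + m) |`| A) \<longleftrightarrow> B = switch m A"
    and "(\<lambda>m. a + m) |`| B = (\<lambda>m. a + m) |`| A \<longleftrightarrow> B = A" for m A B
    by (simp_all only: switch_image[symmetric] inj_eq)
  then have "lamplighter (translate a (m, A)) (translate a (m', B)) \<longleftrightarrow> lamplighter (m, A) (m', B)" for m A m' B
    by (simp add: lamplighter_def translate_def Zd_adj_def)
  ultimately show ?thesis
    by (simp add: graph_aut_def split_paired_all)
qed

text \<open>Functions of a path that do not see the action of these automorphisms. All functions that are
  used below compare only the positions of the lamplighter at different times.\<close>

definition lamp_invariant :: "((nat \<Rightarrow> ('d::finite) lamp_vertex) \<Rightarrow> 'b) \<Rightarrow> bool" where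
  "lamp_invariant g \<longleftrightarrow>
     (\<forall>a X. g (\<lambda>i. translate a (X i)) = g X) \<and> (\<forall>a X. g (\<lambda>i. flip a (X i)) = g X)"

text \<open>The automorphism that carries the origin to its neighbour \<open>y\<close> carries the neighbour obtained by
  negating the position of \<open>y\<close> to the origin; \<open>y \<mapsto> (- fst y, snd y)\<close> is an involution of the
  neighbours of the origin.\<close>

lemma lamp_origin_transitive:
  fixes y :: "('d::finite) lamp_vertex"
  assumes "lamplighter lamp_origin y"
  obtains \<phi> where "graph_aut lamplighter \<phi>" "\<phi> lamp_origin = y" "\<phi> (- fst y, snd y) = lamp_origin"
    "\<And>(g :: (nat \<Rightarrow> 'd lamp_vertex) \<Rightarrow> ennreal) X. lamp_invariant g \<Longrightarrow> g (\<lambda>i. \<phi> (X i)) = g X"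
proof -
  have "y = (0, switch 0 {||}) \<or> snd y = {||}"
    using assms by (auto simp: lamplighter_def lamp_origin_def)
  then show ?thesis
  proof
    assume "y = (0, switch 0 {||})"
    then show ?thesis
      by (intro that[of "flip 0"] graph_aut_flip) (auto simp: flip_def lamp_origin_def lamp_invariant_def)
  next
    assume "snd y = {||}"
    then show ?thesis
      by (intro that[of "translate (fst y)"] graph_aut_translate)
         (auto simp: translate_def lamp_origin_def lamp_invariant_def prod_eq_iff)
  qed
qed

lemma lamplighter_origin_uminus:
  fixes y :: "('d::finite) lamp_vertex"
  assumes "lamplighter lamp_origin y"
  shows "lamplighter lamp_origin (- fst y, snd y)"
  using assms by (auto simp: lamplighter_def lamp_origin_def Zd_adj_def)

text \<open>The degree of a vertex in the open subgraph.\<close>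

abbreviation deg :: "('v \<Rightarrow> 'v \<Rightarrow> bool) \<Rightarrow> ('v set \<Rightarrow> bool) \<Rightarrow> 'v \<Rightarrow> nat" where
  "deg G \<omega> x \<equiv> card (open_nbrs G \<omega> x)"

lemma open_adj_sym:
  assumes "\<And>x y. G x y \<Longrightarrow> G y x"
  shows "open_adj G \<omega> x y \<longleftrightarrow> open_adj G \<omega> y x"
  using assms by (auto simp: open_adj_def insert_commute)

lemma deg_mult_nn_integral_walk_step:
  fixes h :: "'v \<Rightarrow> ennreal"
  assumes fin: "finite {y. G x y}"
  shows "ennreal (deg G \<omega> x) * (\<integral>\<^sup>+y. h y \<partial>walk_step G \<omega> x) =
    (\<Sum>y | G x y. if open_adj G \<omega> x y then h y else 0)"
proof -
  have sub: "open_nbrs G \<omega> x \<subseteq> {y. G x y}" by (auto simp: open_nbrs_def open_adj_def)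
  then have fin': "finite (open_nbrs G \<omega> x)" using fin by (rule finite_subset)
  have "(\<Sum>y | G x y. if open_adj G \<omega> x y then h y else 0) = sum h (open_nbrs G \<omega> x)"
    using sub by (intro sum.mono_neutral_cong_right fin) (auto simp: open_nbrs_def)
  moreover have "ennreal (deg G \<omega> x) * (\<integral>\<^sup>+y. h y \<partial>walk_step G \<omega> x) = sum h (open_nbrs G \<omega> x)"
  proof (cases "open_nbrs G \<omega> x = {}")
    case False
    have d: "ennreal (deg G \<omega> x) \<noteq> 0" "ennreal (deg G \<omega> x) \<noteq> top"
      using False fin' by (auto simp: card_gt_0_iff)
    have "(\<integral>\<^sup>+y. h y \<partial>walk_step G \<omega> x) = sum h (open_nbrs G \<omega> x) / ennreal (deg G \<omega> x)"
      using False fin' by (simp add: walk_step_def nn_integral_pmf_of_set ennreal_of_nat_eq_real_of_nat)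
    then show ?thesis
      using d by (simp add: ennreal_times_divide mult.commute[of "ennreal _"] ennreal_mult_divide_eq)
  qed simp
  ultimately show ?thesis by simp
qed

lemma measurable_deg [measurable]:
  assumes "finite {y. G x y}"
  shows "(\<lambda>\<omega>. real (deg G \<omega> x)) \<in> borel_measurable (percolation G p)"
proof -
  have "real (deg G \<omega> x) = (\<Sum>y | G x y. if open_adj G \<omega> x y then 1 else 0)" for \<omega>
    using assms by (auto simp: sum.If_cases open_nbrs_def open_adj_def intro!: arg_cong[where f=card])
  moreover note measurable_open_adj[measurable]
  ultimately show ?thesis by simp
qed

lemma measurable_nn_integral_walk_law:
  fixes G :: "'v::countable \<Rightarrow> 'v \<Rightarrow> bool"
  assumes "\<And>x. finite {y. G x y}" and "f \<in> borel_measurable path_space"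
  shows "(\<lambda>\<omega>. \<integral>\<^sup>+X. f X \<partial>walk_law G \<omega> x) \<in> borel_measurable (percolation G p)"
  using measurable_compose[OF measurable_walk_law[OF assms(1)] nn_integral_measurable_subprob_algebra[OF assms(2)]]
  by simp

lemma deg_lamplighter_le:
  fixes x :: "('d::finite) lamp_vertex"
  shows "deg lamplighter \<omega> x \<le> 2 * CARD('d) + 1"
  unfolding degree_lamplighter(2)[of x, symmetric]
  by (rule card_mono[OF degree_lamplighter(1)]) (auto simp: open_nbrs_def open_adj_def)

text \<open>The annealed law of the walk, weighted by the open degree of the starting vertex. It is a finite
  measure on paths, in general not a probability measure.\<close>

definition biased_walk_law :: "real \<Rightarrow> (nat \<Rightarrow> ('d::finite) lamp_vertex) measure" where
  "biased_walk_law p =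
     density (percolation lamplighter p) (\<lambda>\<omega>. ennreal (deg lamplighter \<omega> lamp_origin)) \<bind>
       (\<lambda>\<omega>. walk_law lamplighter \<omega> lamp_origin)"

lemma biased_kernel_measurable:
  "(\<lambda>\<omega>. walk_law lamplighter \<omega> (lamp_origin :: ('d::finite) lamp_vertex)) \<in>
     measurable (density (percolation lamplighter p) (\<lambda>\<omega>. ennreal (deg lamplighter \<omega> (lamp_origin :: 'd lamp_vertex))))
       (subprob_algebra path_space)"
  using measurable_walk_law[OF degree_lamplighter(1)] by simp

lemma space_percolation_nonempty: "space (percolation G p) \<noteq> {}"
  using prob_space.not_empty[OF prob_space_percolation] .

lemma sets_biased_walk_law [simp, measurable_cong]: "sets (biased_walk_law p) = sets path_space"
  unfolding biased_walk_law_def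
  by (rule sets_bind) (use space_percolation_nonempty in auto)

lemma space_biased_walk_law [simp]: "space (biased_walk_law p) = UNIV"
  using sets_eq_imp_space_eq[OF sets_biased_walk_law] by (simp add: space_PiM)

lemma nn_integral_biased_walk_law:
  fixes f :: "(nat \<Rightarrow> ('d::finite) lamp_vertex) \<Rightarrow> ennreal"
  assumes f[measurable]: "f \<in> borel_measurable path_space"
  shows "(\<integral>\<^sup>+X. f X \<partial>biased_walk_law p) =
    (\<integral>\<^sup>+\<omega>. ennreal (deg lamplighter \<omega> (lamp_origin :: 'd lamp_vertex)) *
       (\<integral>\<^sup>+X. f X \<partial>walk_law lamplighter \<omega> lamp_origin) \<partial>percolation lamplighter p)"
proof -
  note [measurable] = measurable_nn_integral_walk_law[OF degree_lamplighter(1) f]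
    measurable_deg[OF degree_lamplighter(1)]
  show ?thesis
    unfolding biased_walk_law_def
    by (subst nn_integral_bind[OF f biased_kernel_measurable], subst nn_integral_density) auto
qed

lemma finite_measure_biased_walk_law:
  "finite_measure (biased_walk_law p :: (nat \<Rightarrow> ('d::finite) lamp_vertex) measure)"
proof
  let ?o = "lamp_origin :: 'd lamp_vertex"
  have W: "(\<integral>\<^sup>+X. 1 \<partial>walk_law lamplighter \<omega> ?o) = 1" for \<omega>
    using prob_space.emeasure_space_1[OF prob_space_walk_law, of lamplighter \<omega> ?o] by simp
  have d: "ennreal (deg lamplighter \<omega> ?o) \<le> ennreal (2 * CARD('d) + 1)" for \<omega>
    by (intro ennreal_leI of_nat_mono deg_lamplighter_le)
  interpret P: prob_space "percolation (lamplighter :: 'd lamp_vertex \<Rightarrow> _) p" by (rule prob_space_percolation)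
  have "emeasure (biased_walk_law p :: (nat \<Rightarrow> 'd lamp_vertex) measure) (space (biased_walk_law p)) = (\<integral>\<^sup>+X. 1 \<partial>(biased_walk_law p :: (nat \<Rightarrow> 'd lamp_vertex) measure))"
    by simp
  also have "\<dots> = (\<integral>\<^sup>+\<omega>. ennreal (deg lamplighter \<omega> ?o) \<partial>percolation lamplighter p)"
    by (subst nn_integral_biased_walk_law) (simp_all only: W mult_1_right borel_measurable_const)
  also have "\<dots> \<le> (\<integral>\<^sup>+\<omega>. ennreal (2 * CARD('d) + 1) \<partial>percolation (lamplighter :: 'd lamp_vertex \<Rightarrow> _) p)"
    by (intro nn_integral_mono d)
  also have "\<dots> < \<infinity>" by (simp add: P.emeasure_space_1 ennreal_mult_less_top)
  finally show "emeasure (biased_walk_law p :: (nat \<Rightarrow> 'd lamp_vertex) measure) (space (biased_walk_law p)) \<noteq> \<infinity>"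
    by simp
qed

lemma measurable_path_shift:
  "(\<lambda>X i. X (k + i)) \<in> measurable path_space path_space"
  by (rule measurable_PiM_single') (auto simp: space_PiM intro: measurable_component_singleton)

lemma measurable_map_path:
  "(\<lambda>X i. \<phi> (X i)) \<in> measurable (path_space :: (nat \<Rightarrow> 'v) measure) path_space"
  by (rule measurable_PiM_single')
     (auto simp: space_PiM intro: measurable_compose[OF measurable_component_singleton])

text \<open>Stationarity of the environment seen from the walk. The weight \<open>deg\<close> cancels the normalisation
  of the first step, which leaves a sum over the neighbours \<open>y\<close> of the origin of the event that the
  edge to \<open>y\<close> is open; moving \<open>y\<close> to the origin permutes the terms of this sum.\<close>

lemma biased_walk_law_stationary_step:
  fixes g :: "(nat \<Rightarrow> ('d::finite) lamp_vertex) \<Rightarrow> ennreal"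
  assumes g[measurable]: "g \<in> borel_measurable path_space" and inv: "lamp_invariant g"
  shows "(\<integral>\<^sup>+X. g (\<lambda>i. X (1 + i)) \<partial>biased_walk_law p) = (\<integral>\<^sup>+X. g X \<partial>biased_walk_law p)"
proof -
  let ?G = "lamplighter :: 'd lamp_vertex \<Rightarrow> _" and ?o = "lamp_origin :: 'd lamp_vertex"
  let ?P = "percolation ?G p"
  define H where "H \<omega> x = (\<integral>\<^sup>+X. g X \<partial>walk_law ?G \<omega> x)" for \<omega> x
  have [measurable]: "(\<lambda>\<omega>. H \<omega> x) \<in> borel_measurable ?P" for x
    unfolding H_def by (rule measurable_nn_integral_walk_law[OF degree_lamplighter(1) g])
  have meas: "(\<lambda>\<omega>. if open_adj ?G \<omega> x z then H \<omega> y else 0) \<in> borel_measurable ?P" for x y z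
    using measurable_open_adj[of ?G x z p] by measurable
  have fin: "finite {y. ?G ?o y}" by (rule degree_lamplighter)
  have "(\<integral>\<^sup>+X. g (\<lambda>i. X (1 + i)) \<partial>biased_walk_law p) =
      (\<integral>\<^sup>+\<omega>. (\<Sum>y | ?G ?o y. if open_adj ?G \<omega> ?o y then H \<omega> y else 0) \<partial>?P)"
    unfolding H_def deg_mult_nn_integral_walk_step[of ?G ?o, OF fin, symmetric]
    by (subst nn_integral_biased_walk_law, rule measurable_compose[OF measurable_path_shift g],
        subst nn_integral_walk_law_first_step, rule measurable_compose[OF measurable_path_shift g]) simp
  also have "\<dots> = (\<Sum>y | ?G ?o y. \<integral>\<^sup>+\<omega>. (if open_adj ?G \<omega> ?o y then H \<omega> y else 0) \<partial>?P)"
    by (rule nn_integral_sum) (rule meas)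
  also have "\<dots> = (\<Sum>y | ?G ?o y. \<integral>\<^sup>+\<omega>. (if open_adj ?G \<omega> ?o (- fst y, snd y) then H \<omega> ?o else 0) \<partial>?P)"
  proof (rule sum.cong[OF refl])
    fix y assume "y \<in> {y. ?G ?o y}"
    then have "lamplighter ?o y" by simp
    then obtain \<phi> where \<phi>: "graph_aut ?G \<phi>" "\<phi> ?o = y" "\<phi> (- fst y, snd y) = ?o"
      and inv': "\<And>(g :: (nat \<Rightarrow> 'd lamp_vertex) \<Rightarrow> ennreal) X. lamp_invariant g \<Longrightarrow> g (\<lambda>i. \<phi> (X i)) = g X"
      by (rule lamp_origin_transitive) (rule that)
    have mphi: "(\<lambda>X i. \<phi> (X i)) \<in> measurable (walk_law ?G \<omega> ?o) path_space" for \<omega>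
      using measurable_map_path measurable_cong_sets[OF sets_walk_law refl] by blast
    have H: "H \<omega> y = H (act ?G \<phi> \<omega>) ?o" for \<omega>
      unfolding H_def \<phi>(2)[symmetric] walk_law_act[OF \<phi>(1) degree_lamplighter(1)]
      by (subst nn_integral_distr[OF mphi]) (simp_all add: inv'[OF inv])
    have o: "open_adj ?G \<omega> ?o y \<longleftrightarrow> open_adj ?G (act ?G \<phi> \<omega>) ?o (- fst y, snd y)" for \<omega>
      unfolding open_adj_act[OF \<phi>(1)] \<phi>(2,3) by (rule open_adj_sym) (rule lamplighter_sym)
    have "(\<integral>\<^sup>+\<omega>. (if open_adj ?G \<omega> ?o (- fst y, snd y) then H \<omega> ?o else 0) \<partial>?P) =
      (\<integral>\<^sup>+\<omega>. (if open_adj ?G \<omega> ?o (- fst y, snd y) then H \<omega> ?o else 0) \<partial>distr ?P ?P (act ?G \<phi>))"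
      by (simp add: distr_act[OF \<phi>(1)])
    also have "\<dots> = (\<integral>\<^sup>+\<omega>. (if open_adj ?G \<omega> ?o y then H \<omega> y else 0) \<partial>?P)"
      unfolding o H by (rule nn_integral_distr[OF measurable_act[OF \<phi>(1)]]) (simp add: meas)
    finally show "(\<integral>\<^sup>+\<omega>. (if open_adj ?G \<omega> ?o y then H \<omega> y else 0) \<partial>?P) =
      (\<integral>\<^sup>+\<omega>. (if open_adj ?G \<omega> ?o (- fst y, snd y) then H \<omega> ?o else 0) \<partial>?P)" by simp
  qed
  also have "\<dots> = (\<Sum>y | ?G ?o y. \<integral>\<^sup>+\<omega>. (if open_adj ?G \<omega> ?o y then H \<omega> ?o else 0) \<partial>?P)"
    by (rule sum.reindex_bij_witness[of _ "\<lambda>y. (- fst y, snd y)" "\<lambda>y. (- fst y, snd y)"])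
       (use lamplighter_origin_uminus in auto)
  also have "\<dots> = (\<integral>\<^sup>+\<omega>. (\<Sum>y | ?G ?o y. if open_adj ?G \<omega> ?o y then H \<omega> ?o else 0) \<partial>?P)"
    by (rule nn_integral_sum[symmetric]) (rule meas)
  also have "\<dots> = (\<integral>\<^sup>+\<omega>. ennreal (deg ?G \<omega> ?o) * H \<omega> ?o \<partial>?P)"
    by (intro nn_integral_cong)
       (simp add: deg_mult_nn_integral_walk_step[of ?G ?o, OF fin, symmetric] measure_pmf.emeasure_space_1)
  also have "\<dots> = (\<integral>\<^sup>+X. g X \<partial>biased_walk_law p)"
    by (simp add: nn_integral_biased_walk_law H_def)
  finally show ?thesis .
qed

lemma biased_walk_law_stationary:
  fixes g :: "(nat \<Rightarrow> ('d::finite) lamp_vertex) \<Rightarrow> ennreal"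
  assumes g[measurable]: "g \<in> borel_measurable path_space" and inv: "lamp_invariant g"
  shows "(\<integral>\<^sup>+X. g (\<lambda>i. X (k + i)) \<partial>biased_walk_law p) = (\<integral>\<^sup>+X. g X \<partial>biased_walk_law p)"
proof (induction k)
  case (Suc k)
  have "lamp_invariant (\<lambda>X. g (\<lambda>i. X (k + i)))"
    using inv by (auto simp: lamp_invariant_def)
  moreover have "(\<lambda>X. g (\<lambda>i. X (k + i))) \<in> borel_measurable path_space"
    by (rule measurable_compose[OF measurable_path_shift g])
  ultimately have "(\<integral>\<^sup>+X. g (\<lambda>i. X (1 + (k + i))) \<partial>biased_walk_law p) =
      (\<integral>\<^sup>+X. g (\<lambda>i. X (k + i)) \<partial>biased_walk_law p)"
    by (intro biased_walk_law_stationary_step)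
  then show ?case using Suc by simp
qed simp

lemma biased_walk_law_stationary_pred:
  fixes P :: "(nat \<Rightarrow> ('d::finite) lamp_vertex) \<Rightarrow> bool"
  assumes P[measurable]: "Measurable.pred path_space P" and inv: "lamp_invariant P"
  shows "emeasure (biased_walk_law p) {X. P (\<lambda>i. X (k + i))} = emeasure (biased_walk_law p) {X. P X}"
proof -
  define g where "g X = (indicator {X. P X} X :: ennreal)" for X
  have "{X \<in> space path_space. P X} \<in> sets path_space" by measurable
  then have S: "{X. P X} \<in> sets path_space" by (simp add: space_PiM)
  have [measurable]: "Measurable.pred path_space (\<lambda>X. P (\<lambda>i. X (k + i)))"
    by (rule measurable_compose[OF measurable_path_shift P])
  have "{X \<in> space path_space. P (\<lambda>i. X (k + i))} \<in> sets path_space" by measurable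
  then have S': "{X. P (\<lambda>i. X (k + i))} \<in> sets path_space" by (simp add: space_PiM)
  have "lamp_invariant g" using inv by (simp add: lamp_invariant_def g_def indicator_def)
  moreover have "g \<in> borel_measurable path_space"
    unfolding g_def using S by measurable
  ultimately have "(\<integral>\<^sup>+X. g (\<lambda>i. X (k + i)) \<partial>biased_walk_law p) = (\<integral>\<^sup>+X. g X \<partial>biased_walk_law p)"
    by (intro biased_walk_law_stationary)
  moreover have "g (\<lambda>i. X (k + i)) = indicator {X. P (\<lambda>i. X (k + i))} X" for X
    by (simp add: g_def indicator_def)
  ultimately show ?thesis using S S' by (simp add: g_def)
qed


section \<open>The maximal ergodic inequality and the range of the lamplighter\<close>

text \<open>A deterministic covering lemma: if \<open>k\<close> starts a block of length at most \<open>N\<close> over which \<open>a\<close> has average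
  above \<open>c\<close>, skip that block, otherwise skip \<open>k\<close> alone. The blocks met in this way are disjoint and
  contain all the bad times.\<close>

lemma maximal_counting:
  fixes a :: "nat \<Rightarrow> real"
  assumes nonneg: "\<And>j. a j \<ge> 0" and "c \<ge> 0"
  shows "c * real (card {k\<in>{s..<M}. \<exists>n. 1 \<le> n \<and> n \<le> N \<and> c * real n < (\<Sum>j<n. a (k + j))})
    \<le> (\<Sum>j\<in>{s..<M + N}. a j)"
proof -
  define bad where "bad k \<longleftrightarrow> (\<exists>n. 1 \<le> n \<and> n \<le> N \<and> c * real n < (\<Sum>j<n. a (k + j)))" for k
  have "c * real (card {k\<in>{s..<M}. bad k}) \<le> (\<Sum>j\<in>{s..<M + N}. a j)"
  proof (induction "M - s" arbitrary: s rule: less_induct)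
    case less
    show ?case
    proof (cases "s < M")
      case True
      show ?thesis
      proof (cases "bad s")
        case False
        then have "{k\<in>{s..<M}. bad k} = {k\<in>{Suc s..<M}. bad k}"
          using Suc_le_eq le_neq_implies_less by (auto simp: Suc_le_eq le_less)
        moreover have "c * real (card {k\<in>{Suc s..<M}. bad k}) \<le> (\<Sum>j\<in>{Suc s..<M + N}. a j)"
          using True by (intro less) auto
        moreover have "(\<Sum>j\<in>{s..<M + N}. a j) = a s + (\<Sum>j\<in>{Suc s..<M + N}. a j)"
          using True by (simp add: sum.atLeast_Suc_lessThan)
        ultimately show ?thesis using nonneg[of s] by simp
      next
        case bad: True
        then obtain n where n: "1 \<le> n" "n \<le> N" "c * real n < (\<Sum>j<n. a (s + j))"
          unfolding bad_def by blast
        have "{k\<in>{s..<M}. bad k} \<subseteq> {s..<s + n} \<union> {k\<in>{s + n..<M}. bad k}" by auto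
        then have "card {k\<in>{s..<M}. bad k} \<le> card ({s..<s + n} \<union> {k\<in>{s + n..<M}. bad k})"
          by (intro card_mono) auto
        also have "\<dots> \<le> card {s..<s + n} + card {k\<in>{s + n..<M}. bad k}" by (rule card_Un_le)
        finally have "real (card {k\<in>{s..<M}. bad k}) \<le> real n + real (card {k\<in>{s + n..<M}. bad k})"
          by simp
        then have "c * real (card {k\<in>{s..<M}. bad k}) \<le> c * real n + c * real (card {k\<in>{s + n..<M}. bad k})"
          using \<open>c \<ge> 0\<close> by (metis distrib_left mult_left_mono)
        also have "c * real (card {k\<in>{s + n..<M}. bad k}) \<le> (\<Sum>j\<in>{s + n..<M + N}. a j)"
          using True n(1) by (intro less) auto
        also have "(\<Sum>j<n. a (s + j)) = (\<Sum>j\<in>{s..<s + n}. a j)"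
          by (rule sum.reindex_bij_witness[of _ "\<lambda>j. j - s" "\<lambda>j. s + j"]) auto
        moreover have "(\<Sum>j\<in>{s..<M + N}. a j) = (\<Sum>j\<in>{s..<s + n}. a j) + (\<Sum>j\<in>{s + n..<M + N}. a j)"
          using True n(2) by (intro sum.atLeastLessThan_concat[symmetric]) auto
        ultimately show ?thesis using n(3) by linarith
      qed
    qed (simp add: sum_nonneg nonneg)
  qed
  then show ?thesis by (simp only: bad_def)
qed

text \<open>The lamplighter does not come back during the times \<open>1, \<dots>, l\<close> to the site where it was at time 0.\<close>

definition no_return :: "nat \<Rightarrow> (nat \<Rightarrow> ('d::finite) lamp_vertex) \<Rightarrow> bool" where
  "no_return l X \<longleftrightarrow> (\<forall>i\<in>{1..l}. fst (X i) \<noteq> fst (X 0))"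

text \<open>The sites of \<open>\<int>\<^sup>d\<close> visited up to and including time \<open>n\<close>.\<close>

definition site_range :: "(nat \<Rightarrow> ('d::finite) lamp_vertex) \<Rightarrow> nat \<Rightarrow> (int ^ 'd) set" where
  "site_range X n = (\<lambda>i. fst (X i)) ` {..n}"

lemma measurable_path_pair:
  fixes Q :: "'v::countable \<Rightarrow> 'v \<Rightarrow> bool"
  shows "Measurable.pred path_space (\<lambda>X. Q (X i) (X j))"
proof (rule measurable_compose_countable[where g="\<lambda>X. X i" and f="\<lambda>x X. Q x (X j)"])
  show "Measurable.pred path_space (\<lambda>X. Q x (X j))" for x
    by (rule measurable_compose[OF measurable_component_singleton]) auto
qed (rule measurable_component_singleton, simp)

lemma measurable_no_return:
  "Measurable.pred path_space (no_return l :: (nat \<Rightarrow> ('d::finite) lamp_vertex) \<Rightarrow> bool)"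
  unfolding no_return_def
  using measurable_path_pair[of "\<lambda>x y. fst x \<noteq> fst (y :: 'd lamp_vertex)"] by simp

lemma measurable_no_return_at:
  "Measurable.pred path_space (\<lambda>X :: nat \<Rightarrow> ('d::finite) lamp_vertex. no_return l (\<lambda>i. X (k + i)))"
  by (rule measurable_compose[OF measurable_path_shift measurable_no_return])

text \<open>Count each site at its last visit up to time \<open>n\<close>. Unless this visit is one of the \<open>l\<close> latest
  times, it is followed by \<open>l\<close> steps without a return.\<close>

lemma card_site_range_le:
  "real (card (site_range X n)) \<le> real l + (\<Sum>k<Suc n. of_bool (no_return l (\<lambda>i. X (k + i))))"
proof -
  let ?K = "{k. k \<le> n \<and> (\<forall>i. k < i \<and> i \<le> n \<longrightarrow> fst (X i) \<noteq> fst (X k))}"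
  have "site_range X n \<subseteq> (\<lambda>k. fst (X k)) ` ?K"
  proof
    fix m assume "m \<in> site_range X n"
    then obtain j where j: "j \<le> n" "fst (X j) = m" by (auto simp: site_range_def)
    define k where "k = Max {i. i \<le> n \<and> fst (X i) = m}"
    have fin: "finite {i. i \<le> n \<and> fst (X i) = m}" by simp
    have "k \<in> {i. i \<le> n \<and> fst (X i) = m}"
      unfolding k_def by (rule Max_in[OF fin]) (use j in auto)
    moreover have "fst (X i) \<noteq> m" if "k < i" "i \<le> n" for i
      using Max_ge[OF fin, of i] that unfolding k_def by fastforce
    ultimately show "m \<in> (\<lambda>k. fst (X k)) ` ?K" by (intro image_eqI[of _ _ k]) auto
  qed
  then have "card (site_range X n) \<le> card ?K"
    by (rule surj_card_le[rotated]) simp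
  also have "?K \<subseteq> {n + 1 - l..<n + 1} \<union> {k\<in>{..<Suc n}. no_return l (\<lambda>i. X (k + i))}"
    by (auto simp: no_return_def)
  then have "card ?K \<le> card ({n + 1 - l..<n + 1} \<union> {k\<in>{..<Suc n}. no_return l (\<lambda>i. X (k + i))})"
    by (intro card_mono) auto
  also have "\<dots> \<le> card {n + 1 - l..<n + 1} + card {k\<in>{..<Suc n}. no_return l (\<lambda>i. X (k + i))}"
    by (rule card_Un_le)
  also have "\<dots> \<le> l + card {k\<in>{..<Suc n}. no_return l (\<lambda>i. X (k + i))}" by simp
  finally have "real (card (site_range X n)) \<le> real (l + card {k\<in>{..<Suc n}. no_return l (\<lambda>i. X (k + i))})"
    by (simp only: of_nat_le_iff)
  also have "\<dots> = real l + (\<Sum>k<Suc n. of_bool (no_return l (\<lambda>i. X (k + i))))"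
    by (simp add: of_bool_def sum.If_cases Int_def del: sum.lessThan_Suc)
  finally show ?thesis .
qed

text \<open>The maximal ergodic inequality for the stationary indicators of \<open>no_return\<close>.\<close>

lemma measure_frequent_no_return_le:
  fixes c :: real
  assumes "c > 0"
  shows "measure (biased_walk_law p) {X :: nat \<Rightarrow> ('d::finite) lamp_vertex.
      \<exists>n\<ge>1. c * real n < (\<Sum>k<n. of_bool (no_return l (\<lambda>i. X (k + i))))}
    \<le> measure (biased_walk_law p) {X :: nat \<Rightarrow> 'd lamp_vertex. no_return l X} / c"
proof -
  let ?\<mu> = "biased_walk_law p :: (nat \<Rightarrow> 'd lamp_vertex) measure"
  interpret \<mu>: finite_measure ?\<mu> by (rule finite_measure_biased_walk_law)
  define A where "A = {X :: nat \<Rightarrow> 'd lamp_vertex. no_return l X}"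
  define B where "B N = {X :: nat \<Rightarrow> 'd lamp_vertex. \<exists>n\<in>{1..N}. c * real n < (\<Sum>j<n. of_bool (no_return l (\<lambda>i. X (j + i))))}" for N
  note meas = measurable_no_return_at[of l, where 'd='d]
  have mB: "Measurable.pred path_space (\<lambda>X. X \<in> B N)" for N
    unfolding B_def mem_Collect_eq using meas by measurable
  have mA: "Measurable.pred path_space (\<lambda>X. X \<in> A)"
    unfolding A_def mem_Collect_eq by (rule measurable_no_return)
  have shift_sets: "{X. (\<lambda>i. X (k + i)) \<in> S} \<in> sets ?\<mu>" if "Measurable.pred path_space (\<lambda>X. X \<in> S)" for S k
    using measurable_sets[OF measurable_compose[OF measurable_path_shift that, of k], of "{True}"]
    by (simp add: space_PiM vimage_def)
  have sets0: "S \<in> sets ?\<mu>" if "Measurable.pred path_space (\<lambda>X. X \<in> S)" for S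
    using measurable_sets[OF that, of "{True}"] by (simp add: space_PiM vimage_def)
  have stat: "measure ?\<mu> {X. (\<lambda>i. X (k + i)) \<in> S} = measure ?\<mu> S"
    if "Measurable.pred path_space (\<lambda>X. X \<in> S)" "lamp_invariant (\<lambda>X. X \<in> S)" for S k
    using biased_walk_law_stationary_pred[OF that, of p k] by (simp add: measure_def)
  have inv: "no_return l (\<lambda>i. translate a (X i)) = no_return l X" "no_return l (\<lambda>i. flip a (X i)) = no_return l X"
    for a and X :: "nat \<Rightarrow> 'd lamp_vertex" by (auto simp: no_return_def)
  have iA: "lamp_invariant (\<lambda>X. X \<in> A)" and iB: "lamp_invariant (\<lambda>X. X \<in> B N)" for N
    unfolding A_def B_def lamp_invariant_def by (simp_all add: inv)
  have main: "c * (real M * measure ?\<mu> (B N)) \<le> real (M + N) * measure ?\<mu> A" for M N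
  proof -
    have *: "c * (\<Sum>k<M. indicator {X. (\<lambda>i. X (k + i)) \<in> B N} X) \<le> (\<Sum>j<M + N. indicator {X. (\<lambda>i. X (j + i)) \<in> A} X :: real)" for X
    proof -
      define a where "a j = (of_bool (no_return l (\<lambda>i. X (j + i))) :: real)" for j
      have "(\<Sum>k<M. indicator {X. (\<lambda>i. X (k + i)) \<in> B N} X :: real) =
          real (card {k\<in>{0..<M}. \<exists>n. 1 \<le> n \<and> n \<le> N \<and> c * real n < (\<Sum>j<n. a (k + j))})"
        by (simp add: indicator_def of_bool_def[where p="_ \<in> B N"] sum.If_cases Int_def B_def a_def add.assoc lessThan_atLeast0 Bex_def conj_assoc)
      moreover have "(\<Sum>j<M + N. indicator {X. (\<lambda>i. X (j + i)) \<in> A} X :: real) = (\<Sum>j\<in>{0..<M + N}. a j)"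
        by (simp add: a_def A_def indicator_def lessThan_atLeast0)
      ultimately show ?thesis
        using maximal_counting[of a c 0 M N] \<open>c > 0\<close> by (simp add: a_def)
    qed
    have int: "integrable ?\<mu> (indicator {X. (\<lambda>i. X (k + i)) \<in> S} :: _ \<Rightarrow> real)" if "Measurable.pred path_space (\<lambda>X. X \<in> S)" for k S
      using shift_sets[OF that] by (simp add: \<mu>.emeasure_finite less_top[symmetric])
    have "(\<integral>X. c * (\<Sum>k<M. indicator {X. (\<lambda>i. X (k + i)) \<in> B N} X) \<partial>?\<mu>) \<le>
      (\<integral>X. (\<Sum>j<M + N. indicator {X. (\<lambda>i. X (j + i)) \<in> A} X) \<partial>?\<mu>)"
      using int[OF mB] int[OF mA]
      by (intro integral_mono * integrable_mult_right Bochner_Integration.integrable_sum) auto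
    also have "(\<integral>X. c * (\<Sum>k<M. indicator {X. (\<lambda>i. X (k + i)) \<in> B N} X) \<partial>?\<mu>) = c * (real M * measure ?\<mu> (B N))"
      using int[OF mB] by (simp add: Bochner_Integration.integral_sum shift_sets[OF mB] stat[OF mB iB])
    also have "(\<integral>X. (\<Sum>j<M + N. indicator {X. (\<lambda>i. X (j + i)) \<in> A} X) \<partial>?\<mu>) = real (M + N) * measure ?\<mu> A"
      using int[OF mA] by (simp add: Bochner_Integration.integral_sum shift_sets[OF mA] stat[OF mA iA])
    finally show ?thesis .
  qed
  have bound: "measure ?\<mu> (B N) \<le> measure ?\<mu> A / c" for N
  proof (rule tendsto_lowerbound)
    show "\<forall>\<^sub>F M in sequentially. measure ?\<mu> (B N) \<le> (1 + real N / real M) * (measure ?\<mu> A / c)"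
      using eventually_gt_at_top[of 0]
    proof eventually_elim
      case (elim M)
      then show ?case using main[of M N] \<open>c > 0\<close> by (simp add: field_simps)
    qed
    have "(\<lambda>M. (1 + real N / real M) * (measure ?\<mu> A / c)) \<longlonglongrightarrow> (1 + 0) * (measure ?\<mu> A / c)"
      by (intro tendsto_intros tendsto_divide_0[OF tendsto_const] filterlim_at_top_imp_at_infinity filterlim_real_sequentially)
    then show "(\<lambda>M. (1 + real N / real M) * (measure ?\<mu> A / c)) \<longlonglongrightarrow> measure ?\<mu> A / c" by simp
  qed simp
  have "incseq B" by (force simp: incseq_def B_def)
  then have "(\<lambda>N. measure ?\<mu> (B N)) \<longlonglongrightarrow> measure ?\<mu> (\<Union>N. B N)"
    using sets0[OF mB] by (intro \<mu>.finite_Lim_measure_incseq) auto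
  then have "measure ?\<mu> (\<Union>N. B N) \<le> measure ?\<mu> A / c"
    by (rule LIMSEQ_le_const2) (use bound in auto)
  moreover have "(\<Union>N. B N) = {X. \<exists>n\<ge>1. c * real n < (\<Sum>k<n. of_bool (no_return l (\<lambda>i. X (k + i))))}"
    unfolding B_def set_eq_iff UN_iff mem_Collect_eq Bex_def atLeastAtMost_iff
    using order_refl by blast
  ultimately show ?thesis by (simp add: A_def)
qed

lemma AE_site_range_sublinear:
  assumes lim: "(\<lambda>l. measure (biased_walk_law p) {X :: nat \<Rightarrow> ('d::finite) lamp_vertex. no_return l X}) \<longlonglongrightarrow> 0"
    and "c > 0"
  shows "AE X in (biased_walk_law p :: (nat \<Rightarrow> 'd lamp_vertex) measure).
    \<forall>\<^sub>F n in sequentially. real (card (site_range X n)) \<le> c * real n"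
proof -
  let ?\<mu> = "biased_walk_law p :: (nat \<Rightarrow> 'd lamp_vertex) measure"
  interpret \<mu>: finite_measure ?\<mu> by (rule finite_measure_biased_walk_law)
  define B where "B l = {X :: nat \<Rightarrow> 'd lamp_vertex.
      \<exists>n\<ge>1. c / 4 * real n < (\<Sum>k<n. of_bool (no_return l (\<lambda>i. X (k + i))))}" for l
  have "Measurable.pred path_space (\<lambda>X. X \<in> B l)" for l
    unfolding B_def mem_Collect_eq using measurable_no_return_at[of l, where 'd='d] by measurable
  then have mB: "B l \<in> sets ?\<mu>" for l
    using measurable_sets[of "\<lambda>X. X \<in> B l" path_space "count_space UNIV" "{True}"]
    by (simp add: space_PiM vimage_def)
  have "measure ?\<mu> (\<Inter>l. B l) \<le> measure ?\<mu> {X. no_return l X} / (c / 4)" for l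
    using measure_frequent_no_return_le[of "c / 4" p l] \<open>c > 0\<close> mB
      \<mu>.finite_measure_mono[of "\<Inter>l. B l" "B l"]
    unfolding B_def by (auto intro: order_trans)
  moreover have "(\<lambda>l. measure ?\<mu> {X. no_return l X} / (c / 4)) \<longlonglongrightarrow> 0 / (c / 4)"
    using \<open>c > 0\<close> by (intro tendsto_intros lim) auto
  ultimately have "measure ?\<mu> (\<Inter>l. B l) \<le> 0"
    using LIMSEQ_le_const by fastforce
  then have "measure ?\<mu> (\<Inter>l. B l) = 0" by (simp add: antisym)
  then have null: "(\<Inter>l. B l) \<in> null_sets ?\<mu>"
    using mB by (intro null_setsI) (auto simp: \<mu>.emeasure_eq_measure)
  show ?thesis
  proof (rule AE_I'[OF null], rule subsetI)
    fix X assume X: "X \<in> {X \<in> space ?\<mu>. \<not> (\<forall>\<^sub>F n in sequentially. real (card (site_range X n)) \<le> c * real n)}"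
    show "X \<in> (\<Inter>l. B l)"
    proof (rule ccontr)
      assume "X \<notin> (\<Inter>l. B l)"
      then obtain l where l: "(\<Sum>k<n. of_bool (no_return l (\<lambda>i. X (k + i)))) \<le> c / 4 * real n" if "n \<ge> 1" for n
        by (auto simp: B_def not_less)
      have "\<forall>\<^sub>F n in sequentially. real (card (site_range X n)) \<le> c * real n"
        using eventually_ge_at_top[of "max 1 (nat \<lceil>2 * real l / c\<rceil>)"]
      proof eventually_elim
        case (elim n)
        then have "2 * real l / c \<le> real n" by linarith
        then have "real l \<le> c / 2 * real n" using \<open>c > 0\<close> by (simp add: field_simps)
        moreover have "c / 4 * real (Suc n) \<le> c / 2 * real n"
          using elim \<open>c > 0\<close> by (simp add: field_simps)
        ultimately show ?case using card_site_range_le[of X n l] l[of "Suc n"] by (simp add: field_simps)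
      qed
      then show False using X by simp
    qed
  qed
qed


section \<open>A point has zero capacity in dimension at most two\<close>

text \<open>The \<open>\<ell>\<^sup>1\<close> norm, which is the graph distance to the origin in \<open>\<int>\<^sup>d\<close>.\<close>

definition l1 :: "int ^ ('d::finite) \<Rightarrow> nat" where
  "l1 m = (\<Sum>i\<in>UNIV. nat \<bar>m $ i\<bar>)"

lemma l1_adj:
  assumes "Zd_adj m m'"
  shows "l1 m' \<le> Suc (l1 m)" "l1 m \<le> Suc (l1 m')" "1 \<le> l1 m \<or> 1 \<le> l1 m'"
proof -
  have *: "int (l1 m) = (\<Sum>i\<in>UNIV. \<bar>m $ i\<bar>)" for m :: "int ^ 'a" by (simp add: l1_def)
  have le: "int (l1 b) \<le> int (l1 a) + 1" if "Zd_adj a b" for a b :: "int ^ 'a"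
  proof -
    have "int (l1 b) \<le> (\<Sum>i\<in>UNIV. \<bar>a $ i\<bar> + \<bar>a $ i - b $ i\<bar>)"
      unfolding * by (rule sum_mono) linarith
    then show ?thesis using that by (simp add: * sum.distrib Zd_adj_def)
  qed
  show "l1 m' \<le> Suc (l1 m)" using le[OF assms] by simp
  show "l1 m \<le> Suc (l1 m')" using le[of m' m] assms by (simp add: Zd_adj_sym)
  show "1 \<le> l1 m \<or> 1 \<le> l1 m'"
  proof (rule ccontr)
    assume "\<not> ?thesis"
    then have "m $ i = 0" "m' $ i = 0" for i by (simp_all add: l1_def not_le)
    then show False using assms by (simp add: Zd_adj_def)
  qed
qed

lemma l1_0 [simp]: "l1 0 = 0" by (simp add: l1_def)

lemma finite_l1_le: "finite {m :: int ^ ('d::finite). l1 m \<le> K}"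
proof (rule finite_subset)
  show "{m :: int ^ 'd. l1 m \<le> K} \<subseteq> vec_lambda ` (UNIV \<rightarrow>\<^sub>E {- int K..int K})"
  proof
    fix m :: "int ^ 'd" assume "m \<in> {m. l1 m \<le> K}"
    then have "l1 m \<le> K" by simp
    moreover have "nat \<bar>m $ i\<bar> \<le> l1 m" for i
      unfolding l1_def by (rule member_le_sum) auto
    ultimately have "nat \<bar>m $ i\<bar> \<le> K" for i by (meson order_trans)
    then have "m $ i \<in> {- int K..int K}" for i by (smt (verit) atLeastAtMost_iff nat_le_iff)
    then show "m \<in> vec_lambda ` (UNIV \<rightarrow>\<^sub>E {- int K..int K})"
      by (intro image_eqI[of _ _ "vec_nth m"]) auto
  qed
qed (intro finite_imageI finite_PiE; simp)

lemma card_l1_sphere_le: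
  assumes "CARD('d::finite) \<in> {1, 2}"
  shows "card {m :: int ^ 'd. l1 m = r} \<le> 6 * max 1 r"
proof -
  obtain i j :: 'd where ij: "UNIV = {i, j}"
    using assms by (auto simp: card_1_singleton_iff card_2_iff)
  let ?f = "\<lambda>m :: int ^ 'd. (m $ i, m $ j \<ge> 0)"
  have l1: "l1 m = (if i = j then nat \<bar>m $ i\<bar> else nat \<bar>m $ i\<bar> + nat \<bar>m $ j\<bar>)" for m :: "int ^ 'd"
    unfolding l1_def ij by auto
  have "inj_on ?f {m. l1 m = r}"
  proof (rule inj_onI)
    fix m m' :: "int ^ 'd"
    assume a: "m \<in> {m. l1 m = r}" "m' \<in> {m. l1 m = r}" "?f m = ?f m'"
    then have "m $ j = m' $ j" by (auto simp: l1 split: if_splits)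
    moreover have "m $ i = m' $ i" using a by simp
    ultimately have "\<forall>k\<in>{i, j}. m $ k = m' $ k" by simp
    then show "m = m'" unfolding ij[symmetric] by (simp add: vec_eq_iff)
  qed
  moreover have "?f ` {m. l1 m = r} \<subseteq> {- int r..int r} \<times> UNIV"
    by (auto simp: l1 split: if_splits)
  ultimately have "card {m :: int ^ 'd. l1 m = r} \<le> card ({- int r..int r} \<times> (UNIV :: bool set))"
    by (rule card_inj_on_le) simp
  also have "\<dots> \<le> 6 * max 1 r" by (simp add: card_cartesian_product)
  finally show ?thesis .
qed

text \<open>There are finitely supported functions with value 1 at the origin and arbitrarily small
  Dirichlet energy. Up to dimension two the sphere of radius \<open>r\<close> has at most \<open>6 * max 1 r\<close> points, so
  that a profile decreasing from 1 to 0 in steps proportional to \<open>1 / r\<close> has energy of the order of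
  the reciprocal of the harmonic number.\<close>

lemma zero_capacity:
  fixes e :: real
  assumes d: "CARD('d::finite) \<in> {1, 2}" and "e > 0"
  obtains \<phi> :: "int ^ 'd \<Rightarrow> real" and K where
    "\<phi> 0 = 1" "\<And>m. 0 \<le> \<phi> m" "\<And>m. \<phi> m \<le> 1" "\<And>m. l1 m \<ge> K \<Longrightarrow> \<phi> m = 0"
    "\<And>B. finite B \<Longrightarrow> (\<Sum>m\<in>B. \<Sum>m' | Zd_adj m m'. (\<phi> m - \<phi> m')\<^sup>2) \<le> e"
proof -
  let ?H = "\<lambda>n. harm n :: real"
  have lim: "filterlim ?H at_top sequentially" by (rule harm_at_top)
  have "(\<lambda>n. 24 * (inverse (?H n) + 1) * inverse (?H n)) \<longlonglongrightarrow> 24 * (0 + 1) * 0"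
    by (intro tendsto_intros tendsto_inverse_0_at_top lim)
  then have "\<forall>\<^sub>F n in sequentially. 24 * (inverse (?H n) + 1) * inverse (?H n) < e"
    using \<open>e > 0\<close> by (auto intro: order_tendstoD(2))
  moreover have "\<forall>\<^sub>F n in sequentially. ?H n > 0"
    using lim by (simp add: filterlim_at_top_dense)
  ultimately have "\<forall>\<^sub>F n in sequentially. 24 * (inverse (?H n) + 1) * inverse (?H n) < e \<and> ?H n > 0"
    by (rule eventually_conj)
  then obtain K where K: "24 * (inverse (?H K) + 1) * inverse (?H K) < e" "?H K > 0"
    by (auto simp: eventually_sequentially)
  define h where "h r = (if r \<le> K then 1 - ?H r / ?H K else 0)" for r
  define \<phi> where "\<phi> m = h (l1 m)" for m :: "int ^ 'd"
  have Hmono: "?H a \<le> ?H b" if "a \<le> b" for a b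
    unfolding harm_def using that by (intro sum_mono2) auto
  have h01: "0 \<le> h r" "h r \<le> 1" for r
    using Hmono[of r K] K(2) by (auto simp: h_def harm_nonneg field_simps)
  have hstep: "(h r - h (Suc r))\<^sup>2 \<le> (if Suc r \<le> K then (inverse (real (Suc r)) * inverse (?H K))\<^sup>2 else 0)" for r
  proof (cases "Suc r \<le> K")
    case True
    then have "h r - h (Suc r) = inverse (real (Suc r)) * inverse (?H K)"
      by (simp add: h_def harm_Suc divide_inverse distrib_right)
    then show ?thesis using True by simp
  next
    case False
    have HK: "?H K / ?H K = 1" using K(2) by (intro divide_self) linarith
    have "h r = 0" using False HK by (cases "r = K") (simp_all add: h_def)
    moreover have "h (Suc r) = 0" using False by (simp add: h_def)
    ultimately show ?thesis by simp
  qed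
  define w where "w r = (if r \<le> K then (inverse (real (max 1 r)) * inverse (?H K))\<^sup>2 else 0)" for r
  have step: "(\<phi> m - \<phi> m')\<^sup>2 \<le> w (l1 m)" if adj: "Zd_adj m m'" for m m' :: "int ^ 'd"
  proof -
    consider "l1 m' = l1 m" | "l1 m' = Suc (l1 m)" | "l1 m = Suc (l1 m')"
      using l1_adj[OF adj] by linarith
    then show ?thesis
    proof cases
      case 1
      then show ?thesis by (simp add: \<phi>_def w_def)
    next
      case 2
      have "inverse (real (Suc (l1 m))) \<le> inverse (real (max 1 (l1 m)))" by (intro le_imp_inverse_le) auto
      then have "(inverse (real (Suc (l1 m))) * inverse (?H K))\<^sup>2 \<le> (inverse (real (max 1 (l1 m))) * inverse (?H K))\<^sup>2"
        by (intro power_mono mult_right_mono) (auto simp: harm_nonneg)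
      then show ?thesis using hstep[of "l1 m"] 2 by (auto simp: \<phi>_def w_def split: if_splits)
    next
      case 3
      then show ?thesis using hstep[of "l1 m'"]
        by (auto simp: \<phi>_def w_def power2_commute max_def split: if_splits)
    qed
  qed
  have w0: "w r \<ge> 0" for r by (simp add: w_def)
  have nb: "finite {m'. Zd_adj m m'}" "card {m'. Zd_adj m m'} \<le> 4" for m :: "int ^ 'd"
    using d unfolding card_Zd_nbrs by (auto simp: Zd_nbrs_eq)
  have sum: "(\<Sum>m\<in>B. \<Sum>m' | Zd_adj m m'. (\<phi> m - \<phi> m')\<^sup>2) \<le> e" if "finite B" for B
  proof -
    have "(\<Sum>m\<in>B. \<Sum>m' | Zd_adj m m'. (\<phi> m - \<phi> m')\<^sup>2) \<le> (\<Sum>m\<in>B. 4 * w (l1 m))"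
    proof (rule sum_mono)
      fix m
      have "(\<Sum>m' | Zd_adj m m'. (\<phi> m - \<phi> m')\<^sup>2) \<le> real (card {m'. Zd_adj m m'}) * w (l1 m)"
        by (rule sum_bounded_above) (use step in auto)
      also have "\<dots> \<le> 4 * w (l1 m)" using nb(2)[of m] w0 by (intro mult_right_mono) auto
      finally show "(\<Sum>m' | Zd_adj m m'. (\<phi> m - \<phi> m')\<^sup>2) \<le> 4 * w (l1 m)" .
    qed
    also have "\<dots> \<le> (\<Sum>m\<in>B \<union> {m. l1 m \<le> K}. 4 * w (l1 m))"
      using that finite_l1_le by (intro sum_mono2) (auto simp: w0)
    also have "\<dots> = (\<Sum>m | l1 (m :: int ^ 'd) \<le> K. 4 * w (l1 m))"
      using that finite_l1_le by (intro sum.mono_neutral_right) (auto simp: w_def)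
    also have "\<dots> = (\<Sum>r\<le>K. \<Sum>m | m \<in> {m :: int ^ 'd. l1 m \<le> K} \<and> l1 m = r. 4 * w (l1 m))"
      by (rule sum.group[symmetric]) (auto simp: finite_l1_le)
    also have "\<dots> \<le> (\<Sum>r\<le>K. 24 * (inverse (?H K))\<^sup>2 * inverse (real (max 1 r)))"
    proof (rule sum_mono)
      fix r assume r: "r \<in> {..K}"
      have "(\<Sum>m | m \<in> {m :: int ^ 'd. l1 m \<le> K} \<and> l1 m = r. 4 * w (l1 m)) = real (card {m :: int ^ 'd. l1 m = r}) * (4 * w r)"
        using r by (simp add: conj_absorb cong: conj_cong) (metis (mono_tags, lifting) Collect_cong order_refl)
      also have "\<dots> \<le> real (6 * max 1 r) * (4 * w r)"
        using card_l1_sphere_le[OF d, of r] w0[of r] by (intro mult_right_mono of_nat_mono) auto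
      also have "\<dots> = 24 * (inverse (?H K))\<^sup>2 * inverse (real (max 1 r))"
        using r by (simp add: w_def power2_eq_square field_simps)
      finally show "(\<Sum>m | m \<in> {m :: int ^ 'd. l1 m \<le> K} \<and> l1 m = r. 4 * w (l1 m)) \<le> 24 * (inverse (?H K))\<^sup>2 * inverse (real (max 1 r))" .
    qed
    also have "\<dots> = 24 * (inverse (?H K))\<^sup>2 * (\<Sum>r\<le>K. inverse (real (max 1 r)))"
      by (simp add: sum_distrib_left)
    also have "(\<Sum>r\<le>K. inverse (real (max 1 r))) = 1 + ?H K"
    proof -
      have "{..K} = insert 0 {1..K}" by auto
      then show ?thesis by (simp add: harm_def max_def)
    qed
    also have "24 * (inverse (?H K))\<^sup>2 * (1 + ?H K) = 24 * (inverse (?H K) + 1) * inverse (?H K)"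
    proof -
      have "24 * (inverse x)\<^sup>2 * (1 + x) = 24 * (inverse x + 1) * inverse x" if "x > 0" for x :: real
        using that by (simp add: field_simps power2_eq_square)
      from this[OF K(2)] show ?thesis .
    qed
    finally show ?thesis using K(1) by simp
  qed
  show ?thesis
  proof (rule that[of \<phi> K])
    show "\<phi> 0 = 1" using K(2) by (simp add: \<phi>_def h_def harm_def)
    show "\<phi> m = 0" if "l1 m \<ge> K" for m
    proof (cases "l1 m = K")
      case True
      have "?H K / ?H K = 1" using K(2) by (intro divide_self) linarith
      then show ?thesis using True by (simp add: \<phi>_def h_def)
    qed (use that in \<open>simp add: \<phi>_def h_def\<close>)
  qed (use h01 sum in \<open>auto simp: \<phi>_def\<close>)
qed


section \<open>Recurrence of the position of the lamplighter\<close>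

text \<open>The quenched probability to visit the fibre over the site 0, that is, the set of all vertices at
  which the lamplighter stands at 0, at one of the times \<open>0, \<dots>, n\<close>.\<close>

definition hit :: "nat \<Rightarrow> (('d::finite) lamp_vertex set \<Rightarrow> bool) \<Rightarrow> 'd lamp_vertex \<Rightarrow> real" where
  "hit n \<omega> x = measure (walk_law lamplighter \<omega> x) {X. \<exists>i\<le>n. fst (X i) = 0}"

lemma pred_path_sets:
  "Measurable.pred path_space P \<Longrightarrow> {X. P X} \<in> sets (path_space :: (nat \<Rightarrow> 'v) measure)"
  by (drule predE) (simp add: space_PiM)

lemma hit_set_measurable [measurable]:
  "{X :: nat \<Rightarrow> ('d::finite) lamp_vertex. \<exists>i\<le>n. fst (X i) = 0} \<in> sets path_space"
proof -
  have "Measurable.pred path_space (\<lambda>X :: nat \<Rightarrow> 'd lamp_vertex. fst (X i) = 0)" for i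
    by (rule measurable_compose[OF measurable_component_singleton]) auto
  then have "Measurable.pred path_space (\<lambda>X :: nat \<Rightarrow> 'd lamp_vertex. \<exists>i\<in>{..n}. fst (X i) = 0)"
    by measurable
  from pred_path_sets[OF this] show ?thesis by (simp only: Bex_def atMost_iff)
qed

lemma space_walk_law [simp]:
  fixes G :: "'v::countable \<Rightarrow> 'v \<Rightarrow> bool"
  shows "space (walk_law G \<omega> x) = UNIV"
  by (simp add: sets_eq_imp_space_eq[OF sets_walk_law] space_PiM)

lemma emeasure_walk_law:
  fixes G :: "'v::countable \<Rightarrow> 'v \<Rightarrow> bool"
  shows "emeasure (walk_law G \<omega> x) A = ennreal (measure (walk_law G \<omega> x) A)"
proof -
  interpret prob_space "walk_law G \<omega> x" by (rule prob_space_walk_law)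
  show ?thesis by (rule emeasure_eq_measure)
qed

lemma emeasure_walk_law_first_step:
  fixes G :: "'v::countable \<Rightarrow> 'v \<Rightarrow> bool"
  assumes A: "A \<in> sets path_space"
  shows "emeasure (walk_law G \<omega> x) A =
    (\<integral>\<^sup>+y. emeasure (walk_law G \<omega> y) {X. case_nat x X \<in> A} \<partial>walk_step G \<omega> x)"
proof -
  have A': "{X. case_nat x X \<in> A} \<in> sets path_space"
    using measurable_sets[OF measurable_case_nat_path A, of x] by (simp add: space_PiM vimage_def)
  have "emeasure (walk_law G \<omega> x) A = (\<integral>\<^sup>+X. indicator A X \<partial>walk_law G \<omega> x)" using A by simp
  also have "\<dots> = (\<integral>\<^sup>+y. (\<integral>\<^sup>+X. indicator A (case_nat x X) \<partial>walk_law G \<omega> y) \<partial>walk_step G \<omega> x)"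
    using A by (intro nn_integral_walk_law_first_step) auto
  also have "\<dots> = (\<integral>\<^sup>+y. (\<integral>\<^sup>+X. indicator {X. case_nat x X \<in> A} X \<partial>walk_law G \<omega> y) \<partial>walk_step G \<omega> x)"
    by (simp add: indicator_def)
  finally show ?thesis using A' by simp
qed

lemma hit_nonneg: "0 \<le> hit n \<omega> x" by (simp add: hit_def)

lemma hit_le_1: "hit n \<omega> x \<le> 1"
proof -
  interpret prob_space "walk_law lamplighter \<omega> x" by (rule prob_space_walk_law)
  show ?thesis by (simp add: hit_def)
qed

lemma hit_mono:
  assumes "n \<le> m"
  shows "hit n \<omega> x \<le> hit m \<omega> x"
proof -
  interpret prob_space "walk_law lamplighter \<omega> x" by (rule prob_space_walk_law)
  show ?thesis unfolding hit_def
    using assms by (intro finite_measure_mono) (auto intro: le_trans)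
qed

lemma hit_fibre:
  assumes "fst x = 0"
  shows "hit n \<omega> x = 1"
proof -
  have 1: "emeasure (walk_law lamplighter \<omega> y) UNIV = 1" for y :: "'a lamp_vertex"
    using prob_space.emeasure_space_1[OF prob_space_walk_law, of lamplighter \<omega> y] by simp
  have "{X. case_nat x X \<in> {X. \<exists>i\<le>n. fst (X i) = 0}} = UNIV"
    using assms by (auto intro!: exI[of _ 0])
  then have "ennreal (hit n \<omega> x) = 1"
    unfolding hit_def emeasure_walk_law[symmetric] emeasure_walk_law_first_step[OF hit_set_measurable]
    by (simp add: 1 measure_pmf.emeasure_space_1)
  then show ?thesis by simp
qed

lemma hit_Suc:
  assumes "fst x \<noteq> 0"
  shows "ennreal (hit (Suc n) \<omega> x) = (\<integral>\<^sup>+y. ennreal (hit n \<omega> y) \<partial>walk_step lamplighter \<omega> x)"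
proof -
  have "(\<exists>i\<le>Suc n. fst (case_nat x X i) = 0) \<longleftrightarrow> (\<exists>i\<le>n. fst (X i) = 0)" for X
  proof
    assume "\<exists>i\<le>Suc n. fst (case_nat x X i) = 0"
    then obtain i where "i \<le> Suc n" "fst (case_nat x X i) = 0" by blast
    then show "\<exists>i\<le>n. fst (X i) = 0" using assms by (cases i) auto
  next
    assume "\<exists>i\<le>n. fst (X i) = 0"
    then obtain i where "i \<le> n" "fst (X i) = 0" by blast
    then show "\<exists>i\<le>Suc n. fst (case_nat x X i) = 0" by (intro exI[of _ "Suc i"]) simp
  qed
  then show ?thesis
    unfolding hit_def emeasure_walk_law[symmetric]
    by (subst emeasure_walk_law_first_step[OF hit_set_measurable]) simp
qed

lemma ennreal_sum_if:
  assumes "finite A" "\<And>y. y \<in> A \<Longrightarrow> 0 \<le> f y"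
  shows "(\<Sum>y\<in>A. if b y then ennreal (f y) else 0) = ennreal (\<Sum>y\<in>A. of_bool (b y) * f y)"
proof -
  have "(\<Sum>y\<in>A. if b y then ennreal (f y) else 0) = (\<Sum>y\<in>A. ennreal (of_bool (b y) * f y))"
    by (intro sum.cong) auto
  then show ?thesis using assms by (subst sum_ennreal[symmetric]) auto
qed

lemma deg_hit_Suc:
  assumes "fst x \<noteq> 0"
  shows "real (deg lamplighter \<omega> x) * hit (Suc n) \<omega> x =
    (\<Sum>y | lamplighter x y. of_bool (open_adj lamplighter \<omega> x y) * hit n \<omega> y)"
proof -
  have "ennreal (real (deg lamplighter \<omega> x) * hit (Suc n) \<omega> x) =
    ennreal (\<Sum>y | lamplighter x y. of_bool (open_adj lamplighter \<omega> x y) * hit n \<omega> y)"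
    by (simp only: ennreal_mult hit_nonneg of_nat_0_le_iff hit_Suc[OF assms]
        deg_mult_nn_integral_walk_step[OF degree_lamplighter(1)] ennreal_sum_if[OF degree_lamplighter(1)])
  then show ?thesis by (subst (asm) ennreal_inj) (auto intro!: sum_nonneg simp: hit_nonneg)
qed

lemma deg_no_return_Suc:
  "real (deg lamplighter \<omega> lamp_origin) * measure (walk_law lamplighter \<omega> lamp_origin) {X. no_return (Suc n) X} =
    (\<Sum>y | lamplighter lamp_origin y. of_bool (open_adj lamplighter \<omega> lamp_origin y) * (1 - hit n \<omega> y))"
proof -
  let ?o = "lamp_origin :: 'a lamp_vertex"
  have S: "{X :: nat \<Rightarrow> 'a lamp_vertex. no_return (Suc n) X} \<in> sets path_space"
    by (rule pred_path_sets[OF measurable_no_return])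
  have "{X. case_nat ?o X \<in> {X. no_return (Suc n) X}} = UNIV - {X. \<exists>i\<le>n. fst (X i) = 0}"
    by (force simp: no_return_def lamp_origin_def split: nat.splits)
  moreover have "emeasure (walk_law lamplighter \<omega> y) (UNIV - {X. \<exists>i\<le>n. fst (X i) = 0}) = ennreal (1 - hit n \<omega> y)" for y
  proof -
    interpret prob_space "walk_law lamplighter \<omega> y" by (rule prob_space_walk_law)
    show ?thesis using prob_compl[of "{X. \<exists>i\<le>n. fst (X i) = 0}"]
      by (simp add: emeasure_eq_measure hit_def)
  qed
  ultimately have "ennreal (measure (walk_law lamplighter \<omega> ?o) {X. no_return (Suc n) X}) =
    (\<integral>\<^sup>+y. ennreal (1 - hit n \<omega> y) \<partial>walk_step lamplighter \<omega> ?o)"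
    unfolding emeasure_walk_law[symmetric] emeasure_walk_law_first_step[OF S] by simp
  then have "ennreal (real (deg lamplighter \<omega> ?o) * measure (walk_law lamplighter \<omega> ?o) {X. no_return (Suc n) X}) =
    ennreal (\<Sum>y | lamplighter ?o y. of_bool (open_adj lamplighter \<omega> ?o y) * (1 - hit n \<omega> y))"
    by (simp only: ennreal_mult measure_nonneg of_nat_0_le_iff diff_ge_0_iff_ge hit_le_1
        deg_mult_nn_integral_walk_step[OF degree_lamplighter(1)] ennreal_sum_if[OF degree_lamplighter(1)])
  then show ?thesis by (subst (asm) ennreal_inj) (auto intro!: sum_nonneg simp: hit_le_1)
qed

lemma set_walk_step:
  assumes "finite {y. G x y}" "y \<in> set_pmf (walk_step G \<omega> x)"
  shows "y = x \<or> G x y"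
  using assms(2) finite_open_nbrs[of G x \<omega>, OF assms(1)]
  by (auto simp: walk_step_def open_nbrs_def open_adj_def split: if_splits)

lemma hit_far:
  assumes "n < l1 (fst x)"
  shows "hit n \<omega> x = 0"
  using assms
proof (induction n arbitrary: x)
  case 0
  then have "fst x \<noteq> 0" by (metis l1_0 less_irrefl)
  then have "{X. case_nat x X \<in> {X. \<exists>i\<le>0. fst (X i) = 0}} = {}" by auto
  then have "ennreal (hit 0 \<omega> x) = 0"
    unfolding hit_def emeasure_walk_law[symmetric] emeasure_walk_law_first_step[OF hit_set_measurable]
    by simp
  then show ?case by (simp add: hit_nonneg antisym)
next
  case (Suc n)
  have ne: "fst x \<noteq> 0" using Suc.prems by (metis l1_0 not_less0)
  have "hit n \<omega> y = 0" if "y \<in> set_pmf (walk_step lamplighter \<omega> x)" for y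
  proof (rule Suc.IH)
    have "y = x \<or> fst y = fst x \<or> Zd_adj (fst x) (fst y)"
      using set_walk_step[OF degree_lamplighter(1) that] by (auto simp: lamplighter_def split: prod.splits)
    then show "n < l1 (fst y)" using Suc.prems l1_adj(2)[of "fst x" "fst y"] by auto
  qed
  then have "ennreal (hit (Suc n) \<omega> x) = (\<integral>\<^sup>+y. 0 \<partial>walk_step lamplighter \<omega> x)"
    unfolding hit_Suc[OF ne] by (intro nn_integral_cong_AE) (simp add: AE_measure_pmf_iff)
  then show ?case by (simp add: hit_nonneg antisym)
qed

lemma hit_flip: "hit n (act lamplighter (flip a) \<omega>) x = hit n \<omega> (flip a x)"
proof -
  have "(\<lambda>X i. flip a (X i)) \<in> measurable (walk_law lamplighter (act lamplighter (flip a) \<omega>) x) path_space"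
    using measurable_map_path measurable_cong_sets[OF sets_walk_law refl] by blast
  then show ?thesis
    unfolding hit_def walk_law_act[OF graph_aut_flip degree_lamplighter(1)]
    by (subst measure_distr) (auto simp: vimage_def)
qed

lemma measurable_hit [measurable]:
  "(\<lambda>\<omega>. hit n \<omega> x) \<in> borel_measurable (percolation lamplighter p)"
proof -
  have "(\<lambda>\<omega>. emeasure (walk_law lamplighter \<omega> x) {X. \<exists>i\<le>n. fst (X i) = 0}) \<in> borel_measurable (percolation lamplighter p)"
    by (rule measurable_compose[OF measurable_walk_law[OF degree_lamplighter(1)]])
       (rule measurable_emeasure_subprob_algebra[OF hit_set_measurable])
  then show ?thesis unfolding hit_def measure_def by measurable
qed

text \<open>Summation by parts in \<open>B\<close> followed by \<open>2 x y \<le> x\<^sup>2 + y\<^sup>2\<close>. The support condition makes the boundary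
  terms vanish.\<close>

lemma dirichlet_inequality:
  fixes \<phi> u :: "'a \<Rightarrow> real" and w :: "'a \<Rightarrow> 'a \<Rightarrow> real"
  assumes fin: "finite B" "\<And>m. finite (N m)"
    and N: "\<And>m m'. m' \<in> N m \<longleftrightarrow> m \<in> N m'"
    and w: "\<And>m m'. w m m' = w m' m" "\<And>m m'. 0 \<le> w m m'" "\<And>m m'. w m m' \<le> 1"
    and supp: "\<And>m. m \<in> B \<Longrightarrow> \<phi> m \<noteq> 0 \<or> u m \<noteq> 0 \<Longrightarrow> N m \<subseteq> B"
  defines "L m \<equiv> (\<Sum>m'\<in>N m. w m m' * (u m - u m'))"
  shows "(\<Sum>m\<in>B. \<phi> m * L m) \<le>
    (\<Sum>m\<in>B. \<Sum>m'\<in>N m. (\<phi> m - \<phi> m')\<^sup>2) / 4 + (\<Sum>m\<in>B. u m * L m) / 2"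
proof -
  define W where "W m m' = (if m' \<in> N m then w m m' else 0)" for m m'
  have W: "W m m' = W m' m" "0 \<le> W m m'" for m m' using N w by (auto simp: W_def)
  define T where "T f = (\<Sum>m\<in>B. \<Sum>m'\<in>B. f m * (W m m' * (u m - u m')))" for f
  have L: "(\<Sum>m\<in>B. f m * L m) = T f" if "\<And>m. m \<in> B \<Longrightarrow> f m \<noteq> 0 \<Longrightarrow> N m \<subseteq> B" for f :: "'a \<Rightarrow> real"
    unfolding T_def
  proof (rule sum.cong[OF refl])
    fix m assume m: "m \<in> B"
    show "f m * L m = (\<Sum>m'\<in>B. f m * (W m m' * (u m - u m')))"
    proof (cases "f m = 0")
      case False
      have "L m = (\<Sum>m'\<in>B. W m m' * (u m - u m'))"
        unfolding L_def using that[OF m False] fin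
        by (intro sum.mono_neutral_cong_left) (auto simp: W_def)
      then show ?thesis by (simp add: sum_distrib_left)
    qed simp
  qed
  have T: "2 * T f = (\<Sum>m\<in>B. \<Sum>m'\<in>B. W m m' * ((f m - f m') * (u m - u m')))" for f
  proof -
    have "T f = (\<Sum>m\<in>B. \<Sum>m'\<in>B. f m' * (W m m' * (u m' - u m)))"
      unfolding T_def by (subst sum.swap) (simp add: W)
    then have "2 * T f = (\<Sum>m\<in>B. \<Sum>m'\<in>B. f m * (W m m' * (u m - u m')) + f m' * (W m m' * (u m' - u m)))"
      by (simp add: T_def sum.distrib)
    also have "\<dots> = (\<Sum>m\<in>B. \<Sum>m'\<in>B. W m m' * ((f m - f m') * (u m - u m')))"
      by (intro sum.cong) (auto simp: algebra_simps)
    finally show ?thesis .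
  qed
  have "2 * T \<phi> \<le> (\<Sum>m\<in>B. \<Sum>m'\<in>B. W m m' * (\<phi> m - \<phi> m')\<^sup>2 / 2 + W m m' * ((u m - u m') * (u m - u m')) / 2)"
    unfolding T
  proof (intro sum_mono)
    fix m m'
    have "a * b \<le> a\<^sup>2 / 2 + (b * b) / 2" for a b :: real
      using sum_squares_bound[of a b] by (simp add: power2_eq_square)
    from mult_left_mono[OF this W(2)[of m m'], of "\<phi> m - \<phi> m'" "u m - u m'"]
    show "W m m' * ((\<phi> m - \<phi> m') * (u m - u m')) \<le>
      W m m' * (\<phi> m - \<phi> m')\<^sup>2 / 2 + W m m' * ((u m - u m') * (u m - u m')) / 2"
      by (simp add: distrib_left)
  qed
  also have "\<dots> = (\<Sum>m\<in>B. \<Sum>m'\<in>B. W m m' * (\<phi> m - \<phi> m')\<^sup>2) / 2 + T u"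
    using T[of u] by (simp add: sum.distrib sum_divide_distrib[symmetric])
  also have "(\<Sum>m\<in>B. \<Sum>m'\<in>B. W m m' * (\<phi> m - \<phi> m')\<^sup>2) \<le> (\<Sum>m\<in>B. \<Sum>m'\<in>N m. (\<phi> m - \<phi> m')\<^sup>2)"
  proof (rule sum_mono)
    fix m
    have "(\<Sum>m'\<in>B. W m m' * (\<phi> m - \<phi> m')\<^sup>2) \<le> (\<Sum>m'\<in>B. if m' \<in> N m then (\<phi> m - \<phi> m')\<^sup>2 else 0)"
      using w by (intro sum_mono) (auto simp: W_def intro: mult_left_le_one_le)
    also have "\<dots> = (\<Sum>m'\<in>B \<inter> N m. (\<phi> m - \<phi> m')\<^sup>2)"
      using fin(1) by (simp add: sum.inter_restrict)
    also have "\<dots> \<le> (\<Sum>m'\<in>N m. (\<phi> m - \<phi> m')\<^sup>2)" using fin by (intro sum_mono2) auto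
    finally show "(\<Sum>m'\<in>B. W m m' * (\<phi> m - \<phi> m')\<^sup>2) \<le> (\<Sum>m'\<in>N m. (\<phi> m - \<phi> m')\<^sup>2)" .
  qed
  finally show ?thesis using L[of \<phi>] L[of u] supp by simp
qed

lemma lamplighter_nbrs:
  "{y. lamplighter (m, A) y} = insert (flip m (m, A)) ((\<lambda>m'. (m', A)) ` {m'. Zd_adj m m'})"
  by (auto simp: lamplighter_def flip_def)

lemma sum_lamplighter_nbrs:
  fixes g :: "('d::finite) lamp_vertex \<Rightarrow> real"
  shows "(\<Sum>y | lamplighter (m, A) y. g y) = g (flip m (m, A)) + (\<Sum>m' | Zd_adj m m'. g (m', A))"
proof -
  have fin: "finite {m'. Zd_adj m m'}" by (simp add: Zd_nbrs_eq)
  have "switch m A \<noteq> A" using fset_switch[of m A] by auto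
  then have "flip m (m, A) \<notin> (\<lambda>m'. (m', A)) ` {m'. Zd_adj m m'}" by (auto simp: flip_def)
  moreover have "inj_on (\<lambda>m'. (m', A)) {m'. Zd_adj m m'}" by (auto simp: inj_on_def)
  ultimately show ?thesis
    unfolding lamplighter_nbrs using fin by (simp add: sum.reindex)
qed

lemma deg_eq_sum:
  assumes "finite {y. G x y}"
  shows "real (deg G \<omega> x) = (\<Sum>y | G x y. of_bool (open_adj G \<omega> x y))"
proof -
  have "open_nbrs G \<omega> x = {y. G x y} \<inter> {y. open_adj G \<omega> x y}"
    by (auto simp: open_nbrs_def open_adj_def)
  then show ?thesis using assms by simp
qed

text \<open>Dirichlet's principle on the quotient by the lamp group. Let \<open>q\<close> be the left-hand side,
  \<open>V m\<close> the probability to hit the fibre over 0 from \<open>(m, \<emptyset>)\<close>, and \<open>lap\<close> the Laplacian of the hitting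
  probability in the open subgraph. The expectation of \<open>lap\<close> is \<open>q\<close> at 0, and elsewhere it is nonpositive
  and tends to 0 with growing \<open>n\<close>. Testing \<open>lap\<close> against \<open>\<phi>\<close> gives \<open>q\<close> up to that error. The
  contribution of the lamp edges to this sum has mean 0, since switching the lamp exchanges the two
  endpoints of such an edge; for the remaining edges the sum is at most \<open>e / 4\<close> plus half the energy of
  \<open>V\<close>, and this energy is at most \<open>q\<close>.\<close>

lemma no_return_le:
  fixes \<phi> :: "int ^ ('d::finite) \<Rightarrow> real" and p :: real
  assumes \<phi>: "\<phi> 0 = 1" "\<And>m. 0 \<le> \<phi> m" "\<And>m. \<phi> m \<le> 1" "\<And>m. l1 m \<ge> K \<Longrightarrow> \<phi> m = 0"
    and e: "\<And>B. finite B \<Longrightarrow> (\<Sum>m\<in>B. \<Sum>m' | Zd_adj m m'. (\<phi> m - \<phi> m')\<^sup>2) \<le> e"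
  defines "h n m \<equiv> (\<integral>\<omega>. hit n \<omega> (m, {||}) \<partial>percolation (lamplighter :: 'd lamp_vertex \<Rightarrow> _) p)"
  shows "measure (biased_walk_law p) {X :: nat \<Rightarrow> 'd lamp_vertex. no_return (Suc n) X} \<le>
    e / 2 + 2 * real (2 * CARD('d) + 1) * (\<Sum>m | l1 m \<le> K. h (Suc n) m - h n m)"
proof -
  let ?G = "lamplighter :: 'd lamp_vertex \<Rightarrow> _" and ?o = "lamp_origin :: 'd lamp_vertex"
  let ?P = "percolation ?G p"
  interpret P: prob_space ?P by (rule prob_space_percolation)
  define D where "D = real (2 * CARD('d) + 1)"
  define c where "c \<omega> x y = (of_bool (open_adj ?G \<omega> x y) :: real)" for \<omega> x y
  have c: "0 \<le> c \<omega> x y" "c \<omega> x y \<le> 1" "c \<omega> x y = c \<omega> y x" for \<omega> x y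
    using open_adj_sym[of ?G, OF lamplighter_sym] by (auto simp: c_def)
  have mc [measurable]: "(\<lambda>\<omega>. c \<omega> x y) \<in> borel_measurable ?P" for x y
    unfolding c_def using measurable_open_adj[of ?G x y p] by measurable
  define V where "V \<omega> m = hit n \<omega> (m, {||})" for \<omega> and m :: "int ^ 'd"
  define lat where "lat \<omega> m = (\<Sum>m' | Zd_adj m m'. c \<omega> (m, {||}) (m', {||}) * (V \<omega> m - V \<omega> m'))" for \<omega> m
  define lamp where "lamp \<omega> m = c \<omega> (m, {||}) (flip m (m, {||})) * (V \<omega> m - hit n \<omega> (flip m (m, {||})))" for \<omega> m
  define lap where "lap \<omega> m = (\<Sum>y | ?G (m, {||}) y. c \<omega> (m, {||}) y * (V \<omega> m - hit n \<omega> y))" for \<omega> m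
  have lap_eq: "lap \<omega> m = lamp \<omega> m + lat \<omega> m" for \<omega> m
    unfolding lap_def lamp_def lat_def V_def sum_lamplighter_nbrs ..
  have V01: "0 \<le> V \<omega> m" "V \<omega> m \<le> 1" for \<omega> m by (auto simp: V_def hit_nonneg hit_le_1)
  have mV [measurable]: "(\<lambda>\<omega>. V \<omega> m) \<in> borel_measurable ?P" for m unfolding V_def by measurable
  have mlat [measurable]: "(\<lambda>\<omega>. lat \<omega> m) \<in> borel_measurable ?P" for m unfolding lat_def by measurable
  have mlamp [measurable]: "(\<lambda>\<omega>. lamp \<omega> m) \<in> borel_measurable ?P" for m unfolding lamp_def by measurable
  have term_bound: "\<bar>c \<omega> x y * (hit n \<omega> x' - hit n \<omega> y')\<bar> \<le> 1" for \<omega> x y x' y'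
  proof -
    have "\<bar>hit n \<omega> x' - hit n \<omega> y'\<bar> \<le> 1"
      using hit_nonneg[of n \<omega> x'] hit_nonneg[of n \<omega> y'] hit_le_1[of n \<omega> x'] hit_le_1[of n \<omega> y'] by linarith
    then show ?thesis by (simp add: c_def)
  qed
  have bd: "\<bar>lamp \<omega> m\<bar> \<le> 1" "\<bar>lat \<omega> m\<bar> \<le> real (card {m'. Zd_adj m m'})" for \<omega> m
  proof -
    show "\<bar>lamp \<omega> m\<bar> \<le> 1" unfolding lamp_def V_def by (rule term_bound)
    have "\<bar>lat \<omega> m\<bar> \<le> (\<Sum>m' | Zd_adj m m'. \<bar>c \<omega> (m, {||}) (m', {||}) * (V \<omega> m - V \<omega> m')\<bar>)"
      unfolding lat_def by (rule sum_abs)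
    also have "\<dots> \<le> real (card {m'. Zd_adj m m'}) * 1"
      by (rule sum_bounded_above) (simp add: V_def term_bound)
    finally show "\<bar>lat \<omega> m\<bar> \<le> real (card {m'. Zd_adj m m'})" by simp
  qed
  have int_lat [simp]: "integrable ?P (\<lambda>\<omega>. lat \<omega> m)" for m
    by (rule P.integrable_const_bound[where B="real (card {m'. Zd_adj m m'})"]) (use bd in auto)
  have int_lamp [simp]: "integrable ?P (\<lambda>\<omega>. lamp \<omega> m)" for m
    by (rule P.integrable_const_bound[where B=1]) (use bd in auto)
  have Vb: "\<bar>V \<omega> m * t\<bar> \<le> b" if "\<bar>t\<bar> \<le> b" for \<omega> m t b
    using mult_left_le_one_le[of "\<bar>t\<bar>" "V \<omega> m"] V01[of \<omega> m] that by (simp add: abs_mult)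
  have int_Vlat [simp]: "integrable ?P (\<lambda>\<omega>. V \<omega> m * lat \<omega> m)" for m
    by (rule P.integrable_const_bound[where B="real (card {m'. Zd_adj m m'})"])
       (use Vb bd in auto)
  have int_Vlamp [simp]: "integrable ?P (\<lambda>\<omega>. V \<omega> m * lamp \<omega> m)" for m
    by (rule P.integrable_const_bound[where B=1])
       (use Vb bd in auto)
  have int_lap [simp]: "integrable ?P (\<lambda>\<omega>. lap \<omega> m)" for m unfolding lap_eq by simp
  have int_hit [simp]: "integrable ?P (\<lambda>\<omega>. hit k \<omega> x)" for k x
    by (rule P.integrable_const_bound[where B=1]) (auto simp: hit_nonneg hit_le_1)
  \<comment> \<open>Switching the lamp at \<open>m\<close> preserves the law of the percolation and exchanges the ends of the lamp edge.\<close>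
  have flip_int: "(\<integral>\<omega>. f (act ?G (flip m) \<omega>) \<partial>?P) = (\<integral>\<omega>. f \<omega> \<partial>?P)" if "f \<in> borel_measurable ?P" for f :: "_ \<Rightarrow> real" and m
  proof -
    have "(\<integral>\<omega>. f \<omega> \<partial>?P) = (\<integral>\<omega>. f \<omega> \<partial>distr ?P ?P (act ?G (flip m)))" by (simp add: distr_act[OF graph_aut_flip])
    also have "\<dots> = (\<integral>\<omega>. f (act ?G (flip m) \<omega>) \<partial>?P)"
      by (rule integral_distr[OF measurable_act[OF graph_aut_flip] that])
    finally show ?thesis by simp
  qed
  have lamp_act: "lamp (act ?G (flip m) \<omega>) m = - lamp \<omega> m"
    and V_act: "V (act ?G (flip m) \<omega>) m = hit n \<omega> (flip m (m, {||}))" for \<omega> m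
    using c(3)[of \<omega> "(m, {||})" "flip m (m, {||})"]
    by (auto simp: lamp_def V_def hit_flip c_def open_adj_act[OF graph_aut_flip] algebra_simps)
  have E_lamp: "(\<integral>\<omega>. lamp \<omega> m \<partial>?P) = 0" for m
    using flip_int[OF mlamp[of m], of m] by (simp add: lamp_act)
  have E_Vlamp: "0 \<le> (\<integral>\<omega>. V \<omega> m * lamp \<omega> m \<partial>?P)" for m
  proof -
    let ?f = "\<lambda>\<omega>. V \<omega> m * lamp \<omega> m"
    have i2: "integrable ?P (\<lambda>\<omega>. ?f (act ?G (flip m) \<omega>))"
      by (rule integrable_distr[OF measurable_act[OF graph_aut_flip], where f="?f"])
         (simp add: distr_act[OF graph_aut_flip])
    have "0 \<le> (\<integral>\<omega>. ?f \<omega> + ?f (act ?G (flip m) \<omega>) \<partial>?P)"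
    proof (rule integral_nonneg_AE, rule AE_I2)
      fix \<omega>
      have "?f \<omega> + ?f (act ?G (flip m) \<omega>) = c \<omega> (m, {||}) (flip m (m, {||})) * (V \<omega> m - hit n \<omega> (flip m (m, {||})))\<^sup>2"
        unfolding lamp_act V_act by (simp add: lamp_def power2_eq_square algebra_simps)
      then show "0 \<le> ?f \<omega> + ?f (act ?G (flip m) \<omega>)" using c(1) by simp
    qed
    also have "\<dots> = 2 * (\<integral>\<omega>. ?f \<omega> \<partial>?P)"
      by (subst Bochner_Integration.integral_add[OF int_Vlamp i2]) (subst flip_int, measurable)
    finally show ?thesis by simp
  qed
  define q where "q = measure (biased_walk_law p) {X :: nat \<Rightarrow> 'd lamp_vertex. no_return (Suc n) X}"
  have lap_0: "lap \<omega> 0 = real (deg ?G \<omega> ?o) * measure (walk_law ?G \<omega> ?o) {X. no_return (Suc n) X}" for \<omega>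
    using deg_no_return_Suc[of \<omega> n] by (simp add: lap_def V_def c_def lamp_origin_def hit_fibre)
  have lap_0_nonneg: "0 \<le> lap \<omega> 0" for \<omega> unfolding lap_0 by simp
  have E_lap_0: "(\<integral>\<omega>. lap \<omega> 0 \<partial>?P) = q"
  proof -
    interpret \<mu>: finite_measure "biased_walk_law p :: (nat \<Rightarrow> 'd lamp_vertex) measure"
      by (rule finite_measure_biased_walk_law)
    have S: "{X :: nat \<Rightarrow> 'd lamp_vertex. no_return (Suc n) X} \<in> sets path_space"
      by (rule pred_path_sets[OF measurable_no_return])
    have "ennreal q = (\<integral>\<^sup>+X. indicator {X :: nat \<Rightarrow> 'd lamp_vertex. no_return (Suc n) X} X \<partial>biased_walk_law p)"
      using S by (simp add: q_def \<mu>.emeasure_eq_measure)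
    also have "\<dots> = (\<integral>\<^sup>+\<omega>. ennreal (lap \<omega> 0) \<partial>?P)"
      using S by (subst nn_integral_biased_walk_law) (auto simp: lap_0 ennreal_mult emeasure_walk_law intro!: nn_integral_cong)
    also have "\<dots> = ennreal (\<integral>\<omega>. lap \<omega> 0 \<partial>?P)"
      by (rule nn_integral_eq_integral) (auto simp: lap_0_nonneg)
    finally show ?thesis
      by (subst (asm) ennreal_inj) (auto simp: q_def lap_0_nonneg intro!: integral_nonneg_AE)
  qed
  have lap_ne: "lap \<omega> m = real (deg ?G \<omega> (m, {||})) * (V \<omega> m - hit (Suc n) \<omega> (m, {||}))" if "m \<noteq> 0" for \<omega> m
  proof -
    have "real (deg ?G \<omega> (m, {||})) * hit (Suc n) \<omega> (m, {||}) = (\<Sum>y | ?G (m, {||}) y. c \<omega> (m, {||}) y * hit n \<omega> y)"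
      unfolding c_def using that by (intro deg_hit_Suc) simp
    moreover have "real (deg ?G \<omega> (m, {||})) = (\<Sum>y | ?G (m, {||}) y. c \<omega> (m, {||}) y)"
      unfolding c_def by (rule deg_eq_sum[OF degree_lamplighter(1)])
    ultimately show ?thesis
      by (simp add: lap_def right_diff_distrib sum_subtractf sum_distrib_right)
  qed
  have deg_le: "real (deg ?G \<omega> x) \<le> D" for \<omega> x
    unfolding D_def by (intro of_nat_mono deg_lamplighter_le)
  have lap_ne_bounds: "lap \<omega> m \<le> 0" "- D * (hit (Suc n) \<omega> (m, {||}) - hit n \<omega> (m, {||})) \<le> lap \<omega> m" if "m \<noteq> 0" for \<omega> m
  proof -
    have d: "0 \<le> hit (Suc n) \<omega> (m, {||}) - hit n \<omega> (m, {||})" using hit_mono[of n "Suc n"] by simp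
    then show "lap \<omega> m \<le> 0" unfolding lap_ne[OF that] V_def by (simp add: mult_nonneg_nonpos)
    from mult_right_mono[OF deg_le[of \<omega> "(m, {||})"] d]
    show "- D * (hit (Suc n) \<omega> (m, {||}) - hit n \<omega> (m, {||})) \<le> lap \<omega> m"
      unfolding lap_ne[OF that] V_def by (simp add: algebra_simps)
  qed
  define B where "B = {m :: int ^ 'd. l1 m \<le> Suc (max K n)}"
  have finB: "finite B" unfolding B_def by (rule finite_l1_le)
  have "0 \<in> B" by (simp add: B_def)
  have dir: "(\<Sum>m\<in>B. \<phi> m * lat \<omega> m) \<le> e / 4 + (\<Sum>m\<in>B. V \<omega> m * lat \<omega> m) / 2" for \<omega>
  proof -
    have "(\<Sum>m\<in>B. \<phi> m * lat \<omega> m) \<le> (\<Sum>m\<in>B. \<Sum>m' | Zd_adj m m'. (\<phi> m - \<phi> m')\<^sup>2) / 4 + (\<Sum>m\<in>B. V \<omega> m * lat \<omega> m) / 2"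
      unfolding lat_def
    proof (rule dirichlet_inequality[where w="\<lambda>m m'. c \<omega> (m, {||}) (m', {||})"])
      fix m assume "m \<in> B" "\<phi> m \<noteq> 0 \<or> V \<omega> m \<noteq> 0"
      then have "l1 m < K \<or> l1 m \<le> n"
        using \<phi>(4)[of m] hit_far[of n "(m, {||})" \<omega>] by (auto simp: V_def not_less[symmetric])
      then show "{m'. Zd_adj m m'} \<subseteq> B" using l1_adj(1) by (fastforce simp: B_def)
    next
      show "finite {m'. Zd_adj m m'}" for m :: "int ^ 'd" by (simp add: Zd_nbrs_eq)
      show "m' \<in> {m'. Zd_adj m m'} \<longleftrightarrow> m \<in> {m. Zd_adj m' m}" for m m' :: "int ^ 'd"
        using Zd_adj_sym[of m m'] by simp
    qed (use c finB in auto)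
    then show ?thesis using e[OF finB] by linarith
  qed
  have "(\<Sum>m\<in>B. \<phi> m * (\<integral>\<omega>. lap \<omega> m \<partial>?P)) = (\<Sum>m\<in>B. \<phi> m * (\<integral>\<omega>. lat \<omega> m \<partial>?P))"
    unfolding lap_eq by (simp add: E_lamp)
  also have "\<dots> = (\<integral>\<omega>. (\<Sum>m\<in>B. \<phi> m * lat \<omega> m) \<partial>?P)"
    by (simp add: Bochner_Integration.integral_sum)
  also have "\<dots> \<le> (\<integral>\<omega>. e / 4 + (\<Sum>m\<in>B. V \<omega> m * lat \<omega> m) / 2 \<partial>?P)"
    by (intro integral_mono dir) auto
  also have "\<dots> = e / 4 + (\<Sum>m\<in>B. \<integral>\<omega>. V \<omega> m * lat \<omega> m \<partial>?P) / 2"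
    by (simp add: Bochner_Integration.integral_sum P.prob_space)
  also have "(\<Sum>m\<in>B. \<integral>\<omega>. V \<omega> m * lat \<omega> m \<partial>?P) \<le> (\<Sum>m\<in>B. if m = 0 then q else 0)"
  proof (rule sum_mono)
    fix m
    have "(\<integral>\<omega>. V \<omega> m * lat \<omega> m \<partial>?P) \<le> (\<integral>\<omega>. V \<omega> m * lamp \<omega> m \<partial>?P) + (\<integral>\<omega>. V \<omega> m * lat \<omega> m \<partial>?P)"
      using E_Vlamp[of m] by simp
    also have "\<dots> = (\<integral>\<omega>. V \<omega> m * lap \<omega> m \<partial>?P)"
      unfolding lap_eq distrib_left by simp
    also have "\<dots> \<le> (if m = 0 then q else 0)"
    proof (cases "m = 0")
      case True
      then show ?thesis using E_lap_0 by (simp add: V_def hit_fibre)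
    next
      case False
      have "V \<omega> m * lap \<omega> m \<le> 0" for \<omega>
        using V01(1) lap_ne_bounds(1)[OF False] by (rule mult_nonneg_nonpos)
      then have "(\<integral>\<omega>. V \<omega> m * lap \<omega> m \<partial>?P) \<le> (\<integral>\<omega>. 0 \<partial>?P)"
        by (intro integral_mono) (auto simp: lap_eq distrib_left)
      then show ?thesis using False by simp
    qed
    finally show "(\<integral>\<omega>. V \<omega> m * lat \<omega> m \<partial>?P) \<le> (if m = 0 then q else 0)" .
  qed
  also have "(\<Sum>m\<in>B. if m = 0 then q else 0) = q" using finB \<open>0 \<in> B\<close> by simp
  finally have upper: "(\<Sum>m\<in>B. \<phi> m * (\<integral>\<omega>. lap \<omega> m \<partial>?P)) \<le> e / 4 + q / 2" by simp
  have h_mono: "0 \<le> h (Suc n) m - h n m" for m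
    unfolding h_def diff_ge_0_iff_ge by (intro integral_mono hit_mono int_hit) simp
  have "q - D * (\<Sum>m | l1 m \<le> K. h (Suc n) m - h n m) \<le> q - D * (\<Sum>m\<in>B - {0}. if l1 m \<le> K then h (Suc n) m - h n m else 0)"
  proof -
    have "(\<Sum>m\<in>B - {0}. if l1 m \<le> K then h (Suc n) m - h n m else 0) = (\<Sum>m\<in>(B - {0}) \<inter> {m. l1 m \<le> K}. h (Suc n) m - h n m)"
      using finB by (simp add: sum.inter_restrict)
    also have "\<dots> \<le> (\<Sum>m | l1 m \<le> K. h (Suc n) m - h n m)"
      by (rule sum_mono2[OF finite_l1_le _ h_mono]) auto
    finally show ?thesis by (simp add: D_def mult_left_mono)
  qed
  also have "\<dots> = \<phi> 0 * q + (\<Sum>m\<in>B - {0}. - D * (if l1 m \<le> K then h (Suc n) m - h n m else 0))"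
    by (simp add: \<phi> sum_distrib_left sum_negf)
  also have "\<dots> \<le> \<phi> 0 * q + (\<Sum>m\<in>B - {0}. \<phi> m * (\<integral>\<omega>. lap \<omega> m \<partial>?P))"
  proof (intro add_left_mono sum_mono)
    fix m assume m: "m \<in> B - {0}"
    show "- D * (if l1 m \<le> K then h (Suc n) m - h n m else 0) \<le> \<phi> m * (\<integral>\<omega>. lap \<omega> m \<partial>?P)"
    proof (cases "l1 m \<le> K")
      case True
      have "- D * (h (Suc n) m - h n m) = (\<integral>\<omega>. - D * (hit (Suc n) \<omega> (m, {||}) - hit n \<omega> (m, {||})) \<partial>?P)"
        by (simp add: h_def)
      also have "\<dots> \<le> (\<integral>\<omega>. lap \<omega> m \<partial>?P)"
        using m by (intro integral_mono lap_ne_bounds(2)) auto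
      also have "\<dots> \<le> \<phi> m * (\<integral>\<omega>. lap \<omega> m \<partial>?P)"
      proof -
        have "(\<integral>\<omega>. lap \<omega> m \<partial>?P) \<le> (\<integral>\<omega>. 0 \<partial>?P)"
          using m by (intro integral_mono lap_ne_bounds(1)) auto
        then show ?thesis using mult_right_mono_neg[OF \<phi>(3)[of m], of "\<integral>\<omega>. lap \<omega> m \<partial>?P"] by simp
      qed
      finally show ?thesis using True by simp
    next
      case False
      then show ?thesis using \<phi>(4)[of m] by simp
    qed
  qed
  also have "\<dots> = (\<Sum>m\<in>B. \<phi> m * (\<integral>\<omega>. lap \<omega> m \<partial>?P))"
    using finB \<open>0 \<in> B\<close> by (simp add: sum.remove[of B 0] E_lap_0)
  also note upper
  finally show ?thesis unfolding q_def[symmetric] D_def[symmetric] by (simp add: field_simps)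
qed

lemma no_return_tendsto_0:
  assumes "CARD('d::finite) \<in> {1, 2}"
  shows "(\<lambda>l. measure (biased_walk_law p) {X :: nat \<Rightarrow> 'd lamp_vertex. no_return l X}) \<longlonglongrightarrow> 0"
proof (rule LIMSEQ_imp_Suc, rule LIMSEQ_I)
  let ?P = "percolation (lamplighter :: 'd lamp_vertex \<Rightarrow> _) p"
  interpret P: prob_space ?P by (rule prob_space_percolation)
  define h where "h n m = (\<integral>\<omega>. hit n \<omega> (m, {||}) \<partial>?P)" for n m
  have int_hit [simp]: "integrable ?P (\<lambda>\<omega>. hit k \<omega> x)" for k x
    by (rule P.integrable_const_bound[where B=1]) (auto simp: hit_nonneg hit_le_1)
  have "convergent (\<lambda>n. h n m)" for m
  proof (rule Bseq_mono_convergent)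
    have "\<bar>h n m\<bar> \<le> 1" for n
    proof -
      have "h n m \<le> (\<integral>\<omega>. 1 \<partial>?P)" unfolding h_def by (intro integral_mono) (auto simp: hit_le_1)
      moreover have "0 \<le> h n m" unfolding h_def by (intro integral_nonneg_AE) (auto simp: hit_nonneg)
      ultimately show ?thesis by (simp add: P.prob_space)
    qed
    then show "Bseq (\<lambda>n. h n m)" by (intro BseqI'[of _ 1]) simp
    show "\<forall>i n. i \<le> n \<longrightarrow> h i m \<le> h n m"
      unfolding h_def by (auto intro!: integral_mono hit_mono)
  qed
  moreover define H where "H m = lim (\<lambda>n. h n m)" for m
  ultimately have H: "(\<lambda>n. h n m) \<longlonglongrightarrow> H m" for m by (simp add: convergent_LIMSEQ_iff)
  fix e :: real assume "e > 0"
  obtain \<phi> :: "int ^ 'd \<Rightarrow> real" and K where \<phi>: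
    "\<phi> 0 = 1" "\<And>m. 0 \<le> \<phi> m" "\<And>m. \<phi> m \<le> 1" "\<And>m. l1 m \<ge> K \<Longrightarrow> \<phi> m = 0"
    "\<And>B. finite B \<Longrightarrow> (\<Sum>m\<in>B. \<Sum>m' | Zd_adj m m'. (\<phi> m - \<phi> m')\<^sup>2) \<le> e"
    by (rule zero_capacity[OF assms \<open>e > 0\<close>]) (rule that)
  let ?err = "\<lambda>n. 2 * real (2 * CARD('d) + 1) * (\<Sum>m | l1 m \<le> K. h (Suc n) m - h n m)"
  have "?err \<longlonglongrightarrow> 2 * real (2 * CARD('d) + 1) * (\<Sum>m | l1 m \<le> K. H m - H m)"
    by (intro tendsto_intros LIMSEQ_Suc H)
  then have "\<forall>\<^sub>F n in sequentially. ?err n < e / 2"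
    using \<open>e > 0\<close> by (intro order_tendstoD(2)[of ?err 0]) auto
  then obtain N where N: "?err n < e / 2" if "n \<ge> N" for n by (auto simp: eventually_sequentially)
  have "measure (biased_walk_law p) {X :: nat \<Rightarrow> 'd lamp_vertex. no_return (Suc n) X} < e" if "n \<ge> N" for n
  proof -
    have "measure (biased_walk_law p) {X :: nat \<Rightarrow> 'd lamp_vertex. no_return (Suc n) X} \<le> e / 2 + ?err n"
      unfolding h_def by (rule no_return_le[OF \<phi>])
    then show ?thesis using N[OF that] by linarith
  qed
  then show "\<exists>N. \<forall>n\<ge>N. norm (measure (biased_walk_law p) {X :: nat \<Rightarrow> 'd lamp_vertex. no_return (Suc n) X} - 0) < e"
    by auto
qed


section \<open>Gaussian decay of the quenched transition probabilities\<close>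

text \<open>The law of the position at time \<open>n\<close>.\<close>

fun walk_pmf :: "('v \<Rightarrow> 'v \<Rightarrow> bool) \<Rightarrow> ('v set \<Rightarrow> bool) \<Rightarrow> nat \<Rightarrow> 'v \<Rightarrow> 'v pmf" where
  "walk_pmf G \<omega> 0 x = return_pmf x"
| "walk_pmf G \<omega> (Suc n) x = bind_pmf (walk_step G \<omega> x) (walk_pmf G \<omega> n)"

lemma walk_position_set:
  "{X :: nat \<Rightarrow> 'v::countable. X n = y} \<in> sets path_space"
  by (rule pred_path_sets, rule measurable_compose[OF measurable_component_singleton]) auto

lemma measure_walk_position:
  fixes G :: "'v::countable \<Rightarrow> 'v \<Rightarrow> bool"
  shows "measure (walk_law G \<omega> x) {X. X n = y} = pmf (walk_pmf G \<omega> n x) y"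
proof (induction n arbitrary: x)
  case 0
  have "{X. case_nat x X \<in> {X :: nat \<Rightarrow> 'v. X 0 = y}} = (if x = y then UNIV else {})" by auto
  moreover have "emeasure (walk_law G \<omega> z) UNIV = 1" for z
    using prob_space.emeasure_space_1[OF prob_space_walk_law, of G \<omega> z] by simp
  ultimately have "emeasure (walk_law G \<omega> x) {X. X 0 = y} = ennreal (pmf (walk_pmf G \<omega> 0 x) y)"
    by (subst emeasure_walk_law_first_step[OF walk_position_set])
       (simp add: measure_pmf.emeasure_space_1)
  then show ?case by (simp add: emeasure_walk_law)
next
  case (Suc n)
  have "emeasure (walk_law G \<omega> x) {X. X (Suc n) = y} =
      (\<integral>\<^sup>+z. emeasure (walk_law G \<omega> z) {X. X n = y} \<partial>walk_step G \<omega> x)"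
    by (subst emeasure_walk_law_first_step[OF walk_position_set]) simp
  also have "\<dots> = ennreal (pmf (walk_pmf G \<omega> (Suc n) x) y)"
    by (simp add: emeasure_walk_law Suc ennreal_pmf_bind)
  finally show ?case by (simp add: emeasure_walk_law)
qed

lemma walk_pmf_Suc_right: "walk_pmf G \<omega> (Suc n) x = bind_pmf (walk_pmf G \<omega> n x) (walk_step G \<omega>)"
proof (induction n arbitrary: x)
  case 0
  have "bind_pmf (walk_step G \<omega> x) (walk_pmf G \<omega> 0) = walk_step G \<omega> x"
  proof -
    have "walk_pmf G \<omega> 0 = return_pmf" by (rule ext) simp
    then show ?thesis by (simp add: bind_return_pmf')
  qed
  then show ?case by (simp add: bind_return_pmf)
next
  case (Suc n)
  have "walk_pmf G \<omega> (Suc (Suc n)) x = bind_pmf (walk_step G \<omega> x) (walk_pmf G \<omega> (Suc n))"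
    by (simp only: walk_pmf.simps)
  also have "\<dots> = bind_pmf (walk_step G \<omega> x) (\<lambda>z. bind_pmf (walk_pmf G \<omega> n z) (walk_step G \<omega>))"
    using Suc by (intro bind_pmf_cong) auto
  also have "\<dots> = bind_pmf (walk_pmf G \<omega> (Suc n) x) (walk_step G \<omega>)"
    by (simp add: bind_assoc_pmf)
  finally show ?case .
qed

lemma cluster_dist_self: "cluster_dist G \<omega> x x = 0"
  unfolding cluster_dist_def by (rule Least_equality) auto

lemma cluster_dist_step:
  assumes "y \<in> cluster G \<omega> x" "open_adj G \<omega> y z"
  shows "cluster_dist G \<omega> x z \<le> Suc (cluster_dist G \<omega> x y)"
proof -
  have "\<exists>n. (open_adj G \<omega> ^^ n) x y"
    using assms(1) by (auto simp: cluster_def rtranclp_power)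
  then have "(open_adj G \<omega> ^^ cluster_dist G \<omega> x y) x y"
    unfolding cluster_dist_def by (rule LeastI_ex)
  then have "(open_adj G \<omega> ^^ Suc (cluster_dist G \<omega> x y)) x z"
    using assms(2) by auto
  then show ?thesis unfolding cluster_dist_def[of _ _ _ z] by (rule Least_le)
qed

text \<open>A fixed configuration and a starting vertex \<open>r\<close> that has an open edge.\<close>

locale quenched_walk =
  fixes G :: "'v::countable \<Rightarrow> 'v \<Rightarrow> bool" and \<omega> :: "'v set \<Rightarrow> bool" and r :: 'v
  assumes sym: "\<And>x y. G x y \<Longrightarrow> G y x"
    and finite_nbrs: "\<And>x. finite {y. G x y}"
    and not_isolated: "open_nbrs G \<omega> r \<noteq> {}"
begin

lemma finite_open: "finite (open_nbrs G \<omega> x)"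
  using finite_open_nbrs[of G x \<omega>, OF finite_nbrs] .

lemma osym: "open_adj G \<omega> x y \<longleftrightarrow> open_adj G \<omega> y x"
  by (rule open_adj_sym[OF sym])

lemma
  shows finite_set_walk_pmf: "finite (set_pmf (walk_pmf G \<omega> n r))"
    and set_walk_pmfD: "x \<in> set_pmf (walk_pmf G \<omega> n r) \<Longrightarrow> x \<in> cluster G \<omega> r \<and> deg G \<omega> x \<ge> 1"
proof -
  have "finite (set_pmf (walk_pmf G \<omega> n r)) \<and>
    (\<forall>x\<in>set_pmf (walk_pmf G \<omega> n r). x \<in> cluster G \<omega> r \<and> deg G \<omega> x \<ge> 1)"
  proof (induction n)
    case 0
    have "deg G \<omega> r \<ge> 1" using not_isolated finite_open[of r] by (simp add: Suc_le_eq card_gt_0_iff)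
    then show ?case by (simp add: cluster_def)
  next
    case (Suc n)
    have fin: "finite (set_pmf (walk_step G \<omega> y))" for y
      using finite_open[of y] by (simp add: walk_step_def)
    have "x \<in> cluster G \<omega> r \<and> deg G \<omega> x \<ge> 1" if x: "x \<in> set_pmf (walk_pmf G \<omega> (Suc n) r)" for x
    proof -
      obtain y where y: "y \<in> set_pmf (walk_pmf G \<omega> n r)" "x \<in> set_pmf (walk_step G \<omega> y)"
        using x unfolding walk_pmf_Suc_right by auto
      have yc: "y \<in> cluster G \<omega> r" "deg G \<omega> y \<ge> 1" using Suc.IH y(1) by auto
      then have "open_nbrs G \<omega> y \<noteq> {}" by auto
      then have "set_pmf (walk_step G \<omega> y) = open_nbrs G \<omega> y"
        using finite_open[of y] by (simp add: walk_step_def)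
      then have yx: "open_adj G \<omega> y x" using y(2) by (simp add: open_nbrs_def)
      then have "x \<in> cluster G \<omega> r" using yc(1) by (auto simp: cluster_def)
      moreover have "y \<in> open_nbrs G \<omega> x" using yx osym by (simp add: open_nbrs_def)
      then have "deg G \<omega> x \<ge> 1" using finite_open[of x] by (auto simp: Suc_le_eq card_gt_0_iff)
      ultimately show ?thesis by simp
    qed
    moreover have "finite (set_pmf (walk_pmf G \<omega> (Suc n) r))"
      unfolding walk_pmf_Suc_right using Suc.IH fin by simp
    ultimately show ?case by blast
  qed
  then show "finite (set_pmf (walk_pmf G \<omega> n r))"
    "x \<in> set_pmf (walk_pmf G \<omega> n r) \<Longrightarrow> x \<in> cluster G \<omega> r \<and> deg G \<omega> x \<ge> 1" by blast+
qed

text \<open>The transition probabilities from \<open>r\<close>, normalised by the degree of the endpoint. No vertex of degree 0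
  is ever reached, so the convention \<open>0 / 0 = 0\<close> is harmless. By reversibility \<open>\<rho>\<close> evolves by the
  symmetric matrix of open edges.\<close>

definition \<rho> :: "nat \<Rightarrow> 'v \<Rightarrow> real" where
  "\<rho> n y = pmf (walk_pmf G \<omega> n r) y / real (deg G \<omega> y)"

lemma \<rho>_nonneg: "0 \<le> \<rho> n y" by (simp add: \<rho>_def)

lemma deg_\<rho>: "real (deg G \<omega> y) * \<rho> n y = pmf (walk_pmf G \<omega> n r) y"
  using set_walk_pmfD[of y n] by (cases "deg G \<omega> y = 0") (auto simp: \<rho>_def set_pmf_eq)

lemma deg_\<rho>_Suc:
  assumes "finite V" "set_pmf (walk_pmf G \<omega> n r) \<subseteq> V"
  shows "real (deg G \<omega> y) * \<rho> (Suc n) y = (\<Sum>x\<in>V. of_bool (open_adj G \<omega> x y) * \<rho> n x)"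
proof -
  have "pmf (walk_pmf G \<omega> (Suc n) r) y = (\<Sum>x\<in>V. pmf (walk_step G \<omega> x) y * pmf (walk_pmf G \<omega> n r) x)"
    unfolding walk_pmf_Suc_right pmf_bind using assms by (subst integral_measure_pmf[of V]) (auto simp: mult.commute)
  also have "\<dots> = (\<Sum>x\<in>V. of_bool (open_adj G \<omega> x y) * \<rho> n x)"
  proof (rule sum.cong[OF refl])
    fix x assume "x \<in> V"
    show "pmf (walk_step G \<omega> x) y * pmf (walk_pmf G \<omega> n r) x = of_bool (open_adj G \<omega> x y) * \<rho> n x"
    proof (cases "x \<in> set_pmf (walk_pmf G \<omega> n r)")
      case True
      then have "open_nbrs G \<omega> x \<noteq> {}" using set_walk_pmfD[OF True] by auto
      then have "pmf (walk_step G \<omega> x) y = of_bool (open_adj G \<omega> x y) / real (deg G \<omega> x)"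
        using finite_open[of x] by (simp add: walk_step_def indicator_def) (simp add: open_nbrs_def)
      then show ?thesis by (simp add: \<rho>_def)
    next
      case False
      then show ?thesis by (simp add: \<rho>_def set_pmf_eq)
    qed
  qed
  finally show ?thesis by (simp add: deg_\<rho>)
qed

text \<open>Davies' method for the truncated Green function \<open>g = (\<Sum>j\<le>n. z ^ j * \<rho> j)\<close>, with the weight
  \<open>a x = E ^ cluster_dist G \<omega> r x\<close>. The Green equation and symmetrisation over the two orientations of each
  edge bound \<open>Q = (\<Sum>x. deg x * (a x * g x)\<^sup>2)\<close> by \<open>g r + z * k * Q\<close>, because along an edge the weight changes
  by a factor \<open>1\<close>, \<open>E\<close> or \<open>1 / E\<close>. Writing \<open>E = exp s\<close>, the constant \<open>k\<close> is \<open>cosh s\<close>, which exceeds 1 only by an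
  amount of the order of \<open>s\<^sup>2\<close>; this gives Gaussian decay.\<close>

lemma weighted_green_bound:
  fixes z E :: real
  assumes z: "0 < z" "z < 1" and E: "1 \<le> E"
  defines "k \<equiv> (E + 1 / E) / 2"
  assumes zk: "z * k < 1"
  shows "(z ^ n * \<rho> n y * E ^ cluster_dist G \<omega> r y)\<^sup>2 \<le> 1 / ((1 - z) * (1 - z * k))"
proof (cases "y \<in> set_pmf (walk_pmf G \<omega> n r)")
  case False
  then have "\<rho> n y = 0" by (simp add: \<rho>_def set_pmf_eq)
  then show ?thesis using z zk by simp
next
  case y: True
  define V where "V = (\<Union>j\<le>n. set_pmf (walk_pmf G \<omega> j r))"
  have finV: "finite V" unfolding V_def using finite_set_walk_pmf by auto
  have V: "x \<in> cluster G \<omega> r" "deg G \<omega> x \<ge> 1" if "x \<in> V" for x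
    using that set_walk_pmfD unfolding V_def by blast+
  have "r \<in> V" unfolding V_def by (auto intro!: bexI[of _ 0])
  have "y \<in> V" using y unfolding V_def by blast
  define c where "c x y = (of_bool (open_adj G \<omega> x y) :: real)" for x y
  have c: "0 \<le> c x y" "c x y = c y x" for x y using osym[of x y] by (auto simp: c_def)
  define g where "g x = (\<Sum>j\<le>n. z ^ j * \<rho> j x)" for x
  define a where "a x = E ^ cluster_dist G \<omega> r x" for x
  define h where "h x = a x * g x" for x
  have g0: "0 \<le> g x" for x unfolding g_def using z \<rho>_nonneg by (intro sum_nonneg) auto
  have a0: "0 < a x" for x unfolding a_def using E by simp
  have h0: "0 \<le> h x" for x unfolding h_def using a0[of x] g0[of x] by simp
  have k1: "1 \<le> k"
  proof -
    have "0 \<le> (E - 1)\<^sup>2 / E" using E by simp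
    also have "\<dots> = 2 * k - 2" using E by (simp add: k_def field_simps power2_eq_square)
    finally show ?thesis by simp
  qed
  have adj: "((a x)\<^sup>2 + (a x')\<^sup>2) / 2 \<le> k * (a x * a x')" if "x \<in> V" "x' \<in> V" "open_adj G \<omega> x x'" for x x'
  proof -
    have "cluster_dist G \<omega> r x' \<le> Suc (cluster_dist G \<omega> r x)" "cluster_dist G \<omega> r x \<le> Suc (cluster_dist G \<omega> r x')"
      using cluster_dist_step[OF V(1)] that osym by blast+
    then consider "cluster_dist G \<omega> r x' = cluster_dist G \<omega> r x" |
        "cluster_dist G \<omega> r x' = Suc (cluster_dist G \<omega> r x)" | "cluster_dist G \<omega> r x = Suc (cluster_dist G \<omega> r x')"
      by linarith
    then show ?thesis
    proof cases
      case 1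
      then have "a x' = a x" by (simp add: a_def)
      then show ?thesis using mult_right_mono[OF k1, of "a x * a x"] by (simp add: power2_eq_square)
    next
      case 2
      then have "a x' = E * a x" by (simp add: a_def)
      then show ?thesis using E by (simp add: k_def power2_eq_square field_simps)
    next
      case 3
      then have "a x = E * a x'" by (simp add: a_def)
      then show ?thesis using E by (simp add: k_def power2_eq_square field_simps)
    qed
  qed
  have green: "real (deg G \<omega> x) * g x \<le> of_bool (x = r) + z * (\<Sum>x'\<in>V. c x' x * g x')" if "x \<in> V" for x
  proof -
    have "real (deg G \<omega> x) * g x = (\<Sum>j<Suc n. z ^ j * (real (deg G \<omega> x) * \<rho> j x))"
      by (simp add: g_def sum_distrib_left lessThan_Suc_atMost algebra_simps del: sum.lessThan_Suc)
    also have "\<dots> = real (deg G \<omega> x) * \<rho> 0 x + (\<Sum>j<n. z ^ Suc j * (real (deg G \<omega> x) * \<rho> (Suc j) x))"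
      unfolding sum.lessThan_Suc_shift by simp
    also have "real (deg G \<omega> x) * \<rho> 0 x = of_bool (x = r)"
      unfolding deg_\<rho> by (simp add: indicator_def)
    also have "(\<Sum>j<n. z ^ Suc j * (real (deg G \<omega> x) * \<rho> (Suc j) x)) = (\<Sum>j<n. z ^ Suc j * (\<Sum>x'\<in>V. c x' x * \<rho> j x'))"
    proof (rule sum.cong[OF refl])
      fix j assume "j \<in> {..<n}"
      then have "j \<in> {..n}" by simp
      then have "set_pmf (walk_pmf G \<omega> j r) \<subseteq> V" unfolding V_def by blast
      from deg_\<rho>_Suc[OF finV this, of x]
      show "z ^ Suc j * (real (deg G \<omega> x) * \<rho> (Suc j) x) = z ^ Suc j * (\<Sum>x'\<in>V. c x' x * \<rho> j x')"
        by (simp only: c_def)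
    qed
    also have "\<dots> = z * (\<Sum>x'\<in>V. c x' x * (\<Sum>j<n. z ^ j * \<rho> j x'))"
      unfolding sum_distrib_left by (subst sum.swap) (simp add: mult_ac)
    also have "\<dots> \<le> z * (\<Sum>x'\<in>V. c x' x * g x')"
      unfolding g_def using z c(1) \<rho>_nonneg
      by (intro mult_left_mono sum_mono sum_mono2) auto
    finally show ?thesis by simp
  qed
  define Q where "Q = (\<Sum>x\<in>V. real (deg G \<omega> x) * (h x)\<^sup>2)"
  have Q0: "0 \<le> Q" unfolding Q_def by (intro sum_nonneg) auto
  have deg: "(\<Sum>x'\<in>V. c x' x) \<le> real (deg G \<omega> x)" for x
  proof -
    have "(\<Sum>x'\<in>V. c x' x) = real (card (V \<inter> {x'. open_adj G \<omega> x' x}))" using finV by (simp add: c_def)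
    also have "\<dots> \<le> real (deg G \<omega> x)"
      using osym by (intro of_nat_mono card_mono finite_open) (auto simp: open_nbrs_def)
    finally show ?thesis .
  qed
  have "Q = (\<Sum>x\<in>V. (a x)\<^sup>2 * g x * (real (deg G \<omega> x) * g x))"
    by (simp add: Q_def h_def power2_eq_square algebra_simps)
  also have "\<dots> \<le> (\<Sum>x\<in>V. (a x)\<^sup>2 * g x * (of_bool (x = r) + z * (\<Sum>x'\<in>V. c x' x * g x')))"
    using green g0 by (intro sum_mono mult_left_mono) auto
  also have "\<dots> = (\<Sum>x\<in>V. if x = r then (a x)\<^sup>2 * g x else 0) + z * (\<Sum>x\<in>V. \<Sum>x'\<in>V. c x' x * ((a x)\<^sup>2 * (g x * g x')))"
  proof -
    have "(a x)\<^sup>2 * g x * (of_bool (x = r) + z * (\<Sum>x'\<in>V. c x' x * g x')) =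
        (if x = r then (a x)\<^sup>2 * g x else 0) + z * (\<Sum>x'\<in>V. c x' x * ((a x)\<^sup>2 * (g x * g x')))" for x
      by (simp only: distrib_left sum_distrib_left) (simp add: mult_ac)
    then show ?thesis by (simp add: sum.distrib sum_distrib_left)
  qed
  also have "(\<Sum>x\<in>V. if x = r then (a x)\<^sup>2 * g x else 0) = g r"
    using finV \<open>r \<in> V\<close> by (simp add: a_def cluster_dist_self)
  also have "(\<Sum>x\<in>V. \<Sum>x'\<in>V. c x' x * ((a x)\<^sup>2 * (g x * g x'))) \<le> k * Q"
  proof -
    let ?S = "\<Sum>x\<in>V. \<Sum>x'\<in>V. c x' x * ((a x)\<^sup>2 * (g x * g x'))"
    have "?S = (\<Sum>x\<in>V. \<Sum>x'\<in>V. c x' x * ((a x')\<^sup>2 * (g x * g x')))"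
      by (subst sum.swap, intro sum.cong refl) (metis c(2) mult.commute)
    then have "2 * ?S = (\<Sum>x\<in>V. \<Sum>x'\<in>V. c x' x * ((a x)\<^sup>2 * (g x * g x')) + c x' x * ((a x')\<^sup>2 * (g x * g x')))"
      by (simp add: sum.distrib)
    also have "\<dots> \<le> (\<Sum>x\<in>V. \<Sum>x'\<in>V. k * (c x' x * (h x)\<^sup>2) + k * (c x' x * (h x')\<^sup>2))"
    proof (intro sum_mono)
      fix x x' assume x: "x \<in> V" "x' \<in> V"
      show "c x' x * ((a x)\<^sup>2 * (g x * g x')) + c x' x * ((a x')\<^sup>2 * (g x * g x')) \<le> k * (c x' x * (h x)\<^sup>2) + k * (c x' x * (h x')\<^sup>2)"
      proof (cases "open_adj G \<omega> x' x")
        case True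
        have "((a x)\<^sup>2 + (a x')\<^sup>2) * (g x * g x') \<le> 2 * (k * (a x * a x')) * (g x * g x')"
          using adj[of x x'] x True osym g0[of x] g0[of x'] by (intro mult_right_mono) auto
        also have "\<dots> = k * (2 * h x * h x')" by (simp add: h_def algebra_simps)
        also have "\<dots> \<le> k * ((h x)\<^sup>2 + (h x')\<^sup>2)"
          using k1 sum_squares_bound[of "h x" "h x'"] by (intro mult_left_mono) auto
        finally show ?thesis using True by (simp add: c_def algebra_simps)
      qed (simp add: c_def)
    qed
    also have "\<dots> = 2 * (k * (\<Sum>x\<in>V. (\<Sum>x'\<in>V. c x' x) * (h x)\<^sup>2))"
    proof -
      have "(\<Sum>x\<in>V. \<Sum>x'\<in>V. k * (c x' x * (h x')\<^sup>2)) = (\<Sum>x\<in>V. \<Sum>x'\<in>V. k * (c x' x * (h x)\<^sup>2))"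
        by (subst sum.swap, intro sum.cong refl) (metis c(2))
      then show ?thesis by (simp add: sum.distrib sum_distrib_left sum_distrib_right)
    qed
    also have "\<dots> \<le> 2 * (k * Q)"
      unfolding Q_def using k1 deg by (intro mult_left_mono sum_mono mult_right_mono) auto
    finally show ?thesis by simp
  qed
  finally have "Q \<le> g r + z * (k * Q)" using z by simp
  then have "(1 - z * k) * Q \<le> g r" by (simp add: algebra_simps)
  also have "g r \<le> (\<Sum>j\<le>n. z ^ j)"
  proof -
    have "\<rho> j r \<le> 1" for j
    proof -
      have "\<rho> j r * 1 \<le> \<rho> j r * real (deg G \<omega> r)"
        using V(2)[OF \<open>r \<in> V\<close>] \<rho>_nonneg by (intro mult_left_mono) auto
      also have "\<dots> \<le> 1" using deg_\<rho>[of r j] pmf_le_1[of "walk_pmf G \<omega> j r" r] by (simp add: mult.commute)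
      finally show ?thesis by simp
    qed
    then show ?thesis unfolding g_def using z by (intro sum_mono) (simp add: mult_left_le)
  qed
  also have "\<dots> \<le> 1 / (1 - z)"
    using z sum_le_suminf[of "\<lambda>j. z ^ j" "{..n}"] by (simp add: suminf_geometric summable_geometric)
  finally have "(1 - z * k) * Q * (1 - z) \<le> 1"
    using z by (subst (asm) pos_le_divide_eq) auto
  moreover have "0 < (1 - z) * (1 - z * k)" using z zk by simp
  ultimately have Q: "Q \<le> 1 / ((1 - z) * (1 - z * k))"
    by (subst pos_le_divide_eq) (simp_all only: mult_ac)
  have "z ^ n * \<rho> n y \<le> g y" unfolding g_def using z \<rho>_nonneg by (intro member_le_sum) auto
  then have "(z ^ n * \<rho> n y * a y)\<^sup>2 \<le> (h y)\<^sup>2"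
    unfolding h_def using a0[of y] z \<rho>_nonneg[of n y]
    by (intro power_mono) (auto simp: mult.commute[of "a y"] intro!: mult_right_mono)
  also have "\<dots> \<le> real (deg G \<omega> y) * (h y)\<^sup>2"
    using V(2)[OF \<open>y \<in> V\<close>] mult_right_mono[of 1 "real (deg G \<omega> y)" "(h y)\<^sup>2"] by simp
  also have "\<dots> \<le> Q"
    unfolding Q_def using finV \<open>y \<in> V\<close> by (intro member_le_sum) auto
  finally show ?thesis using Q by (simp add: a_def)
qed

text \<open>A weak form of the Varopoulos--Carne bound, with a constant that does not depend on the time.\<close>

lemma transition_probability_bound:
  fixes e D :: real
  assumes e: "0 < e" "e \<le> 1" and D: "\<And>x. real (deg G \<omega> x) \<le> D"
  shows "\<exists>C\<ge>0. \<forall>n y. e * real n \<le> real (cluster_dist G \<omega> r y) \<longrightarrow>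
    measure (walk_law G \<omega> r) {X. X n = y} \<le> C * exp (- (e\<^sup>2 / 8) * real n)"
proof -
  \<comment> \<open>With \<open>z = exp (- 2 s\<^sup>2)\<close> the bound decays like \<open>exp (2 s\<^sup>2 n - s e n)\<close>, which is smallest for this \<open>s\<close>.\<close>
  define s where "s = e / 4"
  have s: "0 < s" "s \<le> 1" using e by (auto simp: s_def)
  define z where "z = exp (- (2 * s\<^sup>2))"
  have z: "0 < z" "z < 1" using s by (auto simp: z_def)
  define E where "E = exp s"
  have E: "1 \<le> E" using s by (simp add: E_def)
  let ?k = "(E + 1 / E) / 2"
  have "exp s \<le> 1 + s + s\<^sup>2" using s by (intro exp_bound) auto
  moreover have "1 / E \<le> 1 - s + s\<^sup>2"
  proof -
    have "1 / E \<le> 1 / (1 + s)" using exp_ge_add_one_self[of s] s by (simp add: E_def frac_le)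
    also have "\<dots> \<le> 1 - s + s\<^sup>2"
    proof -
      have "1 \<le> (1 - s + s\<^sup>2) * (1 + s)" using s by (simp add: algebra_simps power2_eq_square)
      then show ?thesis using s by (simp add: pos_divide_le_eq)
    qed
    finally show ?thesis .
  qed
  ultimately have "?k \<le> 1 + s\<^sup>2" by (simp add: E_def)
  also have "\<dots> \<le> exp (s\<^sup>2)" by (rule exp_ge_add_one_self)
  finally have "z * ?k \<le> z * exp (s\<^sup>2)" using z by (intro mult_left_mono) auto
  also have "\<dots> = exp (- (s\<^sup>2))" by (simp add: z_def exp_add[symmetric])
  also have "\<dots> < 1" using s by simp
  finally have zk: "z * ?k < 1" .
  define C0 where "C0 = 1 / ((1 - z) * (1 - z * ?k))"
  have D0: "0 \<le> D" using D[of r] of_nat_0_le_iff order_trans by blast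
  have C0: "0 \<le> C0" using z zk by (simp add: C0_def)
  have "measure (walk_law G \<omega> r) {X. X n = y} \<le> (D * sqrt C0) * exp (- (e\<^sup>2 / 8) * real n)"
    if far: "e * real n \<le> real (cluster_dist G \<omega> r y)" for n y
  proof -
    define t where "t = exp (- (2 * s\<^sup>2) * real n) * exp (s * (e * real n))"
    have t: "t = exp ((e\<^sup>2 / 8) * real n)"
      unfolding t_def exp_add[symmetric] by (simp add: s_def power2_eq_square algebra_simps)
    have "t \<le> z ^ n * E ^ cluster_dist G \<omega> r y"
    proof -
      have "exp (s * (e * real n)) \<le> exp (s * real (cluster_dist G \<omega> r y))" using far s by simp
      also have "\<dots> = E ^ cluster_dist G \<omega> r y" by (simp add: E_def exp_of_nat_mult[symmetric] mult.commute)
      finally have "exp (s * (e * real n)) \<le> E ^ cluster_dist G \<omega> r y" .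
      moreover have "exp (- (2 * s\<^sup>2) * real n) = z ^ n"
        by (simp add: z_def exp_of_nat_mult[symmetric] mult.commute)
      ultimately show ?thesis unfolding t_def using z by (simp add: mult_left_mono)
    qed
    then have "\<rho> n y * t \<le> \<rho> n y * (z ^ n * E ^ cluster_dist G \<omega> r y)"
      using \<rho>_nonneg by (intro mult_left_mono)
    also have "\<dots> = z ^ n * \<rho> n y * E ^ cluster_dist G \<omega> r y" by simp
    also have "\<dots> \<le> sqrt C0"
      using weighted_green_bound[OF z E zk, of n y] unfolding C0_def by (rule real_le_rsqrt)
    finally have "\<rho> n y \<le> sqrt C0 * exp (- (e\<^sup>2 / 8) * real n)"
      unfolding t by (simp add: exp_minus field_simps)
    then have "real (deg G \<omega> y) * \<rho> n y \<le> D * (sqrt C0 * exp (- (e\<^sup>2 / 8) * real n))"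
      using D D0 \<rho>_nonneg by (intro mult_mono) auto
    then show ?thesis unfolding measure_walk_position deg_\<rho> by (simp add: mult.assoc)
  qed
  moreover have "0 \<le> D * sqrt C0" using D0 C0 by simp
  ultimately show ?thesis by blast
qed

end


section \<open>Few vertices are reachable with a small range\<close>

text \<open>The image of a walk is traversed by a walk with any prescribed number of entries from twice its
  cardinality minus one on: a new point is inserted as an excursion from a visited neighbour.\<close>

lemma covering_walk:
  fixes m :: "nat \<Rightarrow> 'a"
  assumes refl: "\<And>a. R a a" and sym: "\<And>a b. R a b \<Longrightarrow> R b a"
    and walk: "\<And>i. i < n \<Longrightarrow> R (m i) (m (Suc i))"
    and "2 * card (m ` {..n}) \<le> Suc L"
  shows "\<exists>w. length w = L \<and> w \<noteq> [] \<and> hd w = m 0 \<and> successively R w \<and> set w = m ` {..n}"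
  using walk assms(4)
proof (induction n arbitrary: L)
  case 0
  have "successively R (replicate k (m 0))" for k
  proof (induction k)
    case (Suc k)
    then show ?case by (cases k) (auto simp: successively_Cons refl)
  qed simp
  then show ?case using "0.prems" by (intro exI[of _ "replicate L (m 0)"]) auto
next
  case (Suc n)
  show ?case
  proof (cases "m (Suc n) \<in> m ` {..n}")
    case True
    then have "m ` {..Suc n} = m ` {..n}" by (auto simp: atMost_Suc)
    then show ?thesis using Suc by simp
  next
    case False
    then have card: "card (m ` {..Suc n}) = Suc (card (m ` {..n}))" by (simp add: atMost_Suc)
    moreover have "0 < card (m ` {..n})" by (simp add: card_gt_0_iff)
    ultimately have L: "2 * card (m ` {..n}) \<le> Suc (L - 2)" "2 \<le> L" using Suc.prems(2) by auto
    obtain w where w: "length w = L - 2" "w \<noteq> []" "hd w = m 0" "successively R w" "set w = m ` {..n}"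
      using Suc.IH[OF _ L(1)] Suc.prems(1) by auto
    obtain a b where ab: "w = a @ m n # b" using w(5) by (metis atMost_iff image_eqI le_refl split_list)
    let ?w = "a @ m n # m (Suc n) # m n # b"
    have R: "R (m n) (m (Suc n))" "R (m (Suc n)) (m n)" using Suc.prems(1) sym by auto
    have "successively R ?w"
      using w(4) R unfolding ab by (auto simp: successively_append_iff successively_Cons)
    moreover have "hd ?w = m 0" using w(3) ab by (cases a) auto
    moreover have "set ?w = m ` {..Suc n}" using w(5) unfolding ab by (auto simp: atMost_Suc)
    moreover have "length ?w = L" using w(1) L(2) unfolding ab by auto
    ultimately show ?thesis by (intro exI[of _ ?w]) auto
  qed
qed

lemma card_walks_le:
  assumes fin: "\<And>a. finite {b. R a b}" and card: "\<And>a. card {b. R a b} \<le> D"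
  shows "finite {w. length w = Suc k \<and> hd w = a \<and> successively R w} \<and>
    card {w. length w = Suc k \<and> hd w = a \<and> successively R w} \<le> D ^ k"
proof (induction k arbitrary: a)
  case 0
  have "{w. length w = Suc 0 \<and> hd w = a \<and> successively R w} = {[a]}"
    by (auto simp: length_Suc_conv)
  then show ?case by simp
next
  case (Suc k)
  let ?W = "\<lambda>k a. {w. length w = Suc k \<and> hd w = a \<and> successively R w}"
  have sub: "?W (Suc k) a \<subseteq> (\<Union>b\<in>{b. R a b}. (#) a ` ?W k b)"
  proof
    fix w assume w: "w \<in> ?W (Suc k) a"
    then obtain v where v: "w = a # v" "length v = Suc k" by (auto simp: length_Suc_conv)
    then have "v \<noteq> []" by auto
    then have "R a (hd v)" "successively R v" using w v by (auto simp: successively_Cons)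
    then show "w \<in> (\<Union>b\<in>{b. R a b}. (#) a ` ?W k b)" using v by auto
  qed
  have finU: "finite (\<Union>b\<in>{b. R a b}. (#) a ` ?W k b)" using fin Suc by auto
  have "card (?W (Suc k) a) \<le> card (\<Union>b\<in>{b. R a b}. (#) a ` ?W k b)" by (rule card_mono[OF finU sub])
  also have "\<dots> \<le> (\<Sum>b\<in>{b. R a b}. card ((#) a ` ?W k b))" by (rule card_UN_le[OF fin])
  also have "\<dots> \<le> (\<Sum>b\<in>{b. R a b}. D ^ k)"
    by (intro sum_mono order_trans[OF card_image_le]) (use Suc in auto)
  also have "\<dots> \<le> D ^ Suc k" using card[of a] by simp
  finally show ?case using finite_subset[OF sub finU] by blast
qed

text \<open>Paths from the origin that at each step stay put or move to a neighbour in the lamplighter graph.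
  Staying put is allowed because the walk rests at isolated vertices of the open subgraph.\<close>

definition lamp_path :: "(nat \<Rightarrow> ('d::finite) lamp_vertex) \<Rightarrow> bool" where
  "lamp_path X \<longleftrightarrow> X 0 = lamp_origin \<and> (\<forall>i. X (Suc i) = X i \<or> lamplighter (X i) (X (Suc i)))"

text \<open>The vertices that can be reached, at any time, by visiting at most \<open>r\<close> sites.\<close>

definition endpoints :: "nat \<Rightarrow> ('d::finite) lamp_vertex set" where
  "endpoints r = {X n |X n. lamp_path X \<and> card (site_range X n) \<le> r}"

lemma lamps_subset_site_range:
  assumes "lamp_path X"
  shows "fset (snd (X n)) \<subseteq> site_range X n"
proof (induction n)
  case 0
  then show ?case using assms by (simp add: lamp_path_def lamp_origin_def)
next
  case (Suc n)
  have "X (Suc n) = X n \<or> lamplighter (X n) (X (Suc n))" using assms by (simp add: lamp_path_def)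
  then have "fset (snd (X (Suc n))) \<subseteq> insert (fst (X n)) (fset (snd (X n)))"
    by (auto simp: lamplighter_def fset_switch split: prod.splits)
  moreover have "fst (X n) \<in> site_range X (Suc n)" "site_range X n \<subseteq> site_range X (Suc n)"
    by (auto simp: site_range_def)
  ultimately show ?case using Suc by blast
qed

text \<open>The visited set is the image of a walk of \<open>2 * r\<close> steps on \<open>\<int>\<^sup>d\<close>, and both the lit lamps and the
  final position lie in it.\<close>

lemma card_endpoints_le:
  "finite (endpoints r :: ('d::finite) lamp_vertex set)"
  "card (endpoints r :: 'd lamp_vertex set) \<le> (4 * (2 * CARD('d) + 1)\<^sup>2) ^ r"
proof -
  define R where "R m m' \<longleftrightarrow> m' = m \<or> Zd_adj m m'" for m m' :: "int ^ 'd"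
  define D where "D = 2 * CARD('d) + 1"
  have R_eq: "{b. R a b} = insert a {b. Zd_adj a b}" for a by (auto simp: R_def)
  have finR: "finite {b. R a b}" for a unfolding R_eq by (simp add: Zd_nbrs_eq)
  have cardR: "card {b. R a b} \<le> D" for a
  proof -
    have f: "finite {b. Zd_adj a b}" by (simp add: Zd_nbrs_eq)
    show ?thesis unfolding R_eq D_def card_insert_if[OF f] card_Zd_nbrs by simp
  qed
  let ?W = "{w :: (int ^ 'd) list. length w = Suc (2 * r) \<and> hd w = 0 \<and> successively R w \<and> card (set w) \<le> r}"
  have sub': "?W \<subseteq> {w. length w = Suc (2 * r) \<and> hd w = 0 \<and> successively R w}" by auto
  have finW: "finite ?W" and cardW: "card ?W \<le> D ^ (2 * r)"
    using finite_subset[OF sub'] card_mono[OF _ sub'] card_walks_le[of R D "2 * r" 0, OF finR cardR]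
    by (auto intro: order_trans)
  let ?P = "\<lambda>w :: (int ^ 'd) list. set w \<times> {\<eta>. fset \<eta> \<subseteq> set w}"
  have finP: "finite {\<eta>. fset \<eta> \<subseteq> S}" and cardP: "card {\<eta>. fset \<eta> \<subseteq> S} \<le> 2 ^ card S"
    if "finite S" for S :: "(int ^ 'd) set"
  proof -
    have inj: "inj_on fset {\<eta>. fset \<eta> \<subseteq> S}" by (auto simp: inj_on_def fset_inject)
    have im: "fset ` {\<eta>. fset \<eta> \<subseteq> S} \<subseteq> Pow S" by auto
    show "finite {\<eta>. fset \<eta> \<subseteq> S}"
      using finite_imageD[OF finite_subset[OF im] inj] that by simp
    show "card {\<eta>. fset \<eta> \<subseteq> S} \<le> 2 ^ card S"
      using card_inj_on_le[OF inj im] that by (simp add: card_Pow)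
  qed
  have sub: "(endpoints r :: 'd lamp_vertex set) \<subseteq> (\<Union>w\<in>?W. ?P w)"
  proof
    fix y :: "'d lamp_vertex" assume "y \<in> endpoints r"
    then obtain X n where X: "lamp_path X" "card (site_range X n) \<le> r" "y = X n"
      by (auto simp: endpoints_def)
    define m where "m i = fst (X i)" for i
    have m: "m ` {..n} = site_range X n" by (simp add: m_def site_range_def)
    have Rm: "R (m i) (m (Suc i))" for i
    proof -
      have "X (Suc i) = X i \<or> lamplighter (X i) (X (Suc i))" using X(1) by (simp add: lamp_path_def)
      then show ?thesis by (auto simp: m_def R_def lamplighter_def split: prod.splits)
    qed
    have "\<exists>w. length w = Suc (2 * r) \<and> w \<noteq> [] \<and> hd w = m 0 \<and> successively R w \<and> set w = m ` {..n}"
    proof (rule covering_walk)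
      show "R a b \<Longrightarrow> R b a" for a b using Zd_adj_sym[of a b] by (auto simp: R_def)
    qed (use X(2) m Rm in \<open>auto simp: R_def\<close>)
    then obtain w where w: "length w = Suc (2 * r)" "hd w = m 0" "successively R w" "set w = m ` {..n}"
      by blast
    moreover have "m 0 = 0" using X(1) by (simp add: m_def lamp_path_def lamp_origin_def)
    ultimately have "w \<in> ?W" using X(2) m by simp
    moreover have "y \<in> ?P w"
      using lamps_subset_site_range[OF X(1), of n] w(4) m X(3)
      by (auto simp: site_range_def mem_Times_iff)
    ultimately show "y \<in> (\<Union>w\<in>?W. ?P w)" by blast
  qed
  have finU: "finite (\<Union>w\<in>?W. ?P w)" using finW finP by auto
  show "finite (endpoints r :: 'd lamp_vertex set)" by (rule finite_subset[OF sub finU])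
  have "card (endpoints r :: 'd lamp_vertex set) \<le> card (\<Union>w\<in>?W. ?P w)" by (rule card_mono[OF finU sub])
  also have "\<dots> \<le> (\<Sum>w\<in>?W. card (?P w))" by (rule card_UN_le[OF finW])
  also have "\<dots> \<le> (\<Sum>w\<in>?W. 4 ^ r)"
  proof (rule sum_mono)
    fix w assume "w \<in> ?W"
    then have c: "card (set w) \<le> r" by simp
    have "card (?P w) \<le> r * 2 ^ r"
      unfolding card_cartesian_product
      using c order_trans[OF cardP[of "set w"] power_increasing[OF c, of "2 :: nat"]]
      by (intro mult_le_mono) auto
    also have "\<dots> \<le> 2 ^ r * 2 ^ r" using less_exp[of r] by (intro mult_le_mono) auto
    also have "\<dots> = 4 ^ r" by (simp add: power_mult_distrib[symmetric])
    finally show "card (?P w) \<le> 4 ^ r" .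
  qed
  also have "\<dots> \<le> D ^ (2 * r) * 4 ^ r" using cardW by simp
  also have "\<dots> = (4 * D\<^sup>2) ^ r" by (simp add: power_mult power_mult_distrib)
  finally show "card (endpoints r :: 'd lamp_vertex set) \<le> (4 * (2 * CARD('d) + 1)\<^sup>2) ^ r" by (simp only: D_def)
qed


section \<open>Sublinear distance\<close>

lemma AE_lamp_path:
  "AE X in walk_law lamplighter \<omega> (lamp_origin :: ('d::finite) lamp_vertex). lamp_path X"
proof -
  define R where "R x y \<longleftrightarrow> y = x \<or> lamplighter x y" for x y :: "'d lamp_vertex"
  let ?W = "walk_law lamplighter \<omega> :: 'd lamp_vertex \<Rightarrow> _"
  have start: "AE X in ?W x. X 0 = x" for x
  proof -
    interpret prob_space "?W x" by (rule prob_space_walk_law)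
    have S: "{X. X 0 = x} \<in> sets (?W x)" by (simp add: walk_position_set)
    have "prob {X. X 0 = x} = 1" by (simp add: measure_walk_position)
    then show ?thesis using prob_eq_1[OF S] by simp
  qed
  have step: "AE X in ?W x. R (X i) (X (Suc i))" for i x
  proof -
    have S: "{X :: nat \<Rightarrow> 'd lamp_vertex. \<not> R (X i) (X (Suc i))} \<in> sets path_space" for i
      by (rule pred_path_sets) (rule measurable_path_pair)
    have "emeasure (?W x) {X. \<not> R (X i) (X (Suc i))} = 0"
    proof (induction i arbitrary: x)
      case 0
      have "emeasure (?W y) {X. \<not> R x (X 0)} = 0" if "R x y" for y
      proof -
        have "{X :: nat \<Rightarrow> 'd lamp_vertex. \<not> R x (X 0)} \<in> sets path_space"
          by (rule pred_path_sets, rule measurable_compose[OF measurable_component_singleton]) auto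
        moreover have "AE X in ?W y. \<not> \<not> R x (X 0)" using start[of y] that by auto
        ultimately show ?thesis using AE_iff_measurable[of "{X. \<not> R x (X 0)}" "?W y" "\<lambda>X. R x (X 0)"] by simp
      qed
      moreover have "R x y" if "y \<in> set_pmf (walk_step lamplighter \<omega> x)" for y
        using set_walk_step[OF degree_lamplighter(1) that] by (auto simp: R_def)
      ultimately have "(\<integral>\<^sup>+y. emeasure (?W y) {X. \<not> R x (X 0)} \<partial>walk_step lamplighter \<omega> x) = (\<integral>\<^sup>+y. 0 \<partial>walk_step lamplighter \<omega> x)"
        by (intro nn_integral_cong_AE) (simp add: AE_measure_pmf_iff)
      then show ?case by (subst emeasure_walk_law_first_step[OF S]) simp
    next
      case (Suc i)
      then show ?case by (subst emeasure_walk_law_first_step[OF S]) simp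
    qed
    then show ?thesis
      using AE_iff_measurable[of "{X. \<not> R (X i) (X (Suc i))}" "?W x" "\<lambda>X. R (X i) (X (Suc i))"] S by simp
  qed
  have "AE X in ?W lamp_origin. \<forall>i. R (X i) (X (Suc i))"
    using step by (simp add: AE_all_countable)
  with start[of lamp_origin] show ?thesis
    by eventually_elim (auto simp: lamp_path_def R_def)
qed

text \<open>If the range is at most \<open>r n\<close>, a small multiple of \<open>n\<close>, then \<open>X n\<close> is one of at most \<open>B ^ r n\<close> vertices,
  and those at distance at least \<open>e * n\<close> carry summable probability.\<close>

lemma quenched_distance_sublinear:
  fixes \<omega> :: "('d::finite) lamp_vertex set \<Rightarrow> bool"
  assumes nonempty: "open_nbrs lamplighter \<omega> (lamp_origin :: 'd lamp_vertex) \<noteq> {}"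
    and range: "AE X in walk_law lamplighter \<omega> (lamp_origin :: 'd lamp_vertex). \<forall>k.
      \<forall>\<^sub>F n in sequentially. real (card (site_range X n)) \<le> 1 / real (Suc k) * real n"
  shows "AE X in walk_law lamplighter \<omega> (lamp_origin :: 'd lamp_vertex).
    (\<lambda>n. real (cluster_dist lamplighter \<omega> lamp_origin (X n)) / real n) \<longlonglongrightarrow> 0"
proof -
  let ?o = "lamp_origin :: 'd lamp_vertex"
  let ?W = "walk_law lamplighter \<omega> ?o" and ?d = "cluster_dist lamplighter \<omega> ?o"
  interpret quenched_walk lamplighter \<omega> ?o
    by (rule quenched_walk.intro[OF lamplighter_sym degree_lamplighter(1) nonempty])
  interpret W: prob_space ?W by (rule prob_space_walk_law)
  define B where "B = real (4 * (2 * CARD('d) + 1)\<^sup>2)"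
  have B1: "1 < B"
  proof -
    have "1 < 4 * (2 * CARD('d) + 1)\<^sup>2" by (simp add: power2_eq_square)
    then show ?thesis unfolding B_def by linarith
  qed
  have deg_le: "real (deg lamplighter \<omega> x) \<le> real (2 * CARD('d) + 1)" for x
    by (intro of_nat_mono deg_lamplighter_le)
  have main: "AE X in ?W. \<forall>\<^sub>F n in sequentially. real (?d (X n)) < e * real n" if e: "0 < e" "e \<le> 1" for e
  proof -
    obtain C where C: "0 \<le> C" "\<And>n y. e * real n \<le> real (?d y) \<Longrightarrow> measure ?W {X. X n = y} \<le> C * exp (- (e\<^sup>2 / 8) * real n)"
      using transition_probability_bound[OF e deg_le] by blast
    \<comment> \<open>The range fraction \<open>1 / Suc k\<close> is so small that the number of endpoints costs only half the exponent.\<close>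
    obtain k where k: "16 * ln B / e\<^sup>2 < real (Suc k)" using reals_Archimedean2 less_SucI of_nat_less_iff by (metis less_trans lessI)
    define r where "r n = nat \<lfloor>1 / real (Suc k) * real n\<rfloor>" for n
    have r: "real (r n) \<le> 1 / real (Suc k) * real n" for n by (simp add: r_def)
    define F where "F n = {y \<in> endpoints (r n). e * real n \<le> real (?d y)}" for n
    have finF: "finite (F n)" for n
      unfolding F_def by (rule finite_subset[OF _ card_endpoints_le(1)[of "r n"]]) auto
    have UN: "{X. X n \<in> F n} = (\<Union>y\<in>F n. {X. X n = y})" for n by auto
    have setsF: "{X. X n \<in> F n} \<in> sets ?W" for n
      unfolding UN using finF by (auto intro: walk_position_set)
    have bound: "measure ?W {X. X n \<in> F n} \<le> C * exp (- (e\<^sup>2 / 16)) ^ n" for n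
    proof -
      have "measure ?W {X. X n \<in> F n} \<le> (\<Sum>y\<in>F n. measure ?W {X. X n = y})"
        unfolding UN using finF by (intro measure_UNION_le) (auto intro: walk_position_set)
      also have "\<dots> \<le> real (card (F n)) * (C * exp (- (e\<^sup>2 / 8) * real n))"
        by (rule sum_bounded_above, rule C(2)) (simp add: F_def)
      also have "real (card (F n)) \<le> B ^ r n"
      proof -
        have "card (F n) \<le> card (endpoints (r n) :: 'd lamp_vertex set)"
          by (intro card_mono card_endpoints_le(1)) (auto simp: F_def)
        also note card_endpoints_le(2)
        finally show ?thesis unfolding B_def by (simp only: of_nat_power[symmetric] of_nat_le_iff)
      qed
      also have "B ^ r n \<le> exp ((e\<^sup>2 / 16) * real n)"
      proof -
        have lnB: "0 < ln B" using B1 by simp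
        have "real (r n) * ln B \<le> 1 / real (Suc k) * real n * ln B"
          using r lnB by (intro mult_right_mono) auto
        also have "\<dots> = ln B / real (Suc k) * real n" by simp
        also have "\<dots> \<le> (e\<^sup>2 / 16) * real n"
          using k e(1) by (intro mult_right_mono) (simp_all add: field_simps)
        finally have "exp (real (r n) * ln B) \<le> exp ((e\<^sup>2 / 16) * real n)" by simp
        then show ?thesis using B1 by (simp add: exp_of_nat_mult)
      qed
      finally have "measure ?W {X. X n \<in> F n} \<le> exp ((e\<^sup>2 / 16) * real n) * (C * exp (- (e\<^sup>2 / 8) * real n))"
        using C(1) by (simp add: mult_right_mono)
      also have "\<dots> = C * (exp ((e\<^sup>2 / 16) * real n) * exp (- (e\<^sup>2 / 8) * real n))" by simp
      also have "exp ((e\<^sup>2 / 16) * real n) * exp (- (e\<^sup>2 / 8) * real n) = exp (real n * (- (e\<^sup>2 / 16)))"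
        unfolding exp_add[symmetric] by (simp add: field_simps)
      also have "\<dots> = exp (- (e\<^sup>2 / 16)) ^ n" by (rule exp_of_nat_mult)
      finally show ?thesis .
    qed
    have "summable (\<lambda>n. measure ?W {X. X n \<in> F n})"
    proof (rule summable_comparison_test')
      show "summable (\<lambda>n. C * exp (- (e\<^sup>2 / 16)) ^ n)"
        using e by (intro summable_mult summable_geometric) simp
    qed (use bound in auto)
    then have "AE X in ?W. \<forall>\<^sub>F n in sequentially. X \<in> space ?W - {X. X n \<in> F n}"
      using setsF by (intro borel_cantelli_AE1) (auto simp: W.emeasure_finite less_top[symmetric])
    with range AE_lamp_path[of \<omega>] show ?thesis
    proof eventually_elim
      case (elim X)
      from elim(1)[rule_format, of k] elim(3) show ?case
      proof eventually_elim
        case (elim n)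
        have "int (card (site_range X n)) \<le> \<lfloor>1 / real (Suc k) * real n\<rfloor>"
          using elim(1) by (simp only: le_floor_iff of_int_of_nat_eq)
        then have "card (site_range X n) \<le> r n" unfolding r_def by linarith
        then have "X n \<in> endpoints (r n)"
          unfolding endpoints_def using \<open>lamp_path X\<close> by blast
        then show ?case using elim(2) by (auto simp: F_def not_le)
      qed
    qed
  qed
  have "AE X in ?W. \<forall>k. \<forall>\<^sub>F n in sequentially. real (?d (X n)) < 1 / real (Suc k) * real n"
    unfolding AE_all_countable by (intro allI main) auto
  then show ?thesis
  proof eventually_elim
    case (elim X)
    show ?case
    proof (rule LIMSEQ_I)
      fix e :: real assume "0 < e"
      then obtain k where k: "1 / real (Suc k) < e" using nat_approx_posE by blast
      from elim[rule_format, of k] obtain N where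
        N: "real (?d (X n)) < 1 / real (Suc k) * real n" if "n \<ge> N" for n
        by (auto simp: eventually_sequentially)
      have "norm (real (?d (X n)) / real n - 0) < e" if "n \<ge> max 1 N" for n
      proof -
        have "real (?d (X n)) < 1 / real (Suc k) * real n" using N that by simp
        also have "\<dots> \<le> e * real n" using k by (intro mult_right_mono) auto
        finally show ?thesis using that by (simp add: divide_less_eq)
      qed
      then show "\<exists>N. \<forall>n\<ge>N. norm (real (?d (X n)) / real n - 0) < e" by blast
    qed
  qed
qed

lemma measurable_cluster_dist:
  fixes G :: "'v::countable \<Rightarrow> 'v \<Rightarrow> bool"
  shows "(\<lambda>\<omega>. cluster_dist G \<omega> x y) \<in> measurable (percolation G p) (count_space UNIV)"
proof -
  note [measurable] = measurable_open_adj
  have "Measurable.pred (percolation G p) (\<lambda>\<omega>. (open_adj G \<omega> ^^ n) x y)" for n y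
  proof (induction n arbitrary: y)
    case (Suc n)
    note Suc[measurable]
    have "(open_adj G \<omega> ^^ Suc n) x y \<longleftrightarrow> (\<exists>z. (open_adj G \<omega> ^^ n) x z \<and> open_adj G \<omega> z y)" for \<omega>
      by auto
    then show ?case by simp
  qed simp
  then show ?thesis unfolding cluster_dist_def by measurable
qed

lemma infinite_cluster_not_isolated:
  assumes "infinite (cluster G \<omega> x)"
  shows "open_nbrs G \<omega> x \<noteq> {}"
proof
  assume "open_nbrs G \<omega> x = {}"
  then have "\<not> open_adj G \<omega> x y" for y by (auto simp: open_nbrs_def)
  then have "cluster G \<omega> x = {x}"
    by (auto simp: cluster_def elim: converse_rtranclpE)
  then show False using assms by simp
qed

theorem theorem1p5:
  fixes p :: real
  assumes "CARD('d::finite) \<in> {1, 2}"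
    and "p \<in> {0..1}"
    and "p > critical_prob (lamplighter :: 'd lamp_vertex \<Rightarrow> 'd lamp_vertex \<Rightarrow> bool)"
  shows "AE (\<omega>, X) in percolation_walk lamplighter p (lamp_origin :: 'd lamp_vertex).
           infinite (cluster lamplighter \<omega> lamp_origin) \<longrightarrow>
           (\<lambda>n. real (cluster_dist lamplighter \<omega> lamp_origin (X n)) / real n) \<longlonglongrightarrow> 0"
proof -
  let ?G = "lamplighter :: 'd lamp_vertex \<Rightarrow> _" and ?o = "lamp_origin :: 'd lamp_vertex"
  let ?P = "percolation ?G p" and ?\<mu> = "biased_walk_law p :: (nat \<Rightarrow> 'd lamp_vertex) measure"
  let ?d = "\<lambda>\<omega> x. cluster_dist ?G \<omega> ?o x"
  let ?range = "\<lambda>X :: nat \<Rightarrow> 'd lamp_vertex. \<forall>k. \<forall>\<^sub>F n in sequentially. real (card (site_range X n)) \<le> 1 / real (Suc k) * real n"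
  let ?zero = "\<lambda>\<omega> X. (\<lambda>n. real (?d \<omega> (X n)) / real n) \<longlonglongrightarrow> 0"
  have "AE X in ?\<mu>. ?range X"
    unfolding AE_all_countable
    by (intro allI AE_site_range_sublinear no_return_tendsto_0 assms(1)) simp
  \<comment> \<open>Passing to a null set \<open>N\<close> avoids the measurability of the event on the range.\<close>
  then obtain N where N: "\<And>X. X \<notin> N \<Longrightarrow> ?range X" "N \<in> null_sets ?\<mu>"
    by (rule AE_E3) auto
  have "AE X in ?\<mu>. X \<notin> N" using N(2) by (rule AE_not_in)
  moreover have "Measurable.pred path_space (\<lambda>X. X \<notin> N)"
    using null_setsD2[OF N(2)] by simp
  ultimately have "AE \<omega> in density ?P (\<lambda>\<omega>. ennreal (deg ?G \<omega> ?o)). AE X in walk_law ?G \<omega> ?o. X \<notin> N"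
    unfolding biased_walk_law_def by (subst (asm) AE_bind[OF biased_kernel_measurable])
  moreover have "(\<lambda>\<omega>. ennreal (deg ?G \<omega> ?o)) \<in> borel_measurable ?P"
    using measurable_deg[of ?G ?o, OF degree_lamplighter(1)] by measurable
  ultimately have "AE \<omega> in ?P. 0 < ennreal (deg ?G \<omega> ?o) \<longrightarrow> (AE X in walk_law ?G \<omega> ?o. X \<notin> N)"
    by (subst (asm) AE_density)
  then have quenched: "AE \<omega> in ?P. open_nbrs ?G \<omega> ?o \<noteq> {} \<longrightarrow> (AE X in walk_law ?G \<omega> ?o. ?zero \<omega> X)"
  proof eventually_elim
    case (elim \<omega>)
    show ?case
    proof
      assume ne: "open_nbrs ?G \<omega> ?o \<noteq> {}"
      then have "0 < deg ?G \<omega> ?o"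
        using finite_open_nbrs[of ?G ?o \<omega>, OF degree_lamplighter(1)] by (simp add: card_gt_0_iff)
      then have "AE X in walk_law ?G \<omega> ?o. X \<notin> N" using elim by simp
      then have "AE X in walk_law ?G \<omega> ?o. ?range X" by eventually_elim (rule N(1))
      from quenched_distance_sublinear[OF ne this] show "AE X in walk_law ?G \<omega> ?o. ?zero \<omega> X" .
    qed
  qed
  \<comment> \<open>Replacing infiniteness of the cluster by the weaker condition that the origin is not isolated makes
    the measurability of the event easy.\<close>
  let ?Q = "\<lambda>z. open_nbrs ?G (fst z) ?o \<noteq> {} \<longrightarrow> ?zero (fst z) (snd z)"
  have mQ: "Measurable.pred (?P \<Otimes>\<^sub>M path_space) ?Q"
  proof -
    have d: "(\<lambda>z. ?d (fst z) (snd z n)) \<in> measurable (?P \<Otimes>\<^sub>M path_space) (count_space UNIV)" for n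
    proof (rule measurable_compose_countable[where g="\<lambda>z. snd z n" and f="\<lambda>x z. ?d (fst z) x"])
      show "(\<lambda>z. ?d (fst z) x) \<in> measurable (?P \<Otimes>\<^sub>M path_space) (count_space UNIV)" for x
        by (rule measurable_compose[OF measurable_fst measurable_cluster_dist])
      show "(\<lambda>z. snd z n) \<in> measurable (?P \<Otimes>\<^sub>M path_space) (count_space UNIV)"
        by (rule measurable_compose[OF measurable_snd measurable_component_singleton]) simp
    qed
    have q: "(\<lambda>z. real (?d (fst z) (snd z n)) / real n) \<in> borel_measurable (?P \<Otimes>\<^sub>M path_space)" for n
      by (rule measurable_compose[OF d]) simp
    have "(\<lambda>\<omega>. real (deg ?G \<omega> ?o)) \<in> borel_measurable ?P" by (rule measurable_deg[of ?G ?o, OF degree_lamplighter(1)])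
    then have "Measurable.pred ?P (\<lambda>\<omega>. real (deg ?G \<omega> ?o) \<noteq> 0)" by measurable
    then have "Measurable.pred ?P (\<lambda>\<omega>. open_nbrs ?G \<omega> ?o \<noteq> {})"
      using finite_open_nbrs[of ?G ?o, OF degree_lamplighter(1)] by simp
    from measurable_compose[OF measurable_fst this, of path_space]
    have "Measurable.pred (?P \<Otimes>\<^sub>M path_space) (\<lambda>z. open_nbrs ?G (fst z) ?o \<noteq> {})" .
    moreover have "Measurable.pred (?P \<Otimes>\<^sub>M path_space) (\<lambda>z. ?zero (fst z) (snd z))"
      using q by measurable
    ultimately show ?thesis by measurable
  qed
  have "AE \<omega> in ?P. AE z in distr (walk_law ?G \<omega> ?o) (?P \<Otimes>\<^sub>M path_space) (\<lambda>X. (\<omega>, X)). ?Q z"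
    using quenched AE_space
  proof eventually_elim
    case (elim \<omega>)
    have m: "(\<lambda>X. (\<omega>, X)) \<in> measurable (walk_law ?G \<omega> ?o) (?P \<Otimes>\<^sub>M path_space)"
      unfolding measurable_cong_sets[OF sets_walk_law refl] using elim(2) by (rule measurable_Pair1')
    show ?case using elim(1) by (subst AE_distr_iff[OF m predE[OF mQ]]) auto
  qed
  then have "AE z in percolation_walk ?G p ?o. ?Q z"
    unfolding percolation_walk_def
    by (subst AE_bind[OF measurable_percolation_walk_kernel[OF degree_lamplighter(1)] mQ])
  then show ?thesis
    by eventually_elim (auto dest: infinite_cluster_not_isolated)
qed

end
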